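(* Let $\Lambda$ be a finite, locally convex $k$-graph. Suppose that $\Lambda$ is cofinal and has no local periodicity (equivalently, $C^*(\Lambda)$ is simple). Then $sr(C^*(\Lambda))=1$ if $\Lambda$ contains no cycles, and $sr(C^*(\Lambda))=\infty$ otherwise.
   Context: A $k$-graph ($k\ge1$) is a nonempty countable small category $\Lambda$ with a functor $d:\Lambda\to\mathbb{N}^k$ such that whenever $d(\lambda)=m+n$ there are unique $\mu,\nu\in\Lambda$ with $d(\mu)=m$, $d(\nu)=n$, $\lambda=\mu\nu$. $\Lambda^n:=d^{-1}(n)$; $\Lambda^0$ (the vertices) is identified with the objects; $r(\lambda),s(\lambda)$ are the codomain and domain of $\lambda$; $e_1,\dots,e_k$ are the generators of $\mathbb{N}^k$. For $v\in\Lambda^0$, $E\subseteq\Lambda$: $vE=\{\nu\in E: r(\nu)=v\}$. For $n\in\mathbb{N}^k$, $\Lambda^{\le n}:=\{\lambda: d(\lambda)\le n,\ s(\lambda)\Lambda^{e_i}=\emptyset \text{ whenever } d(\lambda)+e_i\le n\}$. $\Lambda$ is finite if $|\Lambda^n|<\infty$ for all $n$; locally convex if for all $i\ne j$, $\lambda\in\Lambda^{e_i}$, $\mu\in\Lambda^{e_j}$ with $r(\lambda)=r(\mu)$, the sets $s(\lambda)\Lambda^{e_j}$ and $s(\mu)\Lambda^{e_i}$ are nonempty. A cycle is $\lambda\in\Lambda\setminus\Lambda^0$ with $r(\lambda)=s(\lambda)$. $\Lambda$ is cofinal if for all $v,w\in\Lambda^0$ there is $n\in\mathbb{N}^k$ with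 $s(w\Lambda^{\le n})\subseteq s(v\Lambda)$. For $m\in(\mathbb{N}\cup\{\infty\})^k$, a path $x$ of degree $d(x)=m$ is a degree-preserving functor $x:\{(p,q)\in\mathbb{N}^k\times\mathbb{N}^k:p\le q\le m\}\to\Lambda$ (where $(p,q)$ has range $p$, source $q$, degree $q-p$); write $x(p)=x(p,p)$, $r(x)=x(0)$. $\Lambda^{\le\infty}$ is the set of all paths $x$ (of any degree in $(\mathbb{N}\cup\{\infty\})^k$) such that $x(n)\Lambda^{e_i}=\emptyset$ whenever $n\in\mathbb{N}^k$, $n\le d(x)$ and $n_i=d(x)_i$; $v\Lambda^{\le\infty}=\{x\in\Lambda^{\le\infty}:r(x)=v\}$. For $n\le d(x)$, $\sigma^n(x)$ is the path of degree $d(x)-n$ (with $\infty-a=\infty$) given by $\sigma^n(x)(p,q)=x(n+p,n+q)$. $\Lambda$ has local periodicity $m,n$ at $v$ if for every $x\in v\Lambda^{\le\infty}$, $m-(m\wedge d(x))=n-(n\wedge d(x))$ and $\sigma^{m\wedge d(x)}(x)=\sigma^{n\wedge d(x)}(x)$, where $\wedge$ is the coordinatewise minimum. $\Lambda$ has no local periodicity if it fails to have local periodicity $m,n$ at $v$ for all $m\ne n\in\mathbb{N}^k$ and all $v\in\Lambda^0$. It is a known theorem that $\Lambda$ is cofinal with no local periodicity if and only if $C^*(\Lambda)$ is simple. $C^*(\Lambda)$ is the universal $C^*$-algebra generated by $\{s_\lambda:\lambda\in\Lambda\}$ subject to: the $s_v$, $v\in\Lambda^0$, are mutually orthogonal projections;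 $s_\mu s_\nu=s_{\mu\nu}$ if $s(\mu)=r(\nu)$; $s_\lambda^*s_\lambda=s_{s(\lambda)}$; $s_v=\sum_{\lambda\in v\Lambda^{\le n}}s_\lambda s_\lambda^*$ for all $v\in\Lambda^0$, $n\in\mathbb{N}^k$. It is unital here since $\Lambda^0$ is finite. Stable rank: for unital $A$, $Lg_n(A)=\{(x_i)\in A^n:\exists (y_i)\in A^n,\ \sum_i y_ix_i=1\}$, and $sr(A)$ is the smallest $n\ge1$ such that $Lg_n(A)$ is dense in $A^n$, or $\infty$ if there is none. *)

theory Defs
  imports
    Complex_Main
    "HOL-Library.Countable_Set"
    "HOL-Library.Extended_Nat"
    "HOL-Library.FuncSet"
    "HOL-Library.Function_Algebras"
    "HOL-Library.Poly_Mapping"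
    "HOL-Algebra.Module"
begin

section \<open>Higher-rank graphs\<close>

text \<open>
  \<open>\<nat>\<^sup>k\<close> is the type \<open>'k \<Rightarrow> nat\<close> for a finite index type \<open>'k\<close>, so that \<open>k \<ge> 1\<close>; order, sum and
  (truncated) difference are pointwise.  A small category is given by its morphisms, an object
  being identified with its identity morphism; \<open>rg\<close> is the codomain, \<open>sc\<close> the domain, and the
  product \<open>cmp \<Lambda> \<mu> \<nu>\<close> is meaningful when \<open>sc \<Lambda> \<mu> = rg \<Lambda> \<nu>\<close>.  In a k-graph the identity
  morphisms are exactly the morphisms of degree \<open>0\<close>, by unique factorisation.
\<close>

record ('l, 'k) kgraph =
  mor :: "'l set"
  rg :: "'l \<Rightarrow> 'l"
  sc :: "'l \<Rightarrow> 'l"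
  cmp :: "'l \<Rightarrow> 'l \<Rightarrow> 'l"
  dg :: "'l \<Rightarrow> 'k \<Rightarrow> nat"

locale small_category =
  fixes \<Lambda> :: "('l, 'k) kgraph"
  assumes rg_closed: "\<xi> \<in> mor \<Lambda> \<Longrightarrow> rg \<Lambda> \<xi> \<in> mor \<Lambda>"
    and sc_closed: "\<xi> \<in> mor \<Lambda> \<Longrightarrow> sc \<Lambda> \<xi> \<in> mor \<Lambda>"
    and rg_rg: "\<xi> \<in> mor \<Lambda> \<Longrightarrow> rg \<Lambda> (rg \<Lambda> \<xi>) = rg \<Lambda> \<xi>"
    and sc_rg: "\<xi> \<in> mor \<Lambda> \<Longrightarrow> sc \<Lambda> (rg \<Lambda> \<xi>) = rg \<Lambda> \<xi>"
    and rg_sc: "\<xi> \<in> mor \<Lambda> \<Longrightarrow> rg \<Lambda> (sc \<Lambda> \<xi>) = sc \<Lambda> \<xi>"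
    and sc_sc: "\<xi> \<in> mor \<Lambda> \<Longrightarrow> sc \<Lambda> (sc \<Lambda> \<xi>) = sc \<Lambda> \<xi>"
    and cmp_closed: "\<lbrakk>\<mu> \<in> mor \<Lambda>; \<nu> \<in> mor \<Lambda>; sc \<Lambda> \<mu> = rg \<Lambda> \<nu>\<rbrakk>
      \<Longrightarrow> cmp \<Lambda> \<mu> \<nu> \<in> mor \<Lambda>"
    and rg_cmp: "\<lbrakk>\<mu> \<in> mor \<Lambda>; \<nu> \<in> mor \<Lambda>; sc \<Lambda> \<mu> = rg \<Lambda> \<nu>\<rbrakk>
      \<Longrightarrow> rg \<Lambda> (cmp \<Lambda> \<mu> \<nu>) = rg \<Lambda> \<mu>"
    and sc_cmp: "\<lbrakk>\<mu> \<in> mor \<Lambda>; \<nu> \<in> mor \<Lambda>; sc \<Lambda> \<mu> = rg \<Lambda> \<nu>\<rbrakk>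
      \<Longrightarrow> sc \<Lambda> (cmp \<Lambda> \<mu> \<nu>) = sc \<Lambda> \<nu>"
    and cmp_assoc: "\<lbrakk>\<xi> \<in> mor \<Lambda>; \<mu> \<in> mor \<Lambda>; \<nu> \<in> mor \<Lambda>;
        sc \<Lambda> \<xi> = rg \<Lambda> \<mu>; sc \<Lambda> \<mu> = rg \<Lambda> \<nu>\<rbrakk>
      \<Longrightarrow> cmp \<Lambda> (cmp \<Lambda> \<xi> \<mu>) \<nu> = cmp \<Lambda> \<xi> (cmp \<Lambda> \<mu> \<nu>)"
    and rg_cmp_id: "\<xi> \<in> mor \<Lambda> \<Longrightarrow> cmp \<Lambda> (rg \<Lambda> \<xi>) \<xi> = \<xi>"
    and cmp_sc_id: "\<xi> \<in> mor \<Lambda> \<Longrightarrow> cmp \<Lambda> \<xi> (sc \<Lambda> \<xi>) = \<xi>"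

locale k_graph = small_category \<Lambda> for \<Lambda> :: "('l, 'k::finite) kgraph" +
  assumes nonempty: "mor \<Lambda> \<noteq> {}"
    and countable: "countable (mor \<Lambda>)"
    and dg_id: "\<xi> \<in> mor \<Lambda> \<Longrightarrow> dg \<Lambda> (rg \<Lambda> \<xi>) = 0"
    and dg_cmp: "\<lbrakk>\<mu> \<in> mor \<Lambda>; \<nu> \<in> mor \<Lambda>; sc \<Lambda> \<mu> = rg \<Lambda> \<nu>\<rbrakk>
      \<Longrightarrow> dg \<Lambda> (cmp \<Lambda> \<mu> \<nu>) = dg \<Lambda> \<mu> + dg \<Lambda> \<nu>"
    and factorisation: "\<lbrakk>\<xi> \<in> mor \<Lambda>; dg \<Lambda> \<xi> = m + n\<rbrakk>
      \<Longrightarrow> \<exists>!(\<mu>, \<nu>). \<mu> \<in> mor \<Lambda> \<and> \<nu> \<in> mor \<Lambda> \<and> sc \<Lambda> \<mu> = rg \<Lambda> \<nu> \<and>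
            dg \<Lambda> \<mu> = m \<and> dg \<Lambda> \<nu> = n \<and> \<xi> = cmp \<Lambda> \<mu> \<nu>"

definition unit_deg :: "'k \<Rightarrow> 'k \<Rightarrow> nat" where
  "unit_deg i = (\<lambda>j. if j = i then 1 else 0)"

definition of_degree :: "('l, 'k) kgraph \<Rightarrow> ('k \<Rightarrow> nat) \<Rightarrow> 'l set" where
  "of_degree \<Lambda> n = {\<xi> \<in> mor \<Lambda>. dg \<Lambda> \<xi> = n}"

abbreviation vertices :: "('l, 'k) kgraph \<Rightarrow> 'l set" where
  "vertices \<Lambda> \<equiv> of_degree \<Lambda> 0"

text \<open>The set \<open>vE\<close>.\<close>

definition with_range :: "('l, 'k) kgraph \<Rightarrow> 'l \<Rightarrow> 'l set \<Rightarrow> 'l set" where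
  "with_range \<Lambda> v E = {\<nu> \<in> E. rg \<Lambda> \<nu> = v}"

text \<open>The set \<open>\<Lambda>\<close> with superscript \<open>\<le> n\<close>.\<close>

definition upto_degree :: "('l, 'k) kgraph \<Rightarrow> ('k \<Rightarrow> nat) \<Rightarrow> 'l set" where
  "upto_degree \<Lambda> n = {\<xi> \<in> mor \<Lambda>. dg \<Lambda> \<xi> \<le> n \<and>
     (\<forall>i. dg \<Lambda> \<xi> + unit_deg i \<le> n \<longrightarrow> with_range \<Lambda> (sc \<Lambda> \<xi>) (of_degree \<Lambda> (unit_deg i)) = {})}"

definition finite_kgraph :: "('l, 'k) kgraph \<Rightarrow> bool" where
  "finite_kgraph \<Lambda> \<longleftrightarrow> (\<forall>n. finite (of_degree \<Lambda> n))"

definition locally_convex :: "('l, 'k) kgraph \<Rightarrow> bool" where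
  "locally_convex \<Lambda> \<longleftrightarrow>
     (\<forall>i j. i \<noteq> j \<longrightarrow>
       (\<forall>\<xi>\<in>of_degree \<Lambda> (unit_deg i). \<forall>\<mu>\<in>of_degree \<Lambda> (unit_deg j). rg \<Lambda> \<xi> = rg \<Lambda> \<mu> \<longrightarrow>
          with_range \<Lambda> (sc \<Lambda> \<xi>) (of_degree \<Lambda> (unit_deg j)) \<noteq> {} \<and>
          with_range \<Lambda> (sc \<Lambda> \<mu>) (of_degree \<Lambda> (unit_deg i)) \<noteq> {}))"

definition is_cycle :: "('l, 'k) kgraph \<Rightarrow> 'l \<Rightarrow> bool" where
  "is_cycle \<Lambda> \<xi> \<longleftrightarrow> \<xi> \<in> mor \<Lambda> - vertices \<Lambda> \<and> rg \<Lambda> \<xi> = sc \<Lambda> \<xi>"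

definition cofinal_kgraph :: "('l, 'k) kgraph \<Rightarrow> bool" where
  "cofinal_kgraph \<Lambda> \<longleftrightarrow> (\<forall>v\<in>vertices \<Lambda>. \<forall>w\<in>vertices \<Lambda>. \<exists>n.
     sc \<Lambda> ` with_range \<Lambda> w (upto_degree \<Lambda> n) \<subseteq> sc \<Lambda> ` with_range \<Lambda> v (mor \<Lambda>))"


section \<open>Paths of possibly infinite degree and local periodicity\<close>

text \<open>
  A path is its degree together with a functor on \<open>deg_pairs\<close> of that degree, extended by
  \<^term>\<open>undefined\<close>, so that HOL equality of paths is equality of functors with equal domains.
\<close>

type_synonym ('l, 'k) path = "('k \<Rightarrow> enat) \<times> (('k \<Rightarrow> nat) \<times> ('k \<Rightarrow> nat) \<Rightarrow> 'l)"

definition to_enat :: "('k \<Rightarrow> nat) \<Rightarrow> 'k \<Rightarrow> enat" where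
  "to_enat n = (\<lambda>i. enat (n i))"

definition deg_pairs :: "('k \<Rightarrow> enat) \<Rightarrow> (('k \<Rightarrow> nat) \<times> ('k \<Rightarrow> nat)) set" where
  "deg_pairs m = {(p, q). p \<le> q \<and> to_enat q \<le> m}"

definition is_path :: "('l, 'k) kgraph \<Rightarrow> ('l, 'k) path \<Rightarrow> bool" where
  "is_path \<Lambda> = (\<lambda>(m, x). x \<in> extensional (deg_pairs m) \<and>
     (\<forall>(p, q)\<in>deg_pairs m. x (p, q) \<in> mor \<Lambda> \<and> dg \<Lambda> (x (p, q)) = q - p \<and>
        rg \<Lambda> (x (p, q)) = x (p, p) \<and> sc \<Lambda> (x (p, q)) = x (q, q)) \<and>
     (\<forall>p q t. (p, q) \<in> deg_pairs m \<and> (q, t) \<in> deg_pairs m \<longrightarrow>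
        x (p, t) = cmp \<Lambda> (x (p, q)) (x (q, t))))"

definition boundary_paths :: "('l, 'k) kgraph \<Rightarrow> ('l, 'k) path set" where
  "boundary_paths \<Lambda> = {(m, x). is_path \<Lambda> (m, x) \<and>
     (\<forall>n i. to_enat n \<le> m \<and> enat (n i) = m i \<longrightarrow>
        with_range \<Lambda> (x (n, n)) (of_degree \<Lambda> (unit_deg i)) = {})}"

definition boundary_paths_at :: "('l, 'k) kgraph \<Rightarrow> 'l \<Rightarrow> ('l, 'k) path set" where
  "boundary_paths_at \<Lambda> v = {(m, x) \<in> boundary_paths \<Lambda>. x (0, 0) = v}"

definition shift :: "('k \<Rightarrow> nat) \<Rightarrow> ('l, 'k) path \<Rightarrow> ('l, 'k) path" where
  "shift n = (\<lambda>(m, x). let m' = (\<lambda>i. m i - enat (n i))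
     in (m', restrict (\<lambda>(p, q). x (n + p, n + q)) (deg_pairs m')))"

definition deg_meet :: "('k \<Rightarrow> nat) \<Rightarrow> ('k \<Rightarrow> enat) \<Rightarrow> 'k \<Rightarrow> nat" where
  "deg_meet n m = (\<lambda>i. the_enat (min (enat (n i)) (m i)))"

definition local_periodicity :: "('l, 'k) kgraph \<Rightarrow> ('k \<Rightarrow> nat) \<Rightarrow> ('k \<Rightarrow> nat) \<Rightarrow> 'l \<Rightarrow> bool" where
  "local_periodicity \<Lambda> m n v \<longleftrightarrow> (\<forall>x\<in>boundary_paths_at \<Lambda> v.
     m - deg_meet m (fst x) = n - deg_meet n (fst x) \<and>
     shift (deg_meet m (fst x)) x = shift (deg_meet n (fst x)) x)"

definition no_local_periodicity :: "('l, 'k) kgraph \<Rightarrow> bool" where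
  "no_local_periodicity \<Lambda> \<longleftrightarrow>
     (\<forall>m n. \<forall>v\<in>vertices \<Lambda>. m \<noteq> n \<longrightarrow> \<not> local_periodicity \<Lambda> m n v)"


section \<open>Normed *-algebras with carriers, and stable rank\<close>

record 'a star_algebra = "(complex, 'a) module" +
  adj :: "'a \<Rightarrow> 'a"
  nrm :: "'a \<Rightarrow> real"

text \<open>Tuples in \<open>A\<^sup>n\<close> are functions on \<open>{..<n}\<close>.\<close>

definition Lg :: "('a, 'b) star_algebra_scheme \<Rightarrow> nat \<Rightarrow> (nat \<Rightarrow> 'a) set" where
  "Lg A n = {x \<in> {..<n} \<rightarrow>\<^sub>E carrier A. \<exists>y \<in> {..<n} \<rightarrow>\<^sub>E carrier A.
     (\<Oplus>\<^bsub>A\<^esub>i\<in>{..<n}. y i \<otimes>\<^bsub>A\<^esub> x i) = \<one>\<^bsub>A\<^esub>}"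

definition Lg_dense :: "('a, 'b) star_algebra_scheme \<Rightarrow> nat \<Rightarrow> bool" where
  "Lg_dense A n \<longleftrightarrow> (\<forall>x \<in> {..<n} \<rightarrow>\<^sub>E carrier A. \<forall>\<epsilon>>0. \<exists>z\<in>Lg A n.
     \<forall>i<n. nrm A (x i \<ominus>\<^bsub>A\<^esub> z i) < \<epsilon>)"

text \<open>The infimum of the empty set is \<open>\<infinity>\<close>.\<close>

definition stable_rank :: "('a, 'b) star_algebra_scheme \<Rightarrow> enat" where
  "stable_rank A = Inf {enat n |n. n \<ge> 1 \<and> Lg_dense A n}"


section \<open>The free *-algebra on a set of generators\<close>

text \<open>
  The monoid of words is written additively, so that \<^typ>\<open>'a list \<Rightarrow>\<^sub>0 complex\<close>, finitely supported
  functions on words with convolution product, is the free unital algebra on \<open>'a\<close>.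
\<close>

instantiation list :: (type) monoid_add
begin

definition zero_list_def: "(0 :: 'a list) = []"
definition plus_list_def: "(u :: 'a list) + w = u @ w"

instance by standard (simp_all add: zero_list_def plus_list_def)

end

text \<open>
  The letter \<open>(l, False)\<close> stands for the generator \<open>l\<close> and \<open>(l, True)\<close> for its formal adjoint.
\<close>

type_synonym 'l star_poly = "('l \<times> bool) list \<Rightarrow>\<^sub>0 complex"

definition gen :: "'l \<Rightarrow> 'l star_poly" where
  "gen l = Poly_Mapping.single [(l, False)] 1"

definition sp_scale :: "complex \<Rightarrow> 'l star_poly \<Rightarrow> 'l star_poly" where
  "sp_scale c f = Poly_Mapping.map ((*) c) f"

definition sp_adj :: "'l star_poly \<Rightarrow> 'l star_poly" where
  "sp_adj f = (\<Sum>w\<in>Poly_Mapping.keys f.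
     Poly_Mapping.single (rev (map (\<lambda>(l, b). (l, \<not> b)) w)) (cnj (Poly_Mapping.lookup f w)))"

text \<open>The free (non-unital) *-algebra on the generators in \<open>G\<close>: no constant term is allowed.\<close>

definition free_star :: "'l set \<Rightarrow> 'l star_poly set" where
  "free_star G = {f. Poly_Mapping.keys f \<subseteq> lists (G \<times> UNIV) - {[]}}"

definition cstar_seminorm :: "'l set \<Rightarrow> ('l star_poly \<Rightarrow> real) \<Rightarrow> bool" where
  "cstar_seminorm G \<rho> \<longleftrightarrow> (\<forall>f\<in>free_star G.
     \<rho> f \<ge> 0 \<and> (\<forall>c. \<rho> (sp_scale c f) = cmod c * \<rho> f) \<and> \<rho> (sp_adj f * f) = (\<rho> f)\<^sup>2 \<and>
     (\<forall>g\<in>free_star G. \<rho> (f + g) \<le> \<rho> f + \<rho> g \<and> \<rho> (f * g) \<le> \<rho> f * \<rho> g))"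


section \<open>Universal C*-algebras\<close>

text \<open>
  The universal C*-algebra on generators \<open>G\<close> subject to relations \<open>R\<close> (elements of the free
  *-algebra to be annihilated) is the Hausdorff completion of the free *-algebra in the largest
  C*-seminorm that vanishes on \<open>R\<close>.  A C*-seminorm vanishing on \<open>R\<close> is the same thing as
  \<open>f \<mapsto> \<parallel>\<pi>(f)\<parallel>\<close> for a *-homomorphism \<open>\<pi>\<close> into a C*-algebra satisfying the relations, so quantifying
  over seminorms avoids quantifying over the types of the target algebras.  The supremum is meant
  for relations that bound every generator, such as the ones used below.
\<close>

definition univ_norm :: "'l set \<Rightarrow> 'l star_poly set \<Rightarrow> 'l star_poly \<Rightarrow> real" where
  "univ_norm G R f = (SUP \<rho> \<in> {\<rho>. cstar_seminorm G \<rho> \<and> (\<forall>h\<in>R. \<rho> h = 0)}. \<rho> f)"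

definition cauchy_seqs :: "'l set \<Rightarrow> 'l star_poly set \<Rightarrow> (nat \<Rightarrow> 'l star_poly) set" where
  "cauchy_seqs G R = {X. (\<forall>n. X n \<in> free_star G) \<and>
     (\<forall>\<epsilon>>0. \<exists>N. \<forall>m\<ge>N. \<forall>n\<ge>N. univ_norm G R (X m - X n) < \<epsilon>)}"

definition null_class :: "'l set \<Rightarrow> 'l star_poly set \<Rightarrow> (nat \<Rightarrow> 'l star_poly) \<Rightarrow>
    (nat \<Rightarrow> 'l star_poly) set" where
  "null_class G R X = {Y \<in> cauchy_seqs G R. (\<lambda>n. univ_norm G R (X n - Y n)) \<longlonglongrightarrow> 0}"

text \<open>
  The algebra need not be unital; \<open>e\<close> is the polynomial whose class is put into the field \<open>one\<close>.
  The unions below are over representatives of classes, and all have the same value.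
\<close>

definition univ_cstar :: "'l set \<Rightarrow> 'l star_poly set \<Rightarrow> 'l star_poly \<Rightarrow>
    (nat \<Rightarrow> 'l star_poly) set star_algebra" where
  "univ_cstar G R e =
     \<lparr> carrier = null_class G R ` cauchy_seqs G R,
       mult = (\<lambda>P Q. \<Union>X\<in>P. \<Union>Y\<in>Q. null_class G R (\<lambda>n. X n * Y n)),
       one = null_class G R (\<lambda>_. e),
       zero = null_class G R (\<lambda>_. 0),
       add = (\<lambda>P Q. \<Union>X\<in>P. \<Union>Y\<in>Q. null_class G R (\<lambda>n. X n + Y n)),
       smult = (\<lambda>c P. \<Union>X\<in>P. null_class G R (\<lambda>n. sp_scale c (X n))),
       adj = (\<lambda>P. \<Union>X\<in>P. null_class G R (\<lambda>n. sp_adj (X n))),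
       nrm = (\<lambda>P. THE r. \<forall>X\<in>P. (\<lambda>n. univ_norm G R (X n)) \<longlonglongrightarrow> r) \<rparr>"


section \<open>The C*-algebra of a higher-rank graph\<close>

text \<open>
  A relation \<open>a = b\<close> is recorded as \<open>a - b\<close>.  The sums are over finite sets when \<open>\<Lambda>\<close> is finite.
\<close>

definition ck_relations :: "('l, 'k) kgraph \<Rightarrow> 'l star_poly set" where
  "ck_relations \<Lambda> =
     {gen v * gen v - gen v |v. v \<in> vertices \<Lambda>} \<union>
     {sp_adj (gen v) - gen v |v. v \<in> vertices \<Lambda>} \<union>
     {gen v * gen w |v w. v \<in> vertices \<Lambda> \<and> w \<in> vertices \<Lambda> \<and> v \<noteq> w} \<union>
     {gen \<mu> * gen \<nu> - gen (cmp \<Lambda> \<mu> \<nu>) |\<mu> \<nu>.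
        \<mu> \<in> mor \<Lambda> \<and> \<nu> \<in> mor \<Lambda> \<and> sc \<Lambda> \<mu> = rg \<Lambda> \<nu>} \<union>
     {sp_adj (gen \<xi>) * gen \<xi> - gen (sc \<Lambda> \<xi>) |\<xi>. \<xi> \<in> mor \<Lambda>} \<union>
     {gen v - (\<Sum>\<xi>\<in>with_range \<Lambda> v (upto_degree \<Lambda> n). gen \<xi> * sp_adj (gen \<xi>)) |v n.
        v \<in> vertices \<Lambda>}"

text \<open>When \<open>\<Lambda>\<close> has finitely many vertices, the sum of the vertex projections is the unit.\<close>

definition graph_cstar :: "('l, 'k) kgraph \<Rightarrow> (nat \<Rightarrow> 'l star_poly) set star_algebra" where
  "graph_cstar \<Lambda> = univ_cstar (mor \<Lambda>) (ck_relations \<Lambda>) (\<Sum>v\<in>vertices \<Lambda>. gen v)"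

end

(*
  If there is no cycle, the graph is finite, and expanding every generator along the paths that end
  at a source shows that the algebra is spanned by the finitely many s_b s_c* with b, c such paths.
  Hence every f in the dense *-subalgebra is a root of a polynomial, and f - z is invertible for all
  but finitely many scalars z.

  If there is a cycle, cofinality puts an edge of each colour of the cycle at every vertex, so there
  is a cycle at a vertex u to which all paths from u return.  Aperiodicity then gives two distinct
  paths of equal degree from u, hence two loops at u whose partial isometries have orthogonal ranges,
  and cofinality spreads these to a sequence of isometries with orthogonal ranges.  As in Rieffel's
  theorem, such isometries exclude density of Lg n for every n, provided that the algebra is not zero;
  the representation on the boundary path space shows the latter.

  Orthogonality of the ranges needs positivity, which is obtained from the C*-identity alone: a
  self-adjoint b with norm (1 + b) <= 1 and norm (1 - b) <= 1 vanishes, because (3/2) b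
  inherits the hypotheses.
*)

theory Submission
  imports Defs "HOL-Analysis.L2_Norm"
begin

section \<open>Paths in higher-rank graphs\<close>

text \<open>The algebra is given only through C*-seminorms on polynomials without constant term, so
  neither a spectrum nor an order nor a Hilbert space is at hand. Two obstacles come from this. The
  supremum that defines the norm means something only once all seminorms killing the relations are
  bounded on each polynomial by a common constant; hence the Cuntz-Krieger calculus is developed for
  an arbitrary such seminorm and applied to the universal one later. And the relations say that a
  vertex projection is a sum of range projections, not that the summands are orthogonal, while both
  halves of the theorem rest on this. After compression by one of the partial isometries the claim
  becomes: if elements that ought to be positive add up to zero, each of them vanishes. Being
  positive and below \<open>u\<close> is recorded by the single inequality
  \<open>\<rho> (u - a) \<le> 1\<close>, and a small multiple of a summand then satisfies both
  inequalities of the criterion for self-adjoint elements. For the stable rank, density of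
  \<open>Lg n\<close> is refuted with \<open>n + 1\<close> isometries: \<open>n\<close> of them form
  the tuple, the last one witnesses that nearby tuples are not left invertible.\<close>

definition has_edge :: "('l, 'k) kgraph \<Rightarrow> 'k \<Rightarrow> 'l \<Rightarrow> bool" where
  "has_edge \<Lambda> i v \<longleftrightarrow> (\<exists>\<eta>\<in>mor \<Lambda>. rg \<Lambda> \<eta> = v \<and> dg \<Lambda> \<eta> = unit_deg i)"

lemma with_range_unit_deg_empty_iff:
  "with_range \<Lambda> v (of_degree \<Lambda> (unit_deg i)) = {} \<longleftrightarrow> \<not> has_edge \<Lambda> i v"
  by (auto simp: with_range_def of_degree_def has_edge_def)

definition total :: "('k::finite \<Rightarrow> nat) \<Rightarrow> nat" where
  "total n = (\<Sum>i\<in>UNIV. n i)"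

lemma total_add: "total (m + n) = total m + total n"
  by (simp add: total_def sum.distrib)

lemma total_mono: "m \<le> n \<Longrightarrow> total m \<le> total n"
  by (simp add: total_def le_fun_def sum_mono)

lemma total_unit_deg [simp]: "total (unit_deg i) = 1"
  by (simp add: total_def unit_deg_def)

lemma le_total: "n i \<le> total n"
  unfolding total_def by (rule member_le_sum) auto

lemma unit_deg_le_iff: "unit_deg i \<le> n \<longleftrightarrow> 0 < n i"
  by (auto simp: unit_deg_def le_fun_def Suc_le_eq)

lemma finite_atMost_fun: "finite {m :: 'k::finite \<Rightarrow> nat. m \<le> n}"
proof (rule finite_subset)
  show "{m. m \<le> n} \<subseteq> PiE UNIV (\<lambda>i. {..n i})"
    by (auto simp: le_fun_def)
qed (auto intro: finite_PiE)

lemma add_unit_deg_le_iff: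
  assumes "m \<le> n"
  shows "m + unit_deg i \<le> n \<longleftrightarrow> m i < n i"
  using assms by (auto simp: le_fun_def unit_deg_def Suc_le_eq)

section \<open>Unique factorisation and edges of a given colour\<close>

context k_graph
begin

text \<open>An element \<open>v\<close> of degree \<open>0\<close> factors as
  \<open>rg \<Lambda> v\<close> times \<open>v\<close> and as \<open>v\<close> times
  \<open>sc \<Lambda> v\<close>, both times with degrees \<open>0\<close> and \<open>0\<close>;
  uniqueness forces the two factorisations to agree.\<close>

lemma vertexD:
  assumes "v \<in> vertices \<Lambda>"
  shows "v \<in> mor \<Lambda>" "dg \<Lambda> v = 0" "rg \<Lambda> v = v" "sc \<Lambda> v = v"
proof -
  show v: "v \<in> mor \<Lambda>" "dg \<Lambda> v = 0"
    using assms by (auto simp: of_degree_def)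
  let ?P = "\<lambda>(\<mu>, \<nu>). \<mu> \<in> mor \<Lambda> \<and> \<nu> \<in> mor \<Lambda> \<and> sc \<Lambda> \<mu> = rg \<Lambda> \<nu> \<and>
            dg \<Lambda> \<mu> = 0 \<and> dg \<Lambda> \<nu> = 0 \<and> v = cmp \<Lambda> \<mu> \<nu>"
  have "\<exists>!p. ?P p"
    using factorisation[of v 0 0] v by simp
  moreover have "?P (rg \<Lambda> v, v)"
    using v by (simp add: rg_closed sc_rg dg_id rg_cmp_id)
  moreover have "?P (v, sc \<Lambda> v)"
    using v dg_id[of "sc \<Lambda> v"] by (simp add: sc_closed rg_sc cmp_sc_id)
  ultimately have "(rg \<Lambda> v, v) = (v, sc \<Lambda> v)"
    by (metis (no_types, lifting))
  then show "rg \<Lambda> v = v" "sc \<Lambda> v = v"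
    by simp_all
qed

lemma rg_vertex: "\<xi> \<in> mor \<Lambda> \<Longrightarrow> rg \<Lambda> \<xi> \<in> vertices \<Lambda>"
  by (simp add: of_degree_def rg_closed dg_id)

lemma sc_vertex: "\<xi> \<in> mor \<Lambda> \<Longrightarrow> sc \<Lambda> \<xi> \<in> vertices \<Lambda>"
  using dg_id[of "sc \<Lambda> \<xi>"] by (simp add: of_degree_def sc_closed rg_sc)

lemma factorE:
  assumes "\<xi> \<in> mor \<Lambda>" "m \<le> dg \<Lambda> \<xi>"
  obtains \<mu> \<nu> where "\<mu> \<in> mor \<Lambda>" "\<nu> \<in> mor \<Lambda>" "sc \<Lambda> \<mu> = rg \<Lambda> \<nu>" "dg \<Lambda> \<mu> = m"
    "\<xi> = cmp \<Lambda> \<mu> \<nu>" "dg \<Lambda> \<xi> = m + dg \<Lambda> \<nu>"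
proof -
  have "dg \<Lambda> \<xi> = m + (dg \<Lambda> \<xi> - m)"
    using assms(2) by (auto simp: fun_eq_iff le_fun_def)
  from factorisation[OF assms(1) this] obtain \<mu> \<nu> where
    "\<mu> \<in> mor \<Lambda>" "\<nu> \<in> mor \<Lambda>" "sc \<Lambda> \<mu> = rg \<Lambda> \<nu>" "dg \<Lambda> \<mu> = m"
    "dg \<Lambda> \<nu> = dg \<Lambda> \<xi> - m" "\<xi> = cmp \<Lambda> \<mu> \<nu>"
    by auto
  then show thesis
    using that dg_cmp by metis
qed

lemma cmp_cancel:
  assumes "\<mu> \<in> mor \<Lambda>" "\<nu> \<in> mor \<Lambda>" "sc \<Lambda> \<mu> = rg \<Lambda> \<nu>"
    and "\<mu>' \<in> mor \<Lambda>" "\<nu>' \<in> mor \<Lambda>" "sc \<Lambda> \<mu>' = rg \<Lambda> \<nu>'"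
    and "cmp \<Lambda> \<mu> \<nu> = cmp \<Lambda> \<mu>' \<nu>'" "dg \<Lambda> \<mu> = dg \<Lambda> \<mu>'"
  shows "\<mu> = \<mu>'" "\<nu> = \<nu>'"
proof -
  let ?P = "\<lambda>(a, b). a \<in> mor \<Lambda> \<and> b \<in> mor \<Lambda> \<and> sc \<Lambda> a = rg \<Lambda> b \<and>
            dg \<Lambda> a = dg \<Lambda> \<mu> \<and> dg \<Lambda> b = dg \<Lambda> \<nu> \<and> cmp \<Lambda> \<mu> \<nu> = cmp \<Lambda> a b"
  have "dg \<Lambda> \<mu> + dg \<Lambda> \<nu> = dg \<Lambda> \<mu>' + dg \<Lambda> \<nu>'"
    using assms by (metis dg_cmp)
  then have d: "dg \<Lambda> \<nu> = dg \<Lambda> \<nu>'"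
    using assms(8) by (simp add: fun_eq_iff)
  then have "?P (\<mu>, \<nu>)" "?P (\<mu>', \<nu>')"
    using assms by simp_all
  moreover have "\<exists>!p. ?P p"
    by (rule factorisation) (use assms d in \<open>simp_all add: cmp_closed dg_cmp\<close>)
  ultimately have "(\<mu>, \<nu>) = (\<mu>', \<nu>')"
    by (metis (no_types, lifting))
  then show "\<mu> = \<mu>'" "\<nu> = \<nu>'"
    by simp_all
qed

lemma prefix_edgeE:
  assumes "\<tau> \<in> mor \<Lambda>" "0 < dg \<Lambda> \<tau> j"
  obtains \<eta> \<nu> where "\<eta> \<in> mor \<Lambda>" "\<nu> \<in> mor \<Lambda>" "sc \<Lambda> \<eta> = rg \<Lambda> \<nu>" "dg \<Lambda> \<eta> = unit_deg j"
    "\<tau> = cmp \<Lambda> \<eta> \<nu>" "dg \<Lambda> \<tau> = unit_deg j + dg \<Lambda> \<nu>"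
proof -
  have "unit_deg j \<le> dg \<Lambda> \<tau>"
    using assms(2) by (simp add: unit_deg_le_iff)
  from factorE[OF assms(1) this] that show thesis
    by metis
qed

lemma has_edge_rg:
  assumes "\<tau> \<in> mor \<Lambda>" "0 < dg \<Lambda> \<tau> i"
  shows "has_edge \<Lambda> i (rg \<Lambda> \<tau>)"
  using prefix_edgeE[OF assms] unfolding has_edge_def by (metis rg_cmp)

text \<open>Composing \<open>\<tau>\<close> with the edge gives a path of the same range whose
  degree is positive in colour \<open>i\<close>, and its initial edge of that colour is the one
  wanted. The opposite direction, \<open>has_edge_sc\<close>, takes local convexity.\<close>

lemma has_edge_hereditary:
  assumes "\<tau> \<in> mor \<Lambda>" "has_edge \<Lambda> i (sc \<Lambda> \<tau>)"
  shows "has_edge \<Lambda> i (rg \<Lambda> \<tau>)"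
proof -
  obtain \<eta> where \<eta>: "\<eta> \<in> mor \<Lambda>" "rg \<Lambda> \<eta> = sc \<Lambda> \<tau>" "dg \<Lambda> \<eta> = unit_deg i"
    using assms by (auto simp: has_edge_def)
  then have "0 < dg \<Lambda> (cmp \<Lambda> \<tau> \<eta>) i"
    using assms by (simp add: dg_cmp unit_deg_def)
  then show ?thesis
    using has_edge_rg[of "cmp \<Lambda> \<tau> \<eta>" i] assms \<eta> by (simp add: cmp_closed rg_cmp)
qed

text \<open>The first edge of \<open>\<tau>\<close> is peeled off, and local convexity carries the
  edge of colour \<open>i\<close> over to its source. The condition
  \<open>dg \<Lambda> \<tau> i = 0\<close> guarantees that the peeled colours differ from
  \<open>i\<close>.\<close>

lemma has_edge_sc:
  assumes "locally_convex \<Lambda>" "\<tau> \<in> mor \<Lambda>" "dg \<Lambda> \<tau> i = 0" "has_edge \<Lambda> i (rg \<Lambda> \<tau>)"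
  shows "has_edge \<Lambda> i (sc \<Lambda> \<tau>)"
  using assms(2-4)
proof (induction "total (dg \<Lambda> \<tau>)" arbitrary: \<tau> rule: less_induct)
  case less
  show ?case
  proof (cases "dg \<Lambda> \<tau> = 0")
    case True
    then have "\<tau> \<in> vertices \<Lambda>"
      using less.prems by (simp add: of_degree_def)
    then show ?thesis
      using less.prems vertexD by metis
  next
    case False
    then obtain j where j: "0 < dg \<Lambda> \<tau> j"
      by (auto simp: fun_eq_iff)
    with less.prems have "i \<noteq> j"
      by auto
    obtain \<eta> \<nu> where f: "\<eta> \<in> mor \<Lambda>" "\<nu> \<in> mor \<Lambda>" "sc \<Lambda> \<eta> = rg \<Lambda> \<nu>" "dg \<Lambda> \<eta> = unit_deg j"
        "\<tau> = cmp \<Lambda> \<eta> \<nu>" "dg \<Lambda> \<tau> = unit_deg j + dg \<Lambda> \<nu>"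
      by (rule prefix_edgeE[OF less.prems(1) j])
    obtain \<zeta> where "\<zeta> \<in> mor \<Lambda>" "rg \<Lambda> \<zeta> = rg \<Lambda> \<eta>" "dg \<Lambda> \<zeta> = unit_deg i"
      using less.prems(3) f by (auto simp: has_edge_def rg_cmp)
    then have "has_edge \<Lambda> i (sc \<Lambda> \<eta>)"
      using assms(1) \<open>i \<noteq> j\<close> f(1,4)
      unfolding locally_convex_def with_range_unit_deg_empty_iff
      by (metis (mono_tags, lifting) mem_Collect_eq of_degree_def)
    moreover have "total (dg \<Lambda> \<nu>) < total (dg \<Lambda> \<tau>)" "dg \<Lambda> \<nu> i = 0"
      using f(6) less.prems(2) by (simp_all add: total_add)
    ultimately have "has_edge \<Lambda> i (sc \<Lambda> \<nu>)"
      using less.hyps f(2,3) by simp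
    then show ?thesis
      using f by (simp add: sc_cmp)
  qed
qed

section \<open>Existence, uniqueness and prefixes of paths maximal below a given degree\<close>

lemma upto_degree_iff:
  "\<xi> \<in> upto_degree \<Lambda> n \<longleftrightarrow> \<xi> \<in> mor \<Lambda> \<and> dg \<Lambda> \<xi> \<le> n \<and>
     (\<forall>i. dg \<Lambda> \<xi> i < n i \<longrightarrow> \<not> has_edge \<Lambda> i (sc \<Lambda> \<xi>))"
  unfolding upto_degree_def with_range_unit_deg_empty_iff
  by (auto simp: add_unit_deg_le_iff)

lemma of_degree_upto_degree: "of_degree \<Lambda> n \<subseteq> upto_degree \<Lambda> n"
  by (auto simp: of_degree_def upto_degree_iff)

lemma finite_upto_degree:
  assumes "finite_kgraph \<Lambda>"
  shows "finite (upto_degree \<Lambda> n)"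
proof (rule finite_subset)
  show "upto_degree \<Lambda> n \<subseteq> (\<Union>m\<in>{m. m \<le> n}. of_degree \<Lambda> m)"
    by (auto simp: upto_degree_def of_degree_def)
  show "finite (\<Union>m\<in>{m. m \<le> n}. of_degree \<Lambda> m)"
    using assms finite_atMost_fun[of n] by (simp add: finite_kgraph_def)
qed

text \<open>The cut is at the coordinatewise minimum of \<open>dg \<Lambda> \<xi>\<close> and
  \<open>n\<close>. Where \<open>\<mu>\<close> falls short of \<open>n\<close>, it has used up
  colour \<open>i\<close> entirely, so \<open>\<tau>\<close> has none of it and an edge of colour
  \<open>i\<close> at the end of \<open>\<mu>\<close> would persist to the end of
  \<open>\<xi>\<close>.\<close>

lemma upto_degree_prefix:
  assumes "locally_convex \<Lambda>" "\<xi> \<in> mor \<Lambda>"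
    and "\<And>i. dg \<Lambda> \<xi> i < n i \<Longrightarrow> \<not> has_edge \<Lambda> i (sc \<Lambda> \<xi>)"
  obtains \<mu> \<tau> where "\<mu> \<in> upto_degree \<Lambda> n" "\<tau> \<in> mor \<Lambda>" "sc \<Lambda> \<mu> = rg \<Lambda> \<tau>" "\<xi> = cmp \<Lambda> \<mu> \<tau>"
proof -
  let ?m = "\<lambda>i. min (dg \<Lambda> \<xi> i) (n i)"
  have le: "?m \<le> dg \<Lambda> \<xi>"
    by (simp add: le_fun_def)
  obtain \<mu> \<tau> where f: "\<mu> \<in> mor \<Lambda>" "\<tau> \<in> mor \<Lambda>" "sc \<Lambda> \<mu> = rg \<Lambda> \<tau>" "dg \<Lambda> \<mu> = ?m"
      "\<xi> = cmp \<Lambda> \<mu> \<tau>" "dg \<Lambda> \<xi> = ?m + dg \<Lambda> \<tau>"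
    by (rule factorE[OF assms(2) le])
  have "\<not> has_edge \<Lambda> i (sc \<Lambda> \<mu>)" if "dg \<Lambda> \<mu> i < n i" for i
  proof -
    have lt: "dg \<Lambda> \<xi> i < n i"
      using that f(4) by auto
    have "dg \<Lambda> \<xi> i = min (dg \<Lambda> \<xi> i) (n i) + dg \<Lambda> \<tau> i"
      using fun_cong[OF f(6), of i] by (metis plus_fun_apply)
    with lt have "dg \<Lambda> \<tau> i = 0"
      by linarith
    then show ?thesis
      using has_edge_sc[OF assms(1) f(2)] assms(3)[OF lt] f(1-3,5) by (auto simp: sc_cmp)
  qed
  then have "\<mu> \<in> upto_degree \<Lambda> n"
    using f(1,4) by (simp add: upto_degree_iff le_fun_def)
  then show thesis
    using that f(2,3,5) by blast
qed

text \<open>A longest path with range \<open>v\<close> and degree at most \<open>n\<close> will do,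
  since any edge still allowed at its end would lengthen it.\<close>

lemma upto_degree_nonempty:
  assumes "v \<in> vertices \<Lambda>"
  obtains \<xi> where "\<xi> \<in> upto_degree \<Lambda> n" "rg \<Lambda> \<xi> = v"
proof -
  let ?P = "\<lambda>\<xi>. \<xi> \<in> mor \<Lambda> \<and> rg \<Lambda> \<xi> = v \<and> dg \<Lambda> \<xi> \<le> n"
  have "?P v"
    using vertexD[OF assms] by (simp add: le_fun_def)
  moreover have "\<forall>\<xi>. ?P \<xi> \<longrightarrow> total (dg \<Lambda> \<xi>) < Suc (total n)"
    using total_mono by (auto simp: less_Suc_eq_le)
  ultimately obtain \<xi> where \<xi>: "?P \<xi>" "\<And>\<zeta>. ?P \<zeta> \<Longrightarrow> total (dg \<Lambda> \<zeta>) \<le> total (dg \<Lambda> \<xi>)"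
    using ex_has_greatest_nat[of ?P v "\<lambda>\<xi>. total (dg \<Lambda> \<xi>)" "Suc (total n)"] by blast
  have "\<not> has_edge \<Lambda> i (sc \<Lambda> \<xi>)" if "dg \<Lambda> \<xi> i < n i" for i
  proof
    assume "has_edge \<Lambda> i (sc \<Lambda> \<xi>)"
    then obtain \<eta> where \<eta>: "\<eta> \<in> mor \<Lambda>" "rg \<Lambda> \<eta> = sc \<Lambda> \<xi>" "dg \<Lambda> \<eta> = unit_deg i"
      by (auto simp: has_edge_def)
    have "?P (cmp \<Lambda> \<xi> \<eta>)"
      using \<xi>(1) \<eta> that by (simp add: cmp_closed rg_cmp dg_cmp add_unit_deg_le_iff)
    then show False
      using \<xi> \<eta> by (force simp: dg_cmp total_add)
  qed
  then show thesis
    using that \<xi>(1) by (auto simp: upto_degree_iff)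
qed

text \<open>If \<open>\<mu>\<close> had smaller degree than \<open>\<nu>\<close> in colour
  \<open>i\<close>, its continuation \<open>\<tau>\<close> would start with an edge of colour
  \<open>i\<close>, although \<open>\<mu>\<close> is still below \<open>n\<close> there and so must
  end without one.\<close>

lemma upto_degree_unique:
  assumes "\<mu> \<in> upto_degree \<Lambda> n" "\<nu> \<in> upto_degree \<Lambda> n"
    and "\<tau> \<in> mor \<Lambda>" "sc \<Lambda> \<mu> = rg \<Lambda> \<tau>" "\<tau>' \<in> mor \<Lambda>" "sc \<Lambda> \<nu> = rg \<Lambda> \<tau>'"
    and "cmp \<Lambda> \<mu> \<tau> = cmp \<Lambda> \<nu> \<tau>'"
  shows "\<mu> = \<nu>"
proof -
  have *: "\<not> dg \<Lambda> \<mu> i < dg \<Lambda> \<nu> i"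
    if "\<mu> \<in> upto_degree \<Lambda> n" "\<nu> \<in> upto_degree \<Lambda> n"
    "\<tau> \<in> mor \<Lambda>" "sc \<Lambda> \<mu> = rg \<Lambda> \<tau>" "\<tau>' \<in> mor \<Lambda>" "sc \<Lambda> \<nu> = rg \<Lambda> \<tau>'"
    "cmp \<Lambda> \<mu> \<tau> = cmp \<Lambda> \<nu> \<tau>'" for \<mu> \<nu> \<tau> \<tau>' i
  proof
    assume lt: "dg \<Lambda> \<mu> i < dg \<Lambda> \<nu> i"
    have "dg \<Lambda> \<mu> + dg \<Lambda> \<tau> = dg \<Lambda> \<nu> + dg \<Lambda> \<tau>'"
      using that by (metis dg_cmp upto_degree_iff)
    from fun_cong[OF this, of i] lt have "0 < dg \<Lambda> \<tau> i"
      by simp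
    then have "has_edge \<Lambda> i (sc \<Lambda> \<mu>)"
      using has_edge_rg that by metis
    moreover have "dg \<Lambda> \<mu> i < n i"
      using lt that(2) by (auto simp: upto_degree_iff le_fun_def intro: less_le_trans)
    ultimately show False
      using that(1) by (simp add: upto_degree_iff)
  qed
  have "dg \<Lambda> \<mu> = dg \<Lambda> \<nu>"
    using *[OF assms] *[OF assms(2,1,5,6,3,4) assms(7)[symmetric]]
    by (intro ext) (meson linorder_neqE_nat)
  then show ?thesis
    using cmp_cancel assms by (simp add: upto_degree_iff)
qed

section \<open>Consequences of cofinality, aperiodicity and finiteness for cycles\<close>

lemma cycle_power:
  assumes "\<xi> \<in> mor \<Lambda>" "rg \<Lambda> \<xi> = sc \<Lambda> \<xi>"
  shows "\<exists>\<zeta>\<in>mor \<Lambda>. rg \<Lambda> \<zeta> = rg \<Lambda> \<xi> \<and> sc \<Lambda> \<zeta> = rg \<Lambda> \<xi> \<and> dg \<Lambda> \<zeta> i = m * dg \<Lambda> \<xi> i"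
proof (induction m)
  case 0
  show ?case
    using assms(1) vertexD[OF rg_vertex[OF assms(1)]] by (intro bexI[of _ "rg \<Lambda> \<xi>"]) auto
next
  case (Suc m)
  then obtain \<zeta> where "\<zeta> \<in> mor \<Lambda>" "rg \<Lambda> \<zeta> = rg \<Lambda> \<xi>" "sc \<Lambda> \<zeta> = rg \<Lambda> \<xi>" "dg \<Lambda> \<zeta> i = m * dg \<Lambda> \<xi> i"
    by blast
  then show ?case
    using assms by (intro bexI[of _ "cmp \<Lambda> \<xi> \<zeta>"]) (auto simp: cmp_closed rg_cmp sc_cmp dg_cmp)
qed

text \<open>
  A vertex \<open>w\<close> without edges of colour \<open>i\<close> reaches only such vertices, whereas long powers of the
  cycle give elements of arbitrarily large \<open>\<Lambda>\<close> with superscript \<open>\<le> n\<close> that end at a vertex with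
  such an edge, contrary to cofinality.
\<close>

lemma cycle_has_edge:
  assumes lc: "locally_convex \<Lambda>" and cof: "cofinal_kgraph \<Lambda>"
    and \<xi>: "\<xi> \<in> mor \<Lambda>" "rg \<Lambda> \<xi> = sc \<Lambda> \<xi>" "0 < dg \<Lambda> \<xi> i" and w: "w \<in> vertices \<Lambda>"
  shows "has_edge \<Lambda> i w"
proof -
  let ?v = "rg \<Lambda> \<xi>"
  obtain n where n: "sc \<Lambda> ` with_range \<Lambda> ?v (upto_degree \<Lambda> n) \<subseteq> sc \<Lambda> ` with_range \<Lambda> w (mor \<Lambda>)"
    using cof w rg_vertex[OF \<xi>(1)] unfolding cofinal_kgraph_def by blast
  obtain \<zeta> where \<zeta>: "\<zeta> \<in> mor \<Lambda>" "rg \<Lambda> \<zeta> = ?v" "sc \<Lambda> \<zeta> = ?v" "dg \<Lambda> \<zeta> i = Suc (n i) * dg \<Lambda> \<xi> i"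
    using cycle_power[OF \<xi>(1,2)] by blast
  have gt: "n i < dg \<Lambda> \<zeta> i"
    using \<zeta>(4) \<xi>(3) by (cases "dg \<Lambda> \<xi> i") auto
  \<comment> \<open>The power of the cycle alone may be short of \<open>n\<close> in other colours;
    appending \<open>\<eta>\<close> exhausts every colour that stays below \<open>n\<close>, as
    \<open>upto_degree_prefix\<close> demands.\<close>
  obtain \<eta> where \<eta>: "\<eta> \<in> upto_degree \<Lambda> n" "rg \<Lambda> \<eta> = ?v"
    using upto_degree_nonempty rg_vertex[OF \<xi>(1)] by metis
  then have \<eta>m: "\<eta> \<in> mor \<Lambda>"
    by (simp add: upto_degree_iff)
  have "\<not> has_edge \<Lambda> j (sc \<Lambda> (cmp \<Lambda> \<zeta> \<eta>))" if "dg \<Lambda> (cmp \<Lambda> \<zeta> \<eta>) j < n j" for j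
    using that \<eta> \<eta>m \<zeta> by (auto simp: upto_degree_iff sc_cmp dg_cmp)
  then obtain \<mu> \<tau> where \<mu>: "\<mu> \<in> upto_degree \<Lambda> n" "\<tau> \<in> mor \<Lambda>" "sc \<Lambda> \<mu> = rg \<Lambda> \<tau>"
      "cmp \<Lambda> \<zeta> \<eta> = cmp \<Lambda> \<mu> \<tau>"
    using upto_degree_prefix[OF lc, of "cmp \<Lambda> \<zeta> \<eta>" n] \<eta> \<eta>m \<zeta> by (metis cmp_closed)
  then have \<mu>m: "\<mu> \<in> mor \<Lambda>" "dg \<Lambda> \<mu> i \<le> n i"
    by (auto simp: upto_degree_iff le_fun_def)
  have "dg \<Lambda> \<zeta> + dg \<Lambda> \<eta> = dg \<Lambda> \<mu> + dg \<Lambda> \<tau>"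
    using \<mu> \<mu>m \<eta> \<eta>m \<zeta> by (metis dg_cmp)
  from fun_cong[OF this, of i] gt \<mu>m(2) have "0 < dg \<Lambda> \<tau> i"
    by simp
  then have e: "has_edge \<Lambda> i (sc \<Lambda> \<mu>)"
    using has_edge_rg \<mu> by metis
  have "rg \<Lambda> \<mu> = ?v"
    using \<mu> \<mu>m \<eta> \<eta>m \<zeta> by (metis rg_cmp)
  then have "\<mu> \<in> with_range \<Lambda> ?v (upto_degree \<Lambda> n)"
    using \<mu>(1) by (simp add: with_range_def)
  then have "sc \<Lambda> \<mu> \<in> sc \<Lambda> ` with_range \<Lambda> w (mor \<Lambda>)"
    using n by blast
  then obtain \<kappa> where "\<kappa> \<in> mor \<Lambda>" "rg \<Lambda> \<kappa> = w" "sc \<Lambda> \<kappa> = sc \<Lambda> \<mu>"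
    by (auto simp: with_range_def)
  then show ?thesis
    using has_edge_hereditary e by metis
qed

text \<open>\<open>u\<close> is chosen with the fewest reachable vertices. The reachable set can
  only shrink along a path from \<open>u\<close>; by minimality it stays the same, and it contains
  \<open>u\<close>.\<close>

lemma terminal_vertex:
  assumes "finite (vertices \<Lambda>)"
  obtains u where "u \<in> vertices \<Lambda>"
    "\<And>\<kappa>. \<kappa> \<in> mor \<Lambda> \<Longrightarrow> rg \<Lambda> \<kappa> = u \<Longrightarrow> \<exists>\<kappa>'\<in>mor \<Lambda>. rg \<Lambda> \<kappa>' = sc \<Lambda> \<kappa> \<and> sc \<Lambda> \<kappa>' = u"
proof -
  let ?R = "\<lambda>v. sc \<Lambda> ` with_range \<Lambda> v (mor \<Lambda>)"
  have fin: "finite (?R v)" for v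
    by (rule finite_subset[OF _ assms]) (auto simp: with_range_def sc_vertex)
  obtain v where "v \<in> vertices \<Lambda>"
    using nonempty rg_vertex by blast
  then obtain u where u: "u \<in> vertices \<Lambda>"
    "\<And>w. w \<in> vertices \<Lambda> \<Longrightarrow> card (?R u) \<le> card (?R w)"
    using ex_has_least_nat[of "\<lambda>v. v \<in> vertices \<Lambda>" v "\<lambda>v. card (?R v)"] by blast
  show thesis
  proof (rule that[OF u(1)])
    fix \<kappa> assume \<kappa>: "\<kappa> \<in> mor \<Lambda>" "rg \<Lambda> \<kappa> = u"
    have "sc \<Lambda> \<tau> \<in> ?R u" if "\<tau> \<in> mor \<Lambda>" "rg \<Lambda> \<tau> = sc \<Lambda> \<kappa>" for \<tau>
      using that \<kappa> by (intro image_eqI[of _ _ "cmp \<Lambda> \<kappa> \<tau>"])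
        (auto simp: with_range_def cmp_closed sc_cmp rg_cmp)
    then have "?R (sc \<Lambda> \<kappa>) \<subseteq> ?R u"
      by (auto simp: with_range_def)
    then have "?R (sc \<Lambda> \<kappa>) = ?R u"
      using u(2)[OF sc_vertex[OF \<kappa>(1)]] fin by (meson card_seteq)
    moreover have "u \<in> ?R u"
      using vertexD[OF u(1)] by (force simp: with_range_def)
    ultimately have "u \<in> ?R (sc \<Lambda> \<kappa>)"
      by simp
    then show "\<exists>\<kappa>'\<in>mor \<Lambda>. rg \<Lambda> \<kappa>' = sc \<Lambda> \<kappa> \<and> sc \<Lambda> \<kappa>' = u"
      by (auto simp: with_range_def)
  qed
qed

text \<open>The absence of periodicity is applied to the pair \<open>p\<close>, \<open>0\<close>
  with \<open>p = dg \<Lambda> \<xi>\<close>. It yields a boundary path \<open>x\<close> at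
  \<open>u\<close> that differs from its shift by \<open>p\<close>. If \<open>x\<close> does not
  begin with \<open>\<xi>\<close>, then \<open>\<xi>\<close> and the initial segment of
  \<open>x\<close> of degree \<open>p\<close> are the two paths. If it does, the shift also starts
  at \<open>u\<close>, and an initial segment where \<open>x\<close> and the shift differ provides
  them.\<close>

lemma aperiodic_distinct_paths:
  assumes "no_local_periodicity \<Lambda>" and u: "u \<in> vertices \<Lambda>"
    and \<xi>: "\<xi> \<in> mor \<Lambda>" "rg \<Lambda> \<xi> = u" "sc \<Lambda> \<xi> = u" "dg \<Lambda> \<xi> \<noteq> 0"
    and edge: "\<And>i w. 0 < dg \<Lambda> \<xi> i \<Longrightarrow> w \<in> vertices \<Lambda> \<Longrightarrow> has_edge \<Lambda> i w"
  obtains \<alpha> \<beta> where "\<alpha> \<in> mor \<Lambda>" "\<beta> \<in> mor \<Lambda>" "rg \<Lambda> \<alpha> = u" "rg \<Lambda> \<beta> = u" "dg \<Lambda> \<alpha> = dg \<Lambda> \<beta>" "\<alpha> \<noteq> \<beta>"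
proof -
  define p where "p = dg \<Lambda> \<xi>"
  have "\<not> local_periodicity \<Lambda> p 0 u"
    using assms(1) u \<xi>(4) by (simp add: no_local_periodicity_def p_def)
  then obtain m x where mx: "(m, x) \<in> boundary_paths_at \<Lambda> u" and
    np: "\<not> (p - deg_meet p m = 0 - deg_meet 0 m \<and> shift (deg_meet p m) (m, x) = shift (deg_meet 0 m) (m, x))"
    unfolding local_periodicity_def by force
  have path: "is_path \<Lambda> (m, x)" and x0: "x (0, 0) = u" and
    bd: "\<And>n i. to_enat n \<le> m \<Longrightarrow> enat (n i) = m i \<Longrightarrow> \<not> has_edge \<Lambda> i (x (n, n))"
    using mx unfolding boundary_paths_at_def boundary_paths_def with_range_unit_deg_empty_iff by auto
  have x: "x (a, b) \<in> mor \<Lambda>" "dg \<Lambda> (x (a, b)) = b - a" "rg \<Lambda> (x (a, b)) = x (a, a)"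
    "sc \<Lambda> (x (a, b)) = x (b, b)" if "a \<le> b" "to_enat b \<le> m" for a b
    using path that by (auto simp: is_path_def deg_pairs_def)
  have le_trans: "to_enat a \<le> m" if "a \<le> b" "to_enat b \<le> m" for a b
    using that by (simp add: to_enat_def le_fun_def) (meson enat_ord_simps(1) order_trans)
  have xc: "x (a, c) = cmp \<Lambda> (x (a, b)) (x (b, c))"
    if "a \<le> b" "b \<le> c" "to_enat c \<le> m" for a b c
    using path that le_trans[OF that(2,3)] by (auto simp: is_path_def deg_pairs_def)
  \<comment> \<open>A boundary path stops in a colour only where no edge of that colour exists, but
    every vertex has edges of the colours of \<open>p\<close>. The test degree is zero away from
    \<open>j\<close>, so that it lies below \<open>m\<close>.\<close>
  have inf: "m j = \<infinity>" if "0 < p j" for j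
  proof (rule ccontr)
    assume "m j \<noteq> \<infinity>"
    then obtain t where t: "m j = enat t"
      by auto
    let ?n = "\<lambda>i. if i = j then t else 0"
    have n: "to_enat ?n \<le> m"
      using t by (auto simp: to_enat_def le_fun_def zero_enat_def[symmetric])
    then have "\<not> has_edge \<Lambda> j (x (?n, ?n))"
      using bd[of ?n j] t by simp
    moreover have "x (?n, ?n) \<in> vertices \<Lambda>"
      using x(1,2)[of ?n ?n] n by (simp add: of_degree_def fun_eq_iff)
    ultimately show False
      using edge that p_def by blast
  qed
  have p_le: "to_enat p \<le> m"
    unfolding to_enat_def le_fun_def
  proof
    fix j show "enat (p j) \<le> m j"
      using inf[of j] by (cases "p j = 0") (auto simp: zero_enat_def[symmetric])
  qed
  have add_le: "to_enat (p + b) \<le> m" if "to_enat b \<le> m" for b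
    unfolding to_enat_def le_fun_def
  proof
    fix j show "enat ((p + b) j) \<le> m j"
      using inf[of j] that by (cases "p j = 0") (auto simp: to_enat_def le_fun_def)
  qed
  \<comment> \<open>With the colours of \<open>p\<close> infinite in \<open>m\<close> there is no
    truncation, and both shifts have degree \<open>m\<close>; the failure of periodicity must
    therefore lie in the values.\<close>
  have "deg_meet p m = p"
    using p_le by (auto simp: deg_meet_def to_enat_def le_fun_def min_absorb1)
  moreover have "min (enat 0) e = enat 0" for e
    by (metis i0_lb min_absorb1 zero_enat_def)
  then have "deg_meet 0 m = 0"
    by (simp add: deg_meet_def fun_eq_iff)
  moreover have "m i - enat (p i) = m i" for i
    using inf[of i] by (cases "p i = 0") (auto simp: zero_enat_def[symmetric])
  moreover have "m i - enat 0 = m i" for i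
    by (simp add: zero_enat_def[symmetric])
  moreover have "0 + a = (a :: 'k \<Rightarrow> nat)" for a
    by (simp add: fun_eq_iff)
  moreover have "p - p = 0" "(0 :: 'k \<Rightarrow> nat) - 0 = 0"
    by (simp_all add: fun_eq_iff)
  ultimately have "restrict (\<lambda>(a, b). x (p + a, p + b)) (deg_pairs m)
      \<noteq> restrict (\<lambda>(a, b). x (a, b)) (deg_pairs m)"
    using np by (simp add: shift_def)
  then have "\<exists>q\<in>deg_pairs m. (case q of (a, b) \<Rightarrow> x (p + a, p + b)) \<noteq> (case q of (a, b) \<Rightarrow> x (a, b))"
    by (meson restrict_ext)
  then obtain a b where "(a, b) \<in> deg_pairs m" "x (p + a, p + b) \<noteq> x (a, b)"
    by auto
  then have ab: "a \<le> b" "to_enat b \<le> m" and ne: "x (p + a, p + b) \<noteq> x (a, b)"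
    by (auto simp: deg_pairs_def)
  have zero: "0 \<le> (c :: 'k \<Rightarrow> nat)" for c
    by (simp add: le_fun_def)
  have pa: "p \<le> p + a" "p + a \<le> p + b" "p \<le> p + b"
    using ab by (auto simp: le_fun_def)
  \<comment> \<open>Unique factorisation moves the difference from the segment between
    \<open>a\<close> and \<open>b\<close> to the initial segment of degree \<open>b\<close>.\<close>
  have ne': "x (p, p + b) \<noteq> x (0, b)"
  proof
    assume eq: "x (p, p + b) = x (0, b)"
    have "cmp \<Lambda> (x (p, p + a)) (x (p + a, p + b)) = cmp \<Lambda> (x (0, a)) (x (a, b))"
      using xc[OF zero ab] xc[OF pa(1,2) add_le[OF ab(2)]] eq by simp
    moreover have "dg \<Lambda> (x (p, p + a)) = dg \<Lambda> (x (0, a))"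
      using x(2)[OF pa(1) add_le[OF le_trans[OF ab]]] x(2)[OF zero le_trans[OF ab]]
      by (simp add: fun_eq_iff)
    ultimately show False
      using cmp_cancel(2)[of "x (p, p + a)" "x (p + a, p + b)" "x (0, a)" "x (a, b)"] ne
        x[OF pa(1) add_le[OF le_trans[OF ab]]] x[OF zero le_trans[OF ab]]
        x[OF pa(2) add_le[OF ab(2)]] x[OF ab]
      by simp
  qed
  show thesis
  proof (cases "x (0, p) = \<xi>")
    case True
    then have "x (p, p) = u"
      using x(4)[OF zero p_le] \<xi> by simp
    then show thesis
      using that[of "x (p, p + b)" "x (0, b)"] x[OF pa(3) add_le[OF ab(2)]] x[OF zero ab(2)] ne' x0
      by (simp add: fun_eq_iff)
  next
    case False
    then show thesis
      using that[of "x (0, p)" \<xi>] x[OF zero p_le] x0 \<xi> by (simp add: p_def fun_eq_iff)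
  qed
qed

text \<open>The given cycle may miss \<open>u\<close>; it supplies a colour \<open>i\<close>. An
  edge of this colour at \<open>u\<close> followed by a way back is a cycle at \<open>u\<close>, and
  \<open>cycle_has_edge\<close> for this new cycle gives the edges that
  \<open>aperiodic_distinct_paths\<close> asks for.\<close>

lemma distinct_return_paths:
  assumes "finite (vertices \<Lambda>)" "locally_convex \<Lambda>" "cofinal_kgraph \<Lambda>" "no_local_periodicity \<Lambda>"
    and "is_cycle \<Lambda> \<xi>"
  obtains u \<alpha> \<beta> \<alpha>' \<beta>' where "u \<in> vertices \<Lambda>"
    "\<alpha> \<in> mor \<Lambda>" "\<beta> \<in> mor \<Lambda>" "rg \<Lambda> \<alpha> = u" "rg \<Lambda> \<beta> = u" "dg \<Lambda> \<alpha> = dg \<Lambda> \<beta>" "\<alpha> \<noteq> \<beta>"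
    "\<alpha>' \<in> mor \<Lambda>" "\<beta>' \<in> mor \<Lambda>" "rg \<Lambda> \<alpha>' = sc \<Lambda> \<alpha>" "rg \<Lambda> \<beta>' = sc \<Lambda> \<beta>" "sc \<Lambda> \<alpha>' = u" "sc \<Lambda> \<beta>' = u"
proof -
  have \<xi>: "\<xi> \<in> mor \<Lambda>" "rg \<Lambda> \<xi> = sc \<Lambda> \<xi>" "dg \<Lambda> \<xi> \<noteq> 0"
    using assms(5) by (auto simp: is_cycle_def of_degree_def)
  then obtain i where i: "0 < dg \<Lambda> \<xi> i"
    by (auto simp: fun_eq_iff)
  obtain u where u: "u \<in> vertices \<Lambda>"
    "\<And>\<kappa>. \<kappa> \<in> mor \<Lambda> \<Longrightarrow> rg \<Lambda> \<kappa> = u \<Longrightarrow> \<exists>\<kappa>'\<in>mor \<Lambda>. rg \<Lambda> \<kappa>' = sc \<Lambda> \<kappa> \<and> sc \<Lambda> \<kappa>' = u"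
    using terminal_vertex[OF assms(1)] by blast
  obtain \<eta> where \<eta>: "\<eta> \<in> mor \<Lambda>" "rg \<Lambda> \<eta> = u" "dg \<Lambda> \<eta> = unit_deg i"
    using cycle_has_edge[OF assms(2,3) \<xi>(1,2) i u(1)] by (auto simp: has_edge_def)
  obtain \<kappa> where \<kappa>: "\<kappa> \<in> mor \<Lambda>" "rg \<Lambda> \<kappa> = sc \<Lambda> \<eta>" "sc \<Lambda> \<kappa> = u"
    using u(2)[OF \<eta>(1,2)] by blast
  define \<zeta> where "\<zeta> = cmp \<Lambda> \<eta> \<kappa>"
  have \<zeta>: "\<zeta> \<in> mor \<Lambda>" "rg \<Lambda> \<zeta> = u" "sc \<Lambda> \<zeta> = u"
    using \<eta> \<kappa> by (simp_all add: \<zeta>_def cmp_closed rg_cmp sc_cmp)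
  have "dg \<Lambda> \<zeta> i \<noteq> 0"
    using \<eta> \<kappa> by (simp add: \<zeta>_def dg_cmp unit_deg_def)
  then have "dg \<Lambda> \<zeta> \<noteq> 0"
    by (metis zero_fun_apply)
  then obtain \<alpha> \<beta> where "\<alpha> \<in> mor \<Lambda>" "\<beta> \<in> mor \<Lambda>" "rg \<Lambda> \<alpha> = u" "rg \<Lambda> \<beta> = u"
      "dg \<Lambda> \<alpha> = dg \<Lambda> \<beta>" "\<alpha> \<noteq> \<beta>"
    using aperiodic_distinct_paths[OF assms(4) u(1) \<zeta>] cycle_has_edge[OF assms(2,3) \<zeta>(1)] \<zeta>
    by metis
  then show thesis
    using that u by metis
qed

text \<open>The set of reachable vertices loses an element with each edge: if the range of the first
  edge could be reached from its source, the edge would lie on a cycle. So the length is at most the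
  size of the set at the start.\<close>

lemma acyclic_total_le:
  assumes "finite (vertices \<Lambda>)" "\<not> (\<exists>\<xi>. is_cycle \<Lambda> \<xi>)" "\<xi> \<in> mor \<Lambda>"
  shows "total (dg \<Lambda> \<xi>) \<le> card (vertices \<Lambda>)"
proof -
  let ?R = "\<lambda>v. sc \<Lambda> ` with_range \<Lambda> v (mor \<Lambda>)"
  have sub: "?R v \<subseteq> vertices \<Lambda>" for v
    by (auto simp: with_range_def sc_vertex)
  have "total (dg \<Lambda> \<xi>) \<le> card (?R (rg \<Lambda> \<xi>))"
    using assms(3)
  proof (induction "total (dg \<Lambda> \<xi>)" arbitrary: \<xi> rule: less_induct)
    case less
    show ?case
    proof (cases "dg \<Lambda> \<xi> = 0")
      case True
      then show ?thesis
        by (simp add: total_def)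
    next
      case False
      then obtain j where j: "0 < dg \<Lambda> \<xi> j"
        by (auto simp: fun_eq_iff)
      obtain \<eta> \<nu> where f: "\<eta> \<in> mor \<Lambda>" "\<nu> \<in> mor \<Lambda>" "sc \<Lambda> \<eta> = rg \<Lambda> \<nu>" "dg \<Lambda> \<eta> = unit_deg j"
          "\<xi> = cmp \<Lambda> \<eta> \<nu>" "dg \<Lambda> \<xi> = unit_deg j + dg \<Lambda> \<nu>"
        by (rule prefix_edgeE[OF less.prems(1) j])
      have "sc \<Lambda> \<tau> \<in> ?R (rg \<Lambda> \<xi>)" if "\<tau> \<in> mor \<Lambda>" "rg \<Lambda> \<tau> = rg \<Lambda> \<nu>" for \<tau>
        using that f by (intro image_eqI[of _ _ "cmp \<Lambda> \<eta> \<tau>"])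
          (auto simp: with_range_def cmp_closed sc_cmp rg_cmp)
      then have "?R (rg \<Lambda> \<nu>) \<subseteq> ?R (rg \<Lambda> \<xi>)"
        by (auto simp: with_range_def)
      moreover have "rg \<Lambda> \<xi> \<in> ?R (rg \<Lambda> \<xi>)"
        using vertexD[OF rg_vertex[OF less.prems]] by (force simp: with_range_def)
      moreover have "rg \<Lambda> \<xi> \<notin> ?R (rg \<Lambda> \<nu>)"
      proof
        assume "rg \<Lambda> \<xi> \<in> ?R (rg \<Lambda> \<nu>)"
        then obtain \<tau> where \<tau>: "\<tau> \<in> mor \<Lambda>" "rg \<Lambda> \<tau> = rg \<Lambda> \<nu>" "sc \<Lambda> \<tau> = rg \<Lambda> \<eta>"
          using f by (auto simp: with_range_def rg_cmp)
        have "dg \<Lambda> (cmp \<Lambda> \<eta> \<tau>) j \<noteq> 0"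
          using \<tau> f by (simp add: dg_cmp unit_deg_def)
        then have "dg \<Lambda> (cmp \<Lambda> \<eta> \<tau>) \<noteq> 0"
          by (metis zero_fun_apply)
        then have "is_cycle \<Lambda> (cmp \<Lambda> \<eta> \<tau>)"
          using \<tau> f by (simp add: is_cycle_def cmp_closed rg_cmp sc_cmp of_degree_def)
        then show False
          using assms(2) by blast
      qed
      ultimately have "card (?R (rg \<Lambda> \<nu>)) < card (?R (rg \<Lambda> \<xi>))"
        using finite_subset[OF sub assms(1)] by (intro psubset_card_mono) blast+
      moreover have "total (dg \<Lambda> \<nu>) \<le> card (?R (rg \<Lambda> \<nu>))"
        using less.hyps f by (simp add: total_add)
      ultimately show ?thesis
        using f(6) by (simp add: total_add)
    qed
  qed
  also have "\<dots> \<le> card (vertices \<Lambda>)"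
    using sub assms(1) by (rule card_mono[rotated])
  finally show ?thesis .
qed

end

section \<open>The free *-algebra\<close>

definition star_word :: "('l \<times> bool) list \<Rightarrow> ('l \<times> bool) list" where
  "star_word w = rev (map (\<lambda>(l, b). (l, \<not> b)) w)"

lemma star_word_star_word [simp]: "star_word (star_word w) = w"
  by (simp add: star_word_def rev_map comp_def split_def)

lemma star_word_append: "star_word (u + w) = star_word w + star_word u"
  by (simp add: star_word_def plus_list_def)

lemma star_word_eq_iff: "star_word u = w \<longleftrightarrow> u = star_word w"
  by auto

lemma star_word_in_lists: "star_word w \<in> lists (G \<times> UNIV) - {[]} \<longleftrightarrow> w \<in> lists (G \<times> UNIV) - {[]}"
  by (auto simp: star_word_def in_lists_conv_set)

text \<open>\<open>star_word\<close> is an involution, so each coefficient of the adjoint is one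
  conjugated coefficient of \<open>f\<close>; the rules for \<open>sp_adj\<close> become pointwise
  identities.\<close>

lemma lookup_sp_adj: "Poly_Mapping.lookup (sp_adj f) w = cnj (Poly_Mapping.lookup f (star_word w))"
proof -
  have "Poly_Mapping.lookup (sp_adj f) w =
      (\<Sum>u\<in>Poly_Mapping.keys f. if u = star_word w then cnj (Poly_Mapping.lookup f u) else 0)"
    unfolding sp_adj_def lookup_sum lookup_single star_word_def[symmetric] star_word_eq_iff when_def
    by simp
  also have "\<dots> = cnj (Poly_Mapping.lookup f (star_word w))"
    by (simp add: in_keys_iff)
  finally show ?thesis .
qed

lemma lookup_sp_scale: "Poly_Mapping.lookup (sp_scale c f) w = c * Poly_Mapping.lookup f w"
  unfolding sp_scale_def by transfer (simp add: when_def)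

text \<open>Scalars become constants, that is multiples of the empty word \<open>0\<close>, and the
  rules for \<open>sp_scale\<close> reduce to ring laws.\<close>

lemma sp_scale_eq_mult: "sp_scale c f = Poly_Mapping.single 0 c * f"
proof (rule poly_mapping_eqI)
  fix w
  have "Poly_Mapping.lookup (Poly_Mapping.single 0 c * f) w =
      (\<Sum>l. (c * (\<Sum>q. Poly_Mapping.lookup f q when w = l + q)) when l = 0)"
    unfolding lookup_mult lookup_single by (rule Sum_any.cong) (auto simp: when_def)
  also have "\<dots> = c * (\<Sum>q. Poly_Mapping.lookup f q when w = q)"
    by simp
  also have "\<dots> = c * Poly_Mapping.lookup f w"
    by (simp add: eq_commute[of w])
  finally show "Poly_Mapping.lookup (sp_scale c f) w = Poly_Mapping.lookup (Poly_Mapping.single 0 c * f) w"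
    by (simp add: lookup_sp_scale)
qed

lemma sum_single_keys:
  "(\<Sum>w\<in>Poly_Mapping.keys f. Poly_Mapping.single w (Poly_Mapping.lookup f w)) = (f :: 'l star_poly)"
  by (rule poly_mapping_eqI) (simp add: lookup_sum lookup_single when_def in_keys_iff)

lemma star_poly_induct [case_names zero single add]:
  assumes "P (0 :: 'l star_poly)" "\<And>w c. P (Poly_Mapping.single w c)" "\<And>f g. P f \<Longrightarrow> P g \<Longrightarrow> P (f + g)"
  shows "P f"
proof -
  have "P (\<Sum>w\<in>A. Poly_Mapping.single w (Poly_Mapping.lookup f w))" if "finite A" for A
    using that by (induction A) (auto intro: assms)
  then show ?thesis
    using sum_single_keys[of f] finite_keys[of f] by metis
qed

lemma mult_single_zero_commute: "f * Poly_Mapping.single 0 c = Poly_Mapping.single 0 c * (f :: 'l star_poly)"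
  by (induction f rule: star_poly_induct) (auto simp: mult_single algebra_simps)

lemma sp_scale_mult_left: "sp_scale c f * g = sp_scale c (f * g)"
  by (simp add: sp_scale_eq_mult mult.assoc)

lemma sp_scale_mult_right: "f * sp_scale c g = sp_scale c (f * g)"
  by (simp add: sp_scale_eq_mult mult.assoc[symmetric] mult_single_zero_commute)

lemma sp_scale_add: "sp_scale c (f + g) = sp_scale c f + sp_scale c g"
  by (simp add: sp_scale_eq_mult distrib_left)

lemma sp_scale_diff: "sp_scale c (f - g) = sp_scale c f - sp_scale c g"
  by (simp add: sp_scale_eq_mult right_diff_distrib)

lemma sp_scale_sum: "sp_scale c (\<Sum>i\<in>A. f i) = (\<Sum>i\<in>A. sp_scale c (f i))"
  by (simp add: sp_scale_eq_mult sum_distrib_left)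

lemma sp_scale_add_left: "sp_scale (c + d) f = sp_scale c f + sp_scale d f"
  by (simp add: sp_scale_eq_mult single_add distrib_right)

lemma sp_scale_sum_left: "sp_scale (\<Sum>i\<in>A. c i) f = (\<Sum>i\<in>A. sp_scale (c i) f)"
  by (rule poly_mapping_eqI) (simp add: lookup_sp_scale lookup_sum sum_distrib_right)

lemma sp_scale_sp_scale [simp]: "sp_scale c (sp_scale d f) = sp_scale (c * d) f"
  by (simp add: sp_scale_eq_mult mult.assoc[symmetric] mult_single)

lemma sp_scale_zero [simp]: "sp_scale c 0 = 0" "sp_scale 0 f = 0"
  by (simp_all add: sp_scale_eq_mult)

lemma sp_scale_one [simp]: "sp_scale 1 f = f"
  by (simp add: sp_scale_eq_mult)

lemma sp_scale_minus_one [simp]: "sp_scale (- 1) f = - f"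
  by (rule poly_mapping_eqI) (simp add: lookup_sp_scale)

lemma sp_scale_uminus [simp]: "sp_scale c (- f) = sp_scale (- c) f"
  by (rule poly_mapping_eqI) (simp add: lookup_sp_scale)

lemma sp_adj_add: "sp_adj (f + g) = sp_adj f + sp_adj g"
  by (rule poly_mapping_eqI) (simp add: lookup_sp_adj lookup_add)

lemma sp_adj_diff: "sp_adj (f - g) = sp_adj f - sp_adj g"
  by (rule poly_mapping_eqI) (simp add: lookup_sp_adj lookup_minus)

lemma sp_adj_zero [simp]: "sp_adj 0 = 0"
  by (rule poly_mapping_eqI) (simp add: lookup_sp_adj)

lemma sp_adj_one [simp]: "sp_adj 1 = 1"
  by (rule poly_mapping_eqI)
    (auto simp: lookup_sp_adj lookup_one when_def zero_list_def star_word_def)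

lemma sp_adj_sum: "sp_adj (\<Sum>i\<in>A. f i) = (\<Sum>i\<in>A. sp_adj (f i))"
  by (induction A rule: infinite_finite_induct) (auto simp: sp_adj_add)

lemma sp_adj_scale: "sp_adj (sp_scale c f) = sp_scale (cnj c) (sp_adj f)"
  by (rule poly_mapping_eqI) (simp add: lookup_sp_adj lookup_sp_scale)

lemma sp_adj_sp_adj [simp]: "sp_adj (sp_adj f) = f"
  by (rule poly_mapping_eqI) (simp add: lookup_sp_adj)

lemma sp_adj_single: "sp_adj (Poly_Mapping.single w c) = Poly_Mapping.single (star_word w) (cnj c)"
  by (rule poly_mapping_eqI) (auto simp: lookup_sp_adj lookup_single when_def)

lemma sp_adj_mult: "sp_adj (f * g) = sp_adj g * sp_adj f"
proof (induction f rule: star_poly_induct)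
  case (single w c)
  show ?case
    by (induction g rule: star_poly_induct)
      (auto simp: mult_single sp_adj_single star_word_append sp_adj_add distrib_left distrib_right
        mult.commute)
qed (auto simp: sp_adj_add distrib_left distrib_right)

lemma free_star_iff:
  "f \<in> free_star G \<longleftrightarrow> (\<forall>w. Poly_Mapping.lookup f w \<noteq> 0 \<longrightarrow> w \<in> lists (G \<times> UNIV) - {[]})"
  unfolding free_star_def by (auto simp: in_keys_iff)

lemma free_star_zero [simp, intro]: "0 \<in> free_star G"
  by (simp add: free_star_iff)

lemma free_star_add [simp, intro]: "f \<in> free_star G \<Longrightarrow> g \<in> free_star G \<Longrightarrow> f + g \<in> free_star G"
  by (simp add: free_star_iff lookup_add) (metis add.right_neutral)

lemma free_star_diff [simp, intro]: "f \<in> free_star G \<Longrightarrow> g \<in> free_star G \<Longrightarrow> f - g \<in> free_star G"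
  by (simp add: free_star_iff lookup_minus) (metis diff_0_right)

lemma free_star_uminus [simp, intro]: "f \<in> free_star G \<Longrightarrow> - f \<in> free_star G"
  by (simp add: free_star_iff)

lemma free_star_scale [simp, intro]: "f \<in> free_star G \<Longrightarrow> sp_scale c f \<in> free_star G"
  by (simp add: free_star_iff lookup_sp_scale)

lemma free_star_sum [simp, intro]: "(\<And>i. i \<in> A \<Longrightarrow> f i \<in> free_star G) \<Longrightarrow> sum f A \<in> free_star G"
  by (induction A rule: infinite_finite_induct) auto

lemma free_star_gen [simp, intro]: "l \<in> G \<Longrightarrow> gen l \<in> free_star G"
  by (simp add: free_star_iff gen_def lookup_single when_def)

lemma free_star_adj [simp, intro]: "f \<in> free_star G \<Longrightarrow> sp_adj f \<in> free_star G"
  unfolding free_star_iff lookup_sp_adj using star_word_in_lists by fastforce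

lemma free_star_single:
  "w \<in> lists (G \<times> UNIV) - {[]} \<Longrightarrow> Poly_Mapping.single w c \<in> free_star G"
  by (simp add: free_star_iff lookup_single when_def)

lemma free_star_mult [simp, intro]:
  assumes "f \<in> free_star G" "g \<in> free_star G"
  shows "f * g \<in> free_star G"
proof -
  have "f * g = (\<Sum>u\<in>Poly_Mapping.keys f. \<Sum>w\<in>Poly_Mapping.keys g.
      Poly_Mapping.single (u + w) (Poly_Mapping.lookup f u * Poly_Mapping.lookup g w))"
    by (subst (1) sum_single_keys[of f, symmetric], subst (1) sum_single_keys[of g, symmetric])
      (simp add: sum_product mult_single)
  also have "\<dots> \<in> free_star G"
    using assms by (intro free_star_sum free_star_single) (auto simp: free_star_def plus_list_def)
  finally show ?thesis .
qed

text \<open>All words that occur are non-empty and so are products beginning with a letter, not with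
  the constant \<open>1\<close>. Membership in \<open>free_star G\<close> is passed along because
  the seminorm laws require it.\<close>

lemma free_star_induct [consumes 1, case_names zero add scale gen adj_gen mult]:
  assumes "f \<in> free_star G" and "P 0"
    and add: "\<And>f g. f \<in> free_star G \<Longrightarrow> g \<in> free_star G \<Longrightarrow> P f \<Longrightarrow> P g \<Longrightarrow> P (f + g)"
    and scale: "\<And>c f. f \<in> free_star G \<Longrightarrow> P f \<Longrightarrow> P (sp_scale c f)"
    and gen: "\<And>l. l \<in> G \<Longrightarrow> P (gen l)" "\<And>l. l \<in> G \<Longrightarrow> P (sp_adj (gen l))"
    and mult: "\<And>f g. f \<in> free_star G \<Longrightarrow> g \<in> free_star G \<Longrightarrow> P f \<Longrightarrow> P g \<Longrightarrow> P (f * g)"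
  shows "P f"
proof -
  have letter: "P (Poly_Mapping.single [x] 1)" if "x \<in> G \<times> UNIV" for x
    using that gen by (cases x; cases "snd x") (auto simp: gen_def sp_adj_single star_word_def)
  have word: "P (Poly_Mapping.single w 1)" if "w \<in> lists (G \<times> UNIV)" "w \<noteq> []" for w
    using that(2,1)
  proof (induction w rule: list_nonempty_induct)
    case (single x)
    then show ?case
      using letter by simp
  next
    case (cons x w)
    have "Poly_Mapping.single (x # w) 1 = Poly_Mapping.single [x] 1 * (Poly_Mapping.single w 1 :: 'a star_poly)"
      by (simp add: mult_single plus_list_def)
    moreover have "w \<in> lists (G \<times> UNIV) - {[]}" "[x] \<in> lists (G \<times> UNIV) - {[]}"
      using cons by auto
    ultimately show ?case
      using cons letter mult[of "Poly_Mapping.single [x] 1" "Poly_Mapping.single w 1"]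
      by (simp add: free_star_single)
  qed
  have monomial: "P (Poly_Mapping.single w c)" "Poly_Mapping.single w c \<in> free_star G"
    if "w \<in> lists (G \<times> UNIV) - {[]}" for w c
  proof -
    have "Poly_Mapping.single w c = sp_scale c (Poly_Mapping.single w 1)"
      by (simp add: sp_scale_eq_mult mult_single)
    then show "P (Poly_Mapping.single w c)"
      using word[of w] scale that free_star_single by (metis Diff_iff insertI1)
  qed (use that free_star_single in blast)
  have "P (\<Sum>w\<in>A. Poly_Mapping.single w (Poly_Mapping.lookup f w))"
    if "finite A" "A \<subseteq> lists (G \<times> UNIV) - {[]}" for A
    using that
  proof (induction A)
    case (insert w A)
    then have "(\<Sum>w\<in>A. Poly_Mapping.single w (Poly_Mapping.lookup f w)) \<in> free_star G"
      by (intro free_star_sum monomial) blast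
    then show ?case
      using insert monomial[of w] add by simp
  qed (use assms(2) in auto)
  then have "P (\<Sum>w\<in>Poly_Mapping.keys f. Poly_Mapping.single w (Poly_Mapping.lookup f w))"
    using assms(1) by (auto simp: free_star_def)
  then show ?thesis
    by (simp add: sum_single_keys)
qed

text \<open>Scaling back by \<open>1 / c\<close> reverses the inequality for scalars. The lower
  bound on \<open>N (sp_adj f * f)\<close> with submultiplicativity gives
  \<open>N f \<le> N (sp_adj f)\<close>; applied to the adjoint, this yields equality and then the
  upper half of the C*-identity.\<close>

lemma cstar_seminormI:
  assumes nn: "\<And>f. f \<in> free_star G \<Longrightarrow> 0 \<le> N f"
    and scale_le: "\<And>c f. f \<in> free_star G \<Longrightarrow> N (sp_scale c f) \<le> cmod c * N f"
    and add: "\<And>f g. f \<in> free_star G \<Longrightarrow> g \<in> free_star G \<Longrightarrow> N (f + g) \<le> N f + N g"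
    and mult: "\<And>f g. f \<in> free_star G \<Longrightarrow> g \<in> free_star G \<Longrightarrow> N (f * g) \<le> N f * N g"
    and star_ge: "\<And>f. f \<in> free_star G \<Longrightarrow> (N f)\<^sup>2 \<le> N (sp_adj f * f)"
  shows "cstar_seminorm G N"
proof -
  have scale: "N (sp_scale c f) = cmod c * N f" if f: "f \<in> free_star G" for c f
  proof (cases "c = 0")
    case True
    then show ?thesis
      using scale_le[OF f, of 0] nn[of 0] by simp
  next
    case False
    then have "N f \<le> cmod (1 / c) * N (sp_scale c f)"
      using scale_le[of "sp_scale c f" "1 / c"] f by simp
    with False have "cmod c * N f \<le> N (sp_scale c f)"
      by (simp add: norm_divide field_simps)
    with scale_le[OF f] show ?thesis
      by (rule antisym)
  qed
  have adj_ge: "N f \<le> N (sp_adj f)" if f: "f \<in> free_star G" for f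
  proof (cases "N f = 0")
    case True
    then show ?thesis
      using nn[of "sp_adj f"] f by auto
  next
    case False
    have "N f * N f \<le> N (sp_adj f) * N f"
      using star_ge[OF f] mult[of "sp_adj f" f] f by (auto simp: power2_eq_square)
    with False nn[OF f] show ?thesis
      by simp
  qed
  have star: "N (sp_adj f * f) = (N f)\<^sup>2" if f: "f \<in> free_star G" for f
  proof (rule antisym[OF _ star_ge[OF f]])
    have "N (sp_adj f) \<le> N f"
      using adj_ge[of "sp_adj f"] f by simp
    then show "N (sp_adj f * f) \<le> (N f)\<^sup>2"
      using mult[of "sp_adj f" f] mult_right_mono[OF _ nn[OF f]] f
      by (force simp: power2_eq_square)
  qed
  show ?thesis
    by (simp add: cstar_seminorm_def nn scale star add mult)
qed

locale cstar_semi =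
  fixes G :: "'l set" and \<rho> :: "'l star_poly \<Rightarrow> real"
  assumes seminorm: "cstar_seminorm G \<rho>"
begin

lemma
  assumes "f \<in> free_star G"
  shows rho_nonneg: "0 \<le> \<rho> f"
    and rho_scale: "\<rho> (sp_scale c f) = cmod c * \<rho> f"
    and rho_cstar: "\<rho> (sp_adj f * f) = (\<rho> f)\<^sup>2"
  using seminorm assms by (auto simp: cstar_seminorm_def)

lemma
  assumes "f \<in> free_star G" "g \<in> free_star G"
  shows rho_add: "\<rho> (f + g) \<le> \<rho> f + \<rho> g"
    and rho_mult: "\<rho> (f * g) \<le> \<rho> f * \<rho> g"
  using seminorm assms by (auto simp: cstar_seminorm_def)

lemma rho_zero [simp]: "\<rho> 0 = 0"
  using rho_scale[of 0 0] by simp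

lemma rho_uminus: "f \<in> free_star G \<Longrightarrow> \<rho> (- f) = \<rho> f"
  using rho_scale[of f "- 1"] by simp

lemma rho_diff: "f \<in> free_star G \<Longrightarrow> g \<in> free_star G \<Longrightarrow> \<rho> (f - g) \<le> \<rho> f + \<rho> g"
  using rho_add[of f "- g"] by (auto simp: rho_uminus free_star_uminus)

lemma rho_minus_commute: "f \<in> free_star G \<Longrightarrow> g \<in> free_star G \<Longrightarrow> \<rho> (f - g) = \<rho> (g - f)"
  using rho_uminus[of "f - g"] by (auto simp: free_star_diff)

lemma rho_sum: "(\<And>i. i \<in> A \<Longrightarrow> f i \<in> free_star G) \<Longrightarrow> \<rho> (sum f A) \<le> (\<Sum>i\<in>A. \<rho> (f i))"
proof (induction A rule: infinite_finite_induct)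
  case (insert x A)
  then have "\<rho> (f x + sum f A) \<le> \<rho> (f x) + \<rho> (sum f A)"
    by (intro rho_add free_star_sum) auto
  with insert show ?case
    by force
qed auto

lemma rho_adj:
  assumes "f \<in> free_star G"
  shows "\<rho> (sp_adj f) = \<rho> f"
proof -
  have le: "\<rho> f \<le> \<rho> (sp_adj f)" if f: "f \<in> free_star G" for f
  proof (cases "\<rho> f = 0")
    case True
    then show ?thesis
      using rho_nonneg[of "sp_adj f"] f by auto
  next
    case False
    then have "0 < \<rho> f"
      using rho_nonneg[OF f] by simp
    moreover have "\<rho> f * \<rho> f \<le> \<rho> (sp_adj f) * \<rho> f"
      using rho_mult[of "sp_adj f" f] rho_cstar[OF f] f by (auto simp: power2_eq_square)
    ultimately show ?thesis
      by simp
  qed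
  show ?thesis
    using le[of f] le[of "sp_adj f"] assms by (auto intro: antisym)
qed

lemma rho_cstar': "f \<in> free_star G \<Longrightarrow> \<rho> (f * sp_adj f) = (\<rho> f)\<^sup>2"
  using rho_cstar[of "sp_adj f"] by (auto simp: rho_adj)

text \<open>Equality in the quotient by the kernel of \<open>\<rho>\<close>. Membership in
  \<open>free_star G\<close> is built in, since only there does \<open>\<rho>\<close> obey any
  laws.\<close>

definition eqv :: "'l star_poly \<Rightarrow> 'l star_poly \<Rightarrow> bool" (infix \<open>\<approx>\<close> 50) where
  "f \<approx> g \<longleftrightarrow> f \<in> free_star G \<and> g \<in> free_star G \<and> \<rho> (f - g) = 0"

lemma eqvD1: "f \<approx> g \<Longrightarrow> f \<in> free_star G"
  and eqvD2: "f \<approx> g \<Longrightarrow> g \<in> free_star G"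
  by (simp_all add: eqv_def)

lemma eqv_refl [intro]: "f \<in> free_star G \<Longrightarrow> f \<approx> f"
  by (simp add: eqv_def)

lemma eqv_sym: "f \<approx> g \<Longrightarrow> g \<approx> f"
  by (simp add: eqv_def rho_minus_commute)

lemma eqv_zero_iff: "f \<approx> 0 \<longleftrightarrow> f \<in> free_star G \<and> \<rho> f = 0"
  by (auto simp: eqv_def)

lemma eqv_add: "f \<approx> g \<Longrightarrow> f' \<approx> g' \<Longrightarrow> f + f' \<approx> g + g'"
  using rho_add[of "f - g" "f' - g'"] rho_nonneg[of "f + f' - (g + g')"]
  by (auto simp: eqv_def algebra_simps)

lemma eqv_trans [trans]: "f \<approx> g \<Longrightarrow> g \<approx> h \<Longrightarrow> f \<approx> h"
  using rho_add[of "f - g" "g - h"] rho_nonneg[of "f - h"] by (auto simp: eqv_def)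

lemma eqv_scale: "f \<approx> g \<Longrightarrow> sp_scale c f \<approx> sp_scale c g"
  by (auto simp: eqv_def sp_scale_diff[symmetric] rho_scale)

lemma eqv_uminus: "f \<approx> g \<Longrightarrow> - f \<approx> - g"
  using eqv_scale[of f g "- 1"] by simp

lemma eqv_diff: "f \<approx> g \<Longrightarrow> f' \<approx> g' \<Longrightarrow> f - f' \<approx> g - g'"
  using eqv_add[of f g "- f'" "- g'"] eqv_uminus[of f' g'] by simp

lemma eqv_mult:
  assumes "f \<approx> g" "f' \<approx> g'"
  shows "f * f' \<approx> g * g'"
proof -
  have *: "f \<in> free_star G" "g \<in> free_star G" "f' \<in> free_star G" "g' \<in> free_star G"
    using assms by (auto simp: eqv_def)
  have "f * f' - g * g' = (f - g) * f' + g * (f' - g')"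
    by (simp add: algebra_simps)
  also have "\<rho> \<dots> \<le> \<rho> ((f - g) * f') + \<rho> (g * (f' - g'))"
    using * by (intro rho_add) auto
  also have "\<dots> \<le> \<rho> (f - g) * \<rho> f' + \<rho> g * \<rho> (f' - g')"
    using * by (intro add_mono rho_mult) auto
  also have "\<dots> = 0"
    using assms by (simp add: eqv_def)
  finally show ?thesis
    using * rho_nonneg[of "f * f' - g * g'"] by (auto simp: eqv_def)
qed

lemma eqv_adj: "f \<approx> g \<Longrightarrow> sp_adj f \<approx> sp_adj g"
  by (auto simp: eqv_def sp_adj_diff[symmetric] rho_adj)

lemma eqv_sum: "(\<And>i. i \<in> A \<Longrightarrow> f i \<approx> g i) \<Longrightarrow> sum f A \<approx> sum g A"
  by (induction A rule: infinite_finite_induct) (auto intro: eqv_add)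

lemma eqv_rho:
  assumes "f \<approx> g"
  shows "\<rho> f = \<rho> g"
proof -
  have *: "f \<in> free_star G" "g \<in> free_star G"
    using assms by (auto simp: eqv_def)
  show ?thesis
    using rho_add[of "f - g" g] rho_add[of "g - f" f] assms eqv_sym[OF assms] *
    by (auto simp: eqv_def)
qed

lemma eqv_mult_left: "f \<approx> g \<Longrightarrow> h \<in> free_star G \<Longrightarrow> h * f \<approx> h * g"
  by (intro eqv_mult eqv_refl)

lemma eqv_mult_right: "f \<approx> g \<Longrightarrow> h \<in> free_star G \<Longrightarrow> f * h \<approx> g * h"
  by (intro eqv_mult eqv_refl)

lemma eqv_zero_mult: "f \<approx> 0 \<Longrightarrow> h \<in> free_star G \<Longrightarrow> f * h \<approx> 0"
  using eqv_mult_right[of f 0 h] by simp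

lemma eqv_mult_zero: "f \<approx> 0 \<Longrightarrow> h \<in> free_star G \<Longrightarrow> h * f \<approx> 0"
  using eqv_mult_left[of f 0 h] by simp

text \<open>By the C*-identity \<open>\<rho> p\<close> is a solution of
  \<open>t * t = t\<close>.\<close>

lemma rho_projection_le_1:
  assumes "p * p \<approx> p" "sp_adj p \<approx> p"
  shows "\<rho> p \<le> 1"
proof -
  have p: "p \<in> free_star G"
    using assms(2) by (rule eqvD2)
  have "(\<rho> p)\<^sup>2 = \<rho> (sp_adj p * p)"
    using p by (simp add: rho_cstar)
  also have "\<dots> = \<rho> (p * p)"
    using assms(2) p by (intro eqv_rho eqv_mult_right)
  also have "\<dots> = \<rho> p"
    using assms(1) by (rule eqv_rho)
  finally have "\<rho> p * \<rho> p = \<rho> p"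
    by (simp add: power2_eq_square)
  then show ?thesis
    by auto
qed

section \<open>Sums of projections\<close>

text \<open>For a projection \<open>u\<close> this is the left ideal generated by \<open>u\<close>,
  on which \<open>u\<close> acts from the right as the identity. It is the place where elements such
  as \<open>1 + b\<close>, outside the domain controlled by \<open>\<rho>\<close>, can be measured
  as operators.\<close>

definition rcorner :: "'l star_poly \<Rightarrow> 'l star_poly set" where
  "rcorner u = {g. g * u \<approx> g}"

text \<open>Right multiplication by \<open>x\<close>, which may have a constant term, has norm at most \<open>t\<close>.\<close>

definition rbound :: "'l star_poly \<Rightarrow> 'l star_poly \<Rightarrow> real \<Rightarrow> bool" where
  "rbound u x t \<longleftrightarrow> (\<forall>g\<in>rcorner u. g * x \<in> rcorner u \<and> \<rho> (g * x) \<le> t * \<rho> g)"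

lemma rcorner_free_star: "g \<in> rcorner u \<Longrightarrow> g \<in> free_star G"
  by (auto simp: rcorner_def eqv_def)

lemma rcorner_add: "f \<in> rcorner u \<Longrightarrow> g \<in> rcorner u \<Longrightarrow> f + g \<in> rcorner u"
  by (auto simp: rcorner_def distrib_right intro: eqv_add)

lemma rcorner_scale: "g \<in> rcorner u \<Longrightarrow> sp_scale c g \<in> rcorner u"
  by (auto simp: rcorner_def sp_scale_mult_left intro: eqv_scale)

lemma rcorner_mult: "g \<in> rcorner u \<Longrightarrow> f \<in> free_star G \<Longrightarrow> f * g \<in> rcorner u"
  by (auto simp: rcorner_def mult.assoc intro: eqv_mult_left)

lemma rbound_mult:
  assumes "rbound u x s" "rbound u y t" "0 \<le> t"
  shows "rbound u (x * y) (s * t)"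
  unfolding rbound_def
proof
  fix g assume "g \<in> rcorner u"
  then have x: "g * x \<in> rcorner u" "\<rho> (g * x) \<le> s * \<rho> g"
    using assms(1) by (auto simp: rbound_def)
  then have "g * x * y \<in> rcorner u" "\<rho> (g * x * y) \<le> t * \<rho> (g * x)"
    using assms(2) by (auto simp: rbound_def)
  with mult_left_mono[OF x(2) assms(3)]
  show "g * (x * y) \<in> rcorner u \<and> \<rho> (g * (x * y)) \<le> s * t * \<rho> g"
    by (simp add: mult.assoc mult.left_commute[of t])
qed

lemma rbound_add:
  assumes "rbound u x s" "rbound u y t"
  shows "rbound u (x + y) (s + t)"
  unfolding rbound_def
proof
  fix g assume "g \<in> rcorner u"
  then have *: "g * x \<in> rcorner u" "\<rho> (g * x) \<le> s * \<rho> g" "g * y \<in> rcorner u" "\<rho> (g * y) \<le> t * \<rho> g"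
    using assms by (auto simp: rbound_def)
  then have "\<rho> (g * x + g * y) \<le> \<rho> (g * x) + \<rho> (g * y)"
    by (intro rho_add rcorner_free_star)
  with * show "g * (x + y) \<in> rcorner u \<and> \<rho> (g * (x + y)) \<le> (s + t) * \<rho> g"
    by (simp add: distrib_left distrib_right rcorner_add)
qed

lemma rbound_scale:
  assumes "rbound u x t"
  shows "rbound u (sp_scale c x) (cmod c * t)"
  unfolding rbound_def
proof
  fix g assume "g \<in> rcorner u"
  then have *: "g * x \<in> rcorner u" "\<rho> (g * x) \<le> t * \<rho> g"
    using assms by (auto simp: rbound_def)
  then show "g * sp_scale c x \<in> rcorner u \<and> \<rho> (g * sp_scale c x) \<le> cmod c * t * \<rho> g"
    using mult_left_mono[OF *(2), of "cmod c"]
    by (simp add: sp_scale_mult_right rcorner_scale rho_scale[OF rcorner_free_star] mult.assoc)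
qed

text \<open>On the corner \<open>g\<close> equals \<open>g * u\<close>, so \<open>1 + b\<close> acts
  like \<open>u + b\<close>, which has norm at most \<open>1\<close>.\<close>

lemma rbound_one_plus:
  assumes "u \<in> free_star G" "b \<in> rcorner u" "\<rho> (u + b) \<le> 1"
  shows "rbound u (1 + b) 1"
  unfolding rbound_def
proof
  fix g assume g: "g \<in> rcorner u"
  have fs: "g \<in> free_star G" "b \<in> free_star G"
    using g assms rcorner_free_star by auto
  have "g + g * b \<approx> g * u + g * b"
    using g fs by (intro eqv_add eqv_refl) (simp_all add: rcorner_def eqv_sym)
  then have "\<rho> (g + g * b) = \<rho> (g * (u + b))"
    unfolding distrib_left by (rule eqv_rho)
  also have "\<dots> \<le> \<rho> g * \<rho> (u + b)"
    using fs assms by (intro rho_mult) auto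
  also have "\<dots> \<le> \<rho> g"
    using assms(3) rho_nonneg[OF fs(1)] by (simp add: mult_left_le)
  finally show "g * (1 + b) \<in> rcorner u \<and> \<rho> (g * (1 + b)) \<le> 1 * \<rho> g"
    using g assms fs by (simp add: distrib_left rcorner_add rcorner_mult)
qed

text \<open>By the C*-identity, the squared norm of \<open>g (1 + \<i> b)\<close> is the norm of
  \<open>g (1 + b b) g*\<close>, and \<open>1 + b b\<close> is the mean of the squares of
  \<open>1 + b\<close> and \<open>1 - b\<close>.\<close>

lemma rbound_one_plus_i:
  assumes "b \<in> rcorner u" "sp_adj b = b" and pm: "rbound u (1 + b) 1" "rbound u (1 - b) 1"
  shows "rbound u (1 + sp_scale \<i> b) 1"
  unfolding rbound_def
proof
  have "1 + b * b = sp_scale (1/2) ((1 + b) * (1 + b)) + sp_scale (1/2) ((1 - b) * (1 - b))"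
    by (rule poly_mapping_eqI) (simp add: lookup_sp_scale lookup_add lookup_minus algebra_simps)
  moreover have "rbound u \<dots> (cmod (1/2) * (1 * 1) + cmod (1/2) * (1 * 1))"
    by (intro rbound_add rbound_scale rbound_mult pm) auto
  ultimately have sq: "rbound u (1 + b * b) 1"
    by simp
  fix g assume g: "g \<in> rcorner u"
  have fs: "g \<in> free_star G" "b \<in> free_star G"
    using g assms rcorner_free_star by auto
  let ?h = "g * (1 + sp_scale \<i> b)"
  have h: "?h \<in> rcorner u"
    using g assms fs by (simp add: distrib_left rcorner_add rcorner_mult rcorner_scale sp_scale_mult_right)
  have "?h * sp_adj ?h = g * (1 + b * b) * sp_adj g"
  proof -
    have "(1 + sp_scale \<i> b) * (1 + sp_scale (- \<i>) b) = 1 + b * b"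
      by (rule poly_mapping_eqI)
        (simp add: lookup_sp_scale lookup_add algebra_simps sp_scale_mult_left sp_scale_mult_right)
    then show ?thesis
      by (simp add: sp_adj_mult sp_adj_add sp_adj_scale assms mult.assoc) (simp flip: mult.assoc)
  qed
  then have "(\<rho> ?h)\<^sup>2 = \<rho> (g * (1 + b * b) * sp_adj g)"
    using rho_cstar'[OF rcorner_free_star[OF h]] by simp
  also have "\<dots> \<le> \<rho> (g * (1 + b * b)) * \<rho> g"
    using sq g fs rho_mult[of "g * (1 + b * b)" "sp_adj g"]
    by (auto simp: rbound_def rho_adj intro: rcorner_free_star)
  also have "\<dots> \<le> (\<rho> g)\<^sup>2"
    using sq g rho_nonneg[OF fs(1)] by (auto simp: rbound_def power2_eq_square intro: mult_right_mono)
  finally have "\<rho> ?h \<le> \<rho> g"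
    using rho_nonneg[OF fs(1)] by (rule power2_le_imp_le)
  with h show "?h \<in> rcorner u \<and> \<rho> ?h \<le> 1 * \<rho> g"
    by simp
qed

lemma cube_one_plus:
  fixes b :: "'l star_poly"
  shows "(1 + sp_scale z b) * (1 + sp_scale z b) * (1 + sp_scale z b) =
    1 + sp_scale (3 * z) b + sp_scale (3 * z\<^sup>2) (b * b) + sp_scale (z ^ 3) (b * b * b)"
  by (rule poly_mapping_eqI)
    (simp add: lookup_sp_scale lookup_add algebra_simps sp_scale_mult_left sp_scale_mult_right
      power2_eq_square power3_eq_cube)

text \<open>
  An average of cubes of \<open>1 + z b\<close>, with \<open>z\<close> in the convex hull of the fourth roots of unity, in
  which the terms of order two and three cancel.
\<close>

lemma rbound_one_plus_three_halves:
  assumes "b \<in> rcorner u" "sp_adj b = b" and pm: "rbound u (1 + b) 1" "rbound u (1 - b) 1"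
  shows "rbound u (1 + sp_scale (3/2) b) 1"
proof -
  let ?L = "\<lambda>z. 1 + sp_scale z b"
  have b': "- b \<in> rcorner u" "sp_adj (- b) = - b"
    using rcorner_scale[OF assms(1), of "- 1"] assms(2) sp_adj_diff[of 0 b] by simp_all
  have 1: "rbound u (?L 1) 1"
    using pm by simp
  have i: "rbound u (?L \<i>) 1"
    using rbound_one_plus_i[OF assms] .
  have mi: "rbound u (?L (- \<i>)) 1"
    using rbound_one_plus_i[OF b'] pm by simp
  have half: "rbound u (?L ((1 + z) / 2)) 1" if "rbound u (?L z) 1" for z
  proof -
    have "?L ((1 + z) / 2) = sp_scale (1/2) (?L 1) + sp_scale (1/2) (?L z)"
      by (rule poly_mapping_eqI) (simp add: lookup_sp_scale lookup_add field_simps)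
    moreover have "rbound u \<dots> (cmod (1/2) * 1 + cmod (1/2) * 1)"
      by (intro rbound_add rbound_scale 1 that)
    ultimately show ?thesis
      by simp
  qed
  let ?C = "\<lambda>z. ?L z * ?L z * ?L z"
  have cube: "rbound u (?C z) (1 * 1 * 1)" if "rbound u (?L z) 1" for z
    by (intro rbound_mult that) auto
  have powers: "((1 + \<i>) / 2)\<^sup>2 = \<i> / 2" "((1 + - \<i>) / 2)\<^sup>2 = - \<i> / 2"
    "((1 + \<i>) / 2) ^ 3 = (- 1 + \<i>) / 4" "((1 + - \<i>) / 2) ^ 3 = (- 1 - \<i>) / 4"
    "\<i> ^ 3 = - \<i>" "(- \<i>) ^ 3 = \<i>"
    by (simp_all add: complex_eq_iff power2_eq_square power3_eq_cube)
  \<comment> \<open>The weights 1/6, 1/12, 1/12, 1/3, 1/3 of the five points \<open>z\<close> add up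
    to 1. With them the mean of \<open>z\<close> is 1/2, which the binomial coefficient 3 turns into
    3/2, while the means of the second and third powers of \<open>z\<close> are zero.\<close>
  have "rbound u (sp_scale (1/6) (?C 1) + (sp_scale (1/12) (?C \<i>) + sp_scale (1/12) (?C (- \<i>)))
      + (sp_scale (1/3) (?C ((1 + \<i>) / 2)) + sp_scale (1/3) (?C ((1 + - \<i>) / 2))))
     (cmod (1/6) * (1 * 1 * 1) + (cmod (1/12) * (1 * 1 * 1) + cmod (1/12) * (1 * 1 * 1))
      + (cmod (1/3) * (1 * 1 * 1) + cmod (1/3) * (1 * 1 * 1)))"
    by (intro rbound_add rbound_scale cube half 1 i mi)
  moreover have "sp_scale (1/6) (?C 1) + (sp_scale (1/12) (?C \<i>) + sp_scale (1/12) (?C (- \<i>)))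
      + (sp_scale (1/3) (?C ((1 + \<i>) / 2)) + sp_scale (1/3) (?C ((1 + - \<i>) / 2)))
    = 1 + sp_scale (3/2) b"
    unfolding cube_one_plus powers
    by (rule poly_mapping_eqI) (simp add: lookup_sp_scale lookup_add field_simps)
  ultimately show ?thesis
    by simp
qed

text \<open>Iteration makes right multiplication by \<open>(3/2) ^ k\<close> times \<open>b\<close>
  a contraction on the corner for every \<open>k\<close>. Applied to \<open>b\<close> itself, this
  and the C*-identity give \<open>(3/2) ^ k * (\<rho> b)\<^sup>2 \<le> \<rho> b\<close>.\<close>

lemma selfadjoint_null:
  assumes "u \<in> free_star G" "b \<in> rcorner u" "sp_adj b = b" "\<rho> (u + b) \<le> 1" "\<rho> (u - b) \<le> 1"
  shows "\<rho> b = 0"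
proof -
  have neg: "- c \<in> rcorner u" "sp_adj (- c) = - c" if "c \<in> rcorner u" "sp_adj c = c" for c
    using rcorner_scale[OF that(1), of "- 1"] that(2) sp_adj_diff[of 0 c] by simp_all
  have b: "b \<in> free_star G"
    using assms(2) by (rule rcorner_free_star)
  have pow: "rbound u (1 + sp_scale (of_real ((3/2) ^ k)) b) 1 \<and> rbound u (1 - sp_scale (of_real ((3/2) ^ k)) b) 1" for k
  proof (induction k)
    case 0
    then show ?case
      using rbound_one_plus[OF assms(1,2,4)] rbound_one_plus[OF assms(1) neg(1)[OF assms(2,3)]] assms(5)
      by simp
  next
    case (Suc k)
    let ?c = "sp_scale (of_real ((3/2) ^ k)) b"
    have c: "?c \<in> rcorner u" "sp_adj ?c = ?c"
      using rcorner_scale[OF assms(2)] assms(3) by (simp_all add: sp_adj_scale)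
    have "rbound u (1 + sp_scale (3/2) ?c) 1" "rbound u (1 + sp_scale (3/2) (- ?c)) 1"
      using rbound_one_plus_three_halves[OF c] rbound_one_plus_three_halves[OF neg[OF c]] Suc by simp_all
    moreover have "sp_scale (3/2) (- ?c) = - sp_scale (of_real ((3/2) ^ Suc k)) b"
      "sp_scale (3/2) ?c = sp_scale (of_real ((3/2) ^ Suc k)) b"
      by (auto intro!: poly_mapping_eqI simp: lookup_sp_scale)
    ultimately show ?case
      by simp
  qed
  have bound: "(3/2) ^ k * (\<rho> b)\<^sup>2 \<le> \<rho> b" for k
  proof -
    let ?c = "sp_scale (of_real ((3/2) ^ k)) b"
    have "sp_scale (1/2) (1 + ?c) + sp_scale (-1/2) (1 - ?c) = ?c"
      by (rule poly_mapping_eqI) (simp add: lookup_sp_scale lookup_add lookup_minus algebra_simps)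
    moreover have "rbound u (sp_scale (1/2) (1 + ?c) + sp_scale (-1/2) (1 - ?c)) (cmod (1/2) * 1 + cmod (-1/2) * 1)"
      using pow[of k] by (intro rbound_add rbound_scale) auto
    ultimately have "rbound u ?c 1"
      by simp
    then have "\<rho> (b * ?c) \<le> \<rho> b"
      using assms(2) by (auto simp: rbound_def)
    moreover have "\<rho> (b * ?c) = (3/2) ^ k * (\<rho> b)\<^sup>2"
      using rho_scale[OF free_star_mult[OF b b]] rho_cstar[OF b] assms(3)
      by (simp add: sp_scale_mult_right norm_power)
    ultimately show ?thesis
      by simp
  qed
  show ?thesis
  proof (rule ccontr)
    assume "\<rho> b \<noteq> 0"
    then have pos: "0 < \<rho> b"
      using rho_nonneg[OF b] by simp
    then obtain k where "1 / \<rho> b < (3/2 :: real) ^ k"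
      using real_arch_pow[of "3/2" "1 / \<rho> b"] by auto
    with pos have "1 * \<rho> b < ((3/2) ^ k * \<rho> b) * \<rho> b"
      by (intro mult_strict_right_mono) (auto simp: field_simps)
    with bound[of k] show False
      by (simp add: power2_eq_square mult.assoc)
  qed
qed

text \<open>Compressing the relation for \<open>q\<close> by \<open>s x\<close> gives elements
  \<open>a j\<close> with sum \<open>u\<close>, and \<open>a x\<close> alone is already
  \<open>u\<close>, so the others add up to zero. Each satisfies
  \<open>\<rho> (u - a j) \<le> 1\<close>, which replaces positivity and makes a multiple of
  \<open>a z\<close> fall under \<open>selfadjoint_null\<close>. Finally \<open>a z\<close> is the
  product of \<open>sp_adj (s x) * s z\<close> with its own adjoint.\<close>

lemma partial_isometries_orthogonal:
  assumes fin: "finite J" and s: "\<And>j. j \<in> J \<Longrightarrow> s j \<in> free_star G"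
    and q: "q * q \<approx> q" "sp_adj q \<approx> q"
    and sum: "q \<approx> (\<Sum>j\<in>J. s j * sp_adj (s j))"
    and qs: "\<And>j. j \<in> J \<Longrightarrow> q * s j \<approx> s j"
    and pi: "\<And>j. j \<in> J \<Longrightarrow> s j * sp_adj (s j) * s j \<approx> s j"
    and xz: "x \<in> J" "z \<in> J" "x \<noteq> z"
  shows "sp_adj (s x) * s z \<approx> 0"
proof -
  let ?p = "\<lambda>j. s j * sp_adj (s j)"
  define u where "u = sp_adj (s x) * s x"
  define a where "a j = sp_adj (s x) * ?p j * s x" for j
  have qf: "q \<in> free_star G"
    using q(2) by (rule eqvD2)
  have sx: "s x \<in> free_star G" "sp_adj (s x) \<in> free_star G"
    using s xz by auto
  have u: "u \<in> free_star G"
    using sx by (auto simp: u_def)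
  have a: "a j \<in> free_star G" "sp_adj (a j) = a j" if "j \<in> J" for j
    using sx s[OF that] by (auto simp: a_def sp_adj_mult mult.assoc)
  have au: "a j \<in> rcorner u" if "j \<in> J" for j
  proof -
    have "a j * u = sp_adj (s x) * ?p j * (s x * sp_adj (s x) * s x)"
      by (simp add: a_def u_def mult.assoc)
    also have "\<dots> \<approx> sp_adj (s x) * ?p j * s x"
      using pi[OF xz(1)] sx s[OF that] by (intro eqv_mult_left) auto
    finally show ?thesis
      by (simp add: rcorner_def a_def)
  qed
  have uq: "sp_adj (s x) * q * s x \<approx> u"
    unfolding u_def mult.assoc using qs[OF xz(1)] sx by (intro eqv_mult_left)
  have "u * u = sp_adj (s x) * (s x * sp_adj (s x) * s x)"
    by (simp add: u_def mult.assoc)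
  also have "\<dots> \<approx> u"
    unfolding u_def using pi[OF xz(1)] sx by (intro eqv_mult_left)
  finally have "\<rho> u \<le> 1"
    using u by (intro rho_projection_le_1) (auto simp: u_def sp_adj_mult)
  moreover have "(\<rho> (s x))\<^sup>2 = \<rho> u"
    using rho_cstar[OF sx(1)] by (simp add: u_def)
  ultimately have rs: "\<rho> (s x) \<le> 1"
    by (metis one_power2 power2_le_imp_le zero_le_one)
  \<comment> \<open>\<open>q - ?p j\<close> is a projection, hence of norm at most \<open>1\<close>,
    and compression by the contraction \<open>s x\<close> preserves this bound.\<close>
  have ua: "\<rho> (u - a j) \<le> 1" if j: "j \<in> J" for j
  proof -
    have pf: "?p j \<in> free_star G"
      using s[OF j] by auto
    have qp: "q * ?p j \<approx> ?p j"
      unfolding mult.assoc[symmetric] using qs[OF j] s[OF j] by (intro eqv_mult_right) auto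
    have pq: "?p j * q \<approx> ?p j"
    proof -
      have "?p j * q \<approx> ?p j * sp_adj q"
        using eqv_sym[OF q(2)] pf by (rule eqv_mult_left)
      also have "\<dots> = sp_adj (q * ?p j)"
        by (simp add: sp_adj_mult)
      also have "\<dots> \<approx> sp_adj (?p j)"
        using qp by (rule eqv_adj)
      finally show ?thesis
        by (simp add: sp_adj_mult)
    qed
    have pp: "?p j * ?p j \<approx> ?p j"
      using eqv_mult_right[OF pi[OF j], of "sp_adj (s j)"] s[OF j] by (auto simp: mult.assoc)
    have "(q - ?p j) * (q - ?p j) = q * q - q * ?p j - (?p j * q - ?p j * ?p j)"
      by (simp add: algebra_simps)
    also have "\<dots> \<approx> q - ?p j - (?p j - ?p j)"
      using q(1) qp pq pp by (intro eqv_diff)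
    finally have "(q - ?p j) * (q - ?p j) \<approx> q - ?p j"
      by simp
    moreover have "sp_adj (q - ?p j) \<approx> q - ?p j"
      using q(2) pf by (auto simp: sp_adj_diff sp_adj_mult intro: eqv_diff)
    ultimately have le: "\<rho> (q - ?p j) \<le> 1"
      by (rule rho_projection_le_1)
    have "sp_adj (s x) * (q - ?p j) * s x \<approx> u - a j"
      using eqv_diff[OF uq eqv_refl[OF a(1)[OF j]]] by (simp add: a_def algebra_simps)
    then have "\<rho> (u - a j) = \<rho> (sp_adj (s x) * (q - ?p j) * s x)"
      by (rule eqv_rho[symmetric])
    also have "\<dots> \<le> \<rho> (sp_adj (s x) * (q - ?p j)) * \<rho> (s x)"
      using sx qf pf by (intro rho_mult) auto
    also have "\<dots> \<le> (\<rho> (sp_adj (s x)) * \<rho> (q - ?p j)) * \<rho> (s x)"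
      using sx qf pf by (intro mult_right_mono rho_mult rho_nonneg) auto
    also have "\<dots> \<le> (1 * 1) * 1"
      using sx qf pf rs le by (intro mult_mono) (auto simp: rho_adj intro!: rho_nonneg mult_nonneg_nonneg)
    finally show ?thesis
      by simp
  qed
  have "(\<Sum>j\<in>J. a j) = sp_adj (s x) * (\<Sum>j\<in>J. ?p j) * s x"
    by (simp add: a_def sum_distrib_left sum_distrib_right)
  also have "\<dots> \<approx> sp_adj (s x) * q * s x"
    using eqv_sym[OF sum] sx by (intro eqv_mult_right eqv_mult_left)
  also have "\<dots> \<approx> u"
    by (rule uq)
  finally have "(\<Sum>j\<in>J. a j) - a x \<approx> u - a x"
    using a(1)[OF xz(1)] by (intro eqv_diff eqv_refl)
  moreover have "a x \<approx> u"
  proof -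
    have "a x = sp_adj (s x) * (s x * sp_adj (s x) * s x)"
      by (simp add: a_def mult.assoc)
    also have "\<dots> \<approx> u"
      unfolding u_def using pi[OF xz(1)] sx by (intro eqv_mult_left)
    finally show ?thesis .
  qed
  then have "u - a x \<approx> 0"
    using eqv_diff[OF eqv_refl[OF u] \<open>a x \<approx> u\<close>] by simp
  ultimately have "(\<Sum>j\<in>J. a j) - a x \<approx> 0"
    by (rule eqv_trans)
  moreover have "(\<Sum>j\<in>J. a j) = a x + (a z + (\<Sum>j\<in>J - {x, z}. a j))"
    using fin xz by (simp add: sum.remove[of J x] sum.remove[of "J - {x}" z] Diff_insert2[symmetric])
  ultimately have zero: "a z + (\<Sum>j\<in>J - {x, z}. a j) \<approx> 0"
    by simp
  define m where "m = card (J - {x, z})"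
  have cf: "card (J - {x, z}) = m"
    by (simp add: m_def)
  \<comment> \<open>The divisor \<open>m + 1\<close> is dictated by \<open>plus\<close>: as
    \<open>a z\<close> is minus the sum of the \<open>m\<close> remaining \<open>a j\<close>, the
    element \<open>(m + 1) u + a z\<close> is the sum of \<open>u\<close> and the \<open>m\<close>
    elements \<open>u - a j\<close>, all of norm at most \<open>1\<close>.\<close>
  define b where "b = sp_scale (of_real (1 / (m + 1))) (a z)"
  have b: "b \<in> rcorner u" "sp_adj b = b"
    using au a xz by (simp_all add: b_def rcorner_scale sp_adj_scale)
  have sc: "sp_scale (of_real (1 / (m + 1))) (sp_scale (of_nat (m + 1)) f) = f" for f :: "'l star_poly"
    by (simp del: of_nat_Suc of_nat_add add: of_nat_neq_0)
  have minus: "\<rho> (u - b) \<le> 1"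
  proof -
    have e: "sp_scale (of_nat (m + 1)) u - a z = sp_scale (of_nat m) u + (u - a z)"
      by (simp add: sp_scale_add_left)
    have "\<rho> (sp_scale (of_nat (m + 1)) u - a z) \<le> \<rho> (sp_scale (of_nat m) u) + \<rho> (u - a z)"
      unfolding e using u a xz by (intro rho_add) auto
    also have "\<dots> \<le> real m * 1 + 1"
      using \<open>\<rho> u \<le> 1\<close> ua xz by (intro add_mono) (auto simp: rho_scale[OF u] intro: mult_left_le)
    finally have "\<rho> (sp_scale (of_nat (m + 1)) u - a z) \<le> m + 1"
      by simp
    moreover have "u - b = sp_scale (of_real (1 / (m + 1))) (sp_scale (of_nat (m + 1)) u - a z)"
      by (simp only: sp_scale_diff sc b_def)
    moreover have "sp_scale (of_nat (m + 1)) u - a z \<in> free_star G"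
      using u a xz by auto
    ultimately show ?thesis
      by (simp add: rho_scale norm_divide divide_le_eq del: of_nat_Suc of_nat_add)
  qed
  have plus: "\<rho> (u + b) \<le> 1"
  proof -
    let ?r = "u + (\<Sum>j\<in>J - {x, z}. u - a j)"
    have rf: "?r \<in> free_star G"
      using u a by auto
    have "(\<Sum>j\<in>J - {x, z}. u) = sp_scale (of_nat m) u"
      by (simp add: cf sp_scale_eq_mult)
    then have "?r = sp_scale (of_nat (m + 1)) u - (\<Sum>j\<in>J - {x, z}. a j)"
      by (simp add: sum_subtractf sp_scale_add_left)
    then have d: "sp_scale (of_nat (m + 1)) u + a z - ?r = a z + (\<Sum>j\<in>J - {x, z}. a j)"
      by simp
    have eq: "sp_scale (of_nat (m + 1)) u + a z \<approx> ?r"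
      unfolding eqv_def d using zero rf u a xz by (simp add: eqv_def)
    have "\<rho> ?r \<le> \<rho> u + (\<Sum>j\<in>J - {x, z}. \<rho> (u - a j))"
      using u a by (intro order_trans[OF rho_add] add_left_mono rho_sum) auto
    also have "\<dots> \<le> 1 + (\<Sum>j\<in>J - {x, z}. 1)"
      using \<open>\<rho> u \<le> 1\<close> ua by (intro add_mono sum_mono) auto
    finally have "\<rho> (sp_scale (of_nat (m + 1)) u + a z) \<le> m + 1"
      using eqv_rho[OF eq] by (simp add: cf)
    moreover have "u + b = sp_scale (of_real (1 / (m + 1))) (sp_scale (of_nat (m + 1)) u + a z)"
      by (simp only: sp_scale_add sc b_def)
    ultimately show ?thesis
      using eqvD1[OF eq] by (simp add: rho_scale norm_divide divide_le_eq del: of_nat_Suc of_nat_add)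
  qed
  have "\<rho> b = 0"
    using selfadjoint_null[OF u b plus minus] .
  then have "\<rho> (a z) = 0"
    using a xz by (simp add: b_def rho_scale norm_divide del: of_nat_Suc)
  moreover have "a z = (sp_adj (s x) * s z) * sp_adj (sp_adj (s x) * s z)"
    by (simp add: a_def sp_adj_mult mult.assoc)
  moreover have "sp_adj (s x) * s z \<in> free_star G"
    using sx s xz by auto
  ultimately show ?thesis
    using rho_cstar'[of "sp_adj (s x) * s z"] by (simp add: eqv_zero_iff)
qed

end

lemma tendsto_zero_squeeze:
  fixes f g :: "nat \<Rightarrow> real"
  assumes "g \<longlonglongrightarrow> 0" "\<And>n. \<bar>f n\<bar> \<le> g n"
  shows "f \<longlonglongrightarrow> 0"
proof (rule tendsto_0_le[OF assms(1), where K = 1])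
  have "\<bar>f n\<bar> \<le> \<bar>g n\<bar>" for n
    using assms(2)[of n] by linarith
  then show "\<forall>\<^sub>F n in sequentially. norm (f n) \<le> norm (g n) * 1"
    by simp
qed

section \<open>The universal seminorm\<close>

text \<open>Keeps the index set of the supremum non-empty, as a real-valued \<open>SUP\<close>
  requires, and gives \<open>0\<close> as a lower bound.\<close>

lemma cstar_seminorm_zero: "cstar_seminorm G (\<lambda>_. 0)"
  by (simp add: cstar_seminorm_def)

lemma univ_norm_upper:
  assumes "\<And>\<rho>. cstar_seminorm G \<rho> \<Longrightarrow> (\<forall>h\<in>R. \<rho> h = 0) \<Longrightarrow> \<rho> f \<le> B"
    and "cstar_seminorm G \<rho>" "\<forall>h\<in>R. \<rho> h = 0"
  shows "\<rho> f \<le> univ_norm G R f"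
  unfolding univ_norm_def
  by (rule cSUP_upper) (use assms in \<open>auto intro!: bdd_aboveI2[where M = B]\<close>)

lemma univ_norm_least:
  assumes "\<And>\<rho>. cstar_seminorm G \<rho> \<Longrightarrow> (\<forall>h\<in>R. \<rho> h = 0) \<Longrightarrow> \<rho> f \<le> B"
  shows "univ_norm G R f \<le> B"
  unfolding univ_norm_def
  by (rule cSUP_least) (use assms cstar_seminorm_zero in auto)

lemma univ_norm_relation:
  assumes "h \<in> R"
  shows "univ_norm G R h = 0"
proof (rule antisym)
  show "univ_norm G R h \<le> 0"
    by (rule univ_norm_least) (use assms in auto)
  show "0 \<le> univ_norm G R h"
    using univ_norm_upper[of G R h 0 "\<lambda>_. 0"] assms cstar_seminorm_zero by auto
qed

text \<open>Each inequality passes to the supremum, which is a true supremum because of the uniform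
  bound \<open>B\<close>. The lower half of the C*-identity is first put into the form of a square
  root, so that \<open>\<rho> f\<close> stands alone on the left.\<close>

lemma cstar_seminorm_univ_norm:
  assumes bd: "\<And>f. f \<in> free_star G \<Longrightarrow>
    \<exists>B. \<forall>\<rho>. cstar_seminorm G \<rho> \<longrightarrow> (\<forall>h\<in>R. \<rho> h = 0) \<longrightarrow> \<rho> f \<le> B"
  shows "cstar_seminorm G (univ_norm G R)"
proof (rule cstar_seminormI)
  let ?U = "univ_norm G R"
  have upper: "\<rho> f \<le> ?U f" if "f \<in> free_star G" "cstar_seminorm G \<rho>" "\<forall>h\<in>R. \<rho> h = 0" for f \<rho>
    using bd[OF that(1)] univ_norm_upper[OF _ that(2,3)] by blast
  show nn: "0 \<le> ?U f" if "f \<in> free_star G" for f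
    using upper[OF that cstar_seminorm_zero] by simp
  have sn: "0 \<le> \<rho> f" "\<rho> (sp_scale c f) = cmod c * \<rho> f" "\<rho> (sp_adj f * f) = (\<rho> f)\<^sup>2"
      "\<rho> (f + g) \<le> \<rho> f + \<rho> g" "\<rho> (f * g) \<le> \<rho> f * \<rho> g"
    if "cstar_seminorm G \<rho>" "f \<in> free_star G" "g \<in> free_star G" for \<rho> f g c
    using that by (auto simp: cstar_seminorm_def)
  show "?U (sp_scale c f) \<le> cmod c * ?U f" if "f \<in> free_star G" for c f
  proof (rule univ_norm_least)
    fix \<rho> assume \<rho>: "cstar_seminorm G \<rho>" "\<forall>h\<in>R. \<rho> h = 0"
    show "\<rho> (sp_scale c f) \<le> cmod c * ?U f"
      using sn(2)[OF \<rho>(1) that that, of c] upper[OF that \<rho>] by (simp add: mult_left_mono)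
  qed
  show "(?U f)\<^sup>2 \<le> ?U (sp_adj f * f)" if f: "f \<in> free_star G" for f
  proof -
    have "?U f \<le> sqrt (?U (sp_adj f * f))"
    proof (rule univ_norm_least)
      fix \<rho> assume \<rho>: "cstar_seminorm G \<rho>" "\<forall>h\<in>R. \<rho> h = 0"
      have "(\<rho> f)\<^sup>2 \<le> ?U (sp_adj f * f)"
        using upper[of "sp_adj f * f", OF _ \<rho>] sn(3)[OF \<rho>(1) f f] f by auto
      then show "\<rho> f \<le> sqrt (?U (sp_adj f * f))"
        by (rule real_le_rsqrt)
    qed
    then have "(?U f)\<^sup>2 \<le> (sqrt (?U (sp_adj f * f)))\<^sup>2"
      using nn[OF f] by (rule power_mono)
    then show ?thesis
      using nn[of "sp_adj f * f"] f by simp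
  qed
  show "?U (f + g) \<le> ?U f + ?U g" if "f \<in> free_star G" "g \<in> free_star G" for f g
  proof (rule univ_norm_least)
    fix \<rho> assume \<rho>: "cstar_seminorm G \<rho>" "\<forall>h\<in>R. \<rho> h = 0"
    show "\<rho> (f + g) \<le> ?U f + ?U g"
      using sn(4)[OF \<rho>(1) that] upper[OF that(1) \<rho>] upper[OF that(2) \<rho>] by simp
  qed
  show "?U (f * g) \<le> ?U f * ?U g" if "f \<in> free_star G" "g \<in> free_star G" for f g
  proof (rule univ_norm_least)
    fix \<rho> assume \<rho>: "cstar_seminorm G \<rho>" "\<forall>h\<in>R. \<rho> h = 0"
    have "\<rho> (f * g) \<le> \<rho> f * \<rho> g"
      using sn(5) \<rho> that by blast
    also have "\<dots> \<le> ?U f * ?U g"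
      using upper[OF _ \<rho>] that sn(1)[OF \<rho>(1) that(2) that(1)] nn by (intro mult_mono) auto
    finally show "\<rho> (f * g) \<le> ?U f * ?U g" .
  qed
qed

section \<open>The completion\<close>

locale completion = cstar_semi G "univ_norm G R" for G :: "'l set" and R +
  fixes e :: "'l star_poly"
  assumes unit_closed: "e \<in> free_star G"
begin

abbreviation "\<rho> \<equiv> univ_norm G R"
abbreviation "A \<equiv> univ_cstar G R e"
abbreviation "cls \<equiv> null_class G R"
abbreviation "CS \<equiv> cauchy_seqs G R"

lemma CS_free_star: "X \<in> CS \<Longrightarrow> X n \<in> free_star G"
  by (simp add: cauchy_seqs_def)

lemma CS_cauchy: "X \<in> CS \<Longrightarrow> 0 < \<epsilon> \<Longrightarrow> \<exists>N. \<forall>m\<ge>N. \<forall>n\<ge>N. \<rho> (X m - X n) < \<epsilon>"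
  by (simp add: cauchy_seqs_def)

lemma CSI:
  assumes "\<And>n. X n \<in> free_star G"
    and "\<And>\<epsilon>. 0 < \<epsilon> \<Longrightarrow> \<exists>N. \<forall>m\<ge>N. \<forall>n\<ge>N. \<rho> (X m - X n) < \<epsilon>"
  shows "X \<in> CS"
  using assms by (simp add: cauchy_seqs_def)

lemma CS_const: "f \<in> free_star G \<Longrightarrow> (\<lambda>_. f) \<in> CS"
  by (rule CSI) auto

lemma CS_bounded:
  assumes "X \<in> CS"
  obtains B where "0 < B" "\<And>n. \<rho> (X n) \<le> B"
proof -
  obtain N where N: "\<forall>m\<ge>N. \<forall>n\<ge>N. \<rho> (X m - X n) < 1"
    using CS_cauchy[OF assms, of 1] by auto
  define B where "B = Max ((\<lambda>n. \<rho> (X n)) ` {..N}) + 1"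
  have M: "\<rho> (X n) \<le> B - 1" if "n \<le> N" for n
    using that by (simp add: B_def)
  have "\<rho> (X n) \<le> B" for n
  proof (cases "n \<le> N")
    case False
    have "\<rho> (X n) \<le> \<rho> (X n - X N) + \<rho> (X N)"
      using rho_add[of "X n - X N" "X N"] CS_free_star[OF assms] by simp
    moreover have "\<rho> (X n - X N) < 1"
      using N False by simp
    ultimately show ?thesis
      using M[of N] by simp
  qed (use M in force)
  moreover have "0 < B"
    using M[of 0] rho_nonneg[OF CS_free_star[OF assms], of 0] by simp
  ultimately show thesis
    using that by blast
qed

lemma CS_add:
  assumes X: "X \<in> CS" and Y: "Y \<in> CS"
  shows "(\<lambda>n. X n + Y n) \<in> CS"
proof (rule CSI)
  fix \<epsilon> :: real assume "0 < \<epsilon>"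
  then obtain M N where M: "\<forall>m\<ge>M. \<forall>n\<ge>M. \<rho> (X m - X n) < \<epsilon> / 2"
    and N: "\<forall>m\<ge>N. \<forall>n\<ge>N. \<rho> (Y m - Y n) < \<epsilon> / 2"
    using CS_cauchy[OF X, of "\<epsilon> / 2"] CS_cauchy[OF Y, of "\<epsilon> / 2"] by auto
  have "\<rho> (X m + Y m - (X n + Y n)) < \<epsilon>" if "m \<ge> max M N" "n \<ge> max M N" for m n
  proof -
    have "X m + Y m - (X n + Y n) = (X m - X n) + (Y m - Y n)"
      by simp
    then have "\<rho> (X m + Y m - (X n + Y n)) \<le> \<rho> (X m - X n) + \<rho> (Y m - Y n)"
      using rho_add CS_free_star[OF X] CS_free_star[OF Y] by (metis free_star_diff)
    moreover have "\<rho> (X m - X n) < \<epsilon> / 2" "\<rho> (Y m - Y n) < \<epsilon> / 2"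
      using M N that by auto
    ultimately show ?thesis
      by simp
  qed
  then show "\<exists>N. \<forall>m\<ge>N. \<forall>n\<ge>N. \<rho> (X m + Y m - (X n + Y n)) < \<epsilon>"
    by blast
qed (use assms CS_free_star in auto)

lemma CS_uminus: "X \<in> CS \<Longrightarrow> (\<lambda>n. - X n) \<in> CS"
  unfolding cauchy_seqs_def
  using rho_minus_commute[of "X m" "X n" for m n] by (auto simp: add.commute)

lemma rho_mult_diff:
  assumes "f \<in> free_star G" "f' \<in> free_star G" "g \<in> free_star G" "g' \<in> free_star G"
  shows "\<rho> (f * g - f' * g') \<le> \<rho> (f - f') * \<rho> g + \<rho> f' * \<rho> (g - g')"
proof -
  have "f * g - f' * g' = (f - f') * g + f' * (g - g')"
    by (simp add: algebra_simps)
  then have "\<rho> (f * g - f' * g') \<le> \<rho> ((f - f') * g) + \<rho> (f' * (g - g'))"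
    using rho_add[of "(f - f') * g" "f' * (g - g')"] assms by simp
  moreover have "\<rho> ((f - f') * g) \<le> \<rho> (f - f') * \<rho> g" "\<rho> (f' * (g - g')) \<le> \<rho> f' * \<rho> (g - g')"
    using assms by (auto intro!: rho_mult)
  ultimately show ?thesis
    by linarith
qed

lemma CS_mult:
  assumes X: "X \<in> CS" and Y: "Y \<in> CS"
  shows "(\<lambda>n. X n * Y n) \<in> CS"
proof (rule CSI)
  fix \<epsilon> :: real assume "0 < \<epsilon>"
  obtain B where B: "0 < B" "\<And>n. \<rho> (X n) \<le> B"
    using CS_bounded[OF X] by blast
  obtain C where C: "0 < C" "\<And>n. \<rho> (Y n) \<le> C"
    using CS_bounded[OF Y] by blast
  obtain M N where M: "\<forall>m\<ge>M. \<forall>n\<ge>M. \<rho> (X m - X n) < \<epsilon> / (2 * C)"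
    and N: "\<forall>m\<ge>N. \<forall>n\<ge>N. \<rho> (Y m - Y n) < \<epsilon> / (2 * B)"
    using CS_cauchy[OF X, of "\<epsilon> / (2 * C)"] CS_cauchy[OF Y, of "\<epsilon> / (2 * B)"] B C \<open>0 < \<epsilon>\<close> by auto
  have "\<rho> (X m * Y m - X n * Y n) < \<epsilon>" if "m \<ge> max M N" "n \<ge> max M N" for m n
  proof -
    have "\<rho> (X m * Y m - X n * Y n) \<le> \<rho> (X m - X n) * \<rho> (Y m) + \<rho> (X n) * \<rho> (Y m - Y n)"
      using CS_free_star[OF X] CS_free_star[OF Y] by (intro rho_mult_diff)
    also have "\<dots> \<le> \<rho> (X m - X n) * C + B * \<rho> (Y m - Y n)"
      using B C CS_free_star[OF X] CS_free_star[OF Y]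
      by (intro add_mono mult_left_mono mult_right_mono rho_nonneg) auto
    also have "\<dots> < \<epsilon> / (2 * C) * C + B * (\<epsilon> / (2 * B))"
      using M N B C that by (intro add_strict_mono mult_strict_right_mono mult_strict_left_mono) auto
    also have "\<dots> = \<epsilon>"
      using B C by simp
    finally show ?thesis .
  qed
  then show "\<exists>N. \<forall>m\<ge>N. \<forall>n\<ge>N. \<rho> (X m * Y m - X n * Y n) < \<epsilon>"
    by blast
qed (use assms CS_free_star in auto)

lemma CS_sum: "(\<And>i. i \<in> I \<Longrightarrow> X i \<in> CS) \<Longrightarrow> (\<lambda>n. \<Sum>i\<in>I. X i n) \<in> CS"
  by (induction I rule: infinite_finite_induct) (auto intro: CS_const CS_add)

lemma null_trans:
  assumes "X \<in> CS" "Y \<in> CS" "Z \<in> CS"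
    and "(\<lambda>n. \<rho> (X n - Y n)) \<longlonglongrightarrow> 0" "(\<lambda>n. \<rho> (Y n - Z n)) \<longlonglongrightarrow> 0"
  shows "(\<lambda>n. \<rho> (X n - Z n)) \<longlonglongrightarrow> 0"
proof (rule tendsto_zero_squeeze[OF tendsto_add_zero[OF assms(4,5)]])
  fix n
  have "X n \<in> free_star G" "Y n \<in> free_star G" "Z n \<in> free_star G"
    using assms(1-3) by (auto intro: CS_free_star)
  then show "\<bar>\<rho> (X n - Z n)\<bar> \<le> \<rho> (X n - Y n) + \<rho> (Y n - Z n)"
    using rho_add[of "X n - Y n" "Y n - Z n"] rho_nonneg[of "X n - Z n"] by simp
qed

lemma null_sym:
  assumes "X \<in> CS" "Y \<in> CS" "(\<lambda>n. \<rho> (X n - Y n)) \<longlonglongrightarrow> 0"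
  shows "(\<lambda>n. \<rho> (Y n - X n)) \<longlonglongrightarrow> 0"
  using assms rho_minus_commute[OF CS_free_star[OF assms(1)] CS_free_star[OF assms(2)]] by simp

lemma mem_cls_iff: "Y \<in> cls X \<longleftrightarrow> Y \<in> CS \<and> (\<lambda>n. \<rho> (X n - Y n)) \<longlonglongrightarrow> 0"
  by (simp add: null_class_def)

lemma mem_cls_self: "X \<in> CS \<Longrightarrow> X \<in> cls X"
  by (simp add: mem_cls_iff)

lemma cls_eq_iff:
  assumes "X \<in> CS" "Y \<in> CS"
  shows "cls X = cls Y \<longleftrightarrow> (\<lambda>n. \<rho> (X n - Y n)) \<longlonglongrightarrow> 0"
proof
  assume "cls X = cls Y"
  then show "(\<lambda>n. \<rho> (X n - Y n)) \<longlonglongrightarrow> 0"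
    using mem_cls_self[OF assms(2)] by (auto simp: mem_cls_iff)
next
  assume *: "(\<lambda>n. \<rho> (X n - Y n)) \<longlonglongrightarrow> 0"
  show "cls X = cls Y"
    using null_trans[OF assms _ *] null_trans[OF assms(2,1) _ null_sym[OF assms *]]
    unfolding mem_cls_iff set_eq_iff
    by (meson assms null_trans null_sym *)
qed

lemma carrier_eq: "carrier A = cls ` CS"
  by (simp add: univ_cstar_def)

lemma cls_closed: "X \<in> CS \<Longrightarrow> cls X \<in> carrier A"
  by (simp add: carrier_eq)

lemma carrierE:
  assumes "P \<in> carrier A"
  obtains X where "X \<in> CS" "P = cls X"
  using assms by (auto simp: carrier_eq)

text \<open>The definition takes a union over representatives; all members of this union are one and
  the same class, so the union collapses. For \<open>cls_mult\<close> the same works because Cauchy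
  sequences are bounded.\<close>

lemma cls_add:
  assumes X: "X \<in> CS" and Y: "Y \<in> CS"
  shows "cls X \<oplus>\<^bsub>A\<^esub> cls Y = cls (\<lambda>n. X n + Y n)"
proof -
  have "cls (\<lambda>n. X' n + Y' n) = cls (\<lambda>n. X n + Y n)" if "X' \<in> cls X" "Y' \<in> cls Y" for X' Y'
  proof -
    have *: "X' \<in> CS" "Y' \<in> CS" "(\<lambda>n. \<rho> (X n - X' n)) \<longlonglongrightarrow> 0" "(\<lambda>n. \<rho> (Y n - Y' n)) \<longlonglongrightarrow> 0"
      using that by (auto simp: mem_cls_iff)
    have "(\<lambda>n. \<rho> (X n + Y n - (X' n + Y' n))) \<longlonglongrightarrow> 0"
    proof (rule tendsto_zero_squeeze[OF tendsto_add_zero[OF *(3,4)]])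
      fix n
      have "X n \<in> free_star G" "Y n \<in> free_star G" "X' n \<in> free_star G" "Y' n \<in> free_star G"
        using * X Y by (auto intro: CS_free_star)
      then show "\<bar>\<rho> (X n + Y n - (X' n + Y' n))\<bar> \<le> \<rho> (X n - X' n) + \<rho> (Y n - Y' n)"
        using rho_add[of "X n - X' n" "Y n - Y' n"] rho_nonneg[of "X n + Y n - (X' n + Y' n)"]
        by (simp add: algebra_simps)
    qed
    then show ?thesis
      using cls_eq_iff[OF CS_add[OF X Y] CS_add[OF *(1,2)]] by simp
  qed
  then have "(\<Union>X'\<in>cls X. \<Union>Y'\<in>cls Y. cls (\<lambda>n. X' n + Y' n)) = cls (\<lambda>n. X n + Y n)"
    using mem_cls_self[OF X] mem_cls_self[OF Y] by blast
  then show ?thesis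
    by (simp add: univ_cstar_def)
qed

lemma cls_mult:
  assumes X: "X \<in> CS" and Y: "Y \<in> CS"
  shows "cls X \<otimes>\<^bsub>A\<^esub> cls Y = cls (\<lambda>n. X n * Y n)"
proof -
  obtain C where C: "0 < C" "\<And>n. \<rho> (Y n) \<le> C"
    using CS_bounded[OF Y] by blast
  have "cls (\<lambda>n. X' n * Y' n) = cls (\<lambda>n. X n * Y n)" if "X' \<in> cls X" "Y' \<in> cls Y" for X' Y'
  proof -
    have *: "X' \<in> CS" "Y' \<in> CS" "(\<lambda>n. \<rho> (X n - X' n)) \<longlonglongrightarrow> 0" "(\<lambda>n. \<rho> (Y n - Y' n)) \<longlonglongrightarrow> 0"
      using that by (auto simp: mem_cls_iff)
    obtain B where B: "0 < B" "\<And>n. \<rho> (X' n) \<le> B"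
      using CS_bounded[OF *(1)] by blast
    have "(\<lambda>n. \<rho> (X n * Y n - X' n * Y' n)) \<longlonglongrightarrow> 0"
    proof (rule tendsto_zero_squeeze)
      show "(\<lambda>n. \<rho> (X n - X' n) * C + B * \<rho> (Y n - Y' n)) \<longlonglongrightarrow> 0"
        using tendsto_add_zero[OF tendsto_mult_left_zero[OF *(3)] tendsto_mult_right_zero[OF *(4)]] .
      fix n
      have fs: "X n \<in> free_star G" "Y n \<in> free_star G" "X' n \<in> free_star G" "Y' n \<in> free_star G"
        using * X Y by (auto intro: CS_free_star)
      have "\<rho> (X n * Y n - X' n * Y' n) \<le> \<rho> (X n - X' n) * \<rho> (Y n) + \<rho> (X' n) * \<rho> (Y n - Y' n)"
        using fs by (intro rho_mult_diff) auto
      also have "\<dots> \<le> \<rho> (X n - X' n) * C + B * \<rho> (Y n - Y' n)"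
        using B C fs by (intro add_mono mult_left_mono mult_right_mono rho_nonneg) auto
      finally show "\<bar>\<rho> (X n * Y n - X' n * Y' n)\<bar> \<le> \<rho> (X n - X' n) * C + B * \<rho> (Y n - Y' n)"
        using rho_nonneg[of "X n * Y n - X' n * Y' n"] fs by simp
    qed
    then show ?thesis
      using cls_eq_iff[OF CS_mult[OF X Y] CS_mult[OF *(1,2)]] by simp
  qed
  then have "(\<Union>X'\<in>cls X. \<Union>Y'\<in>cls Y. cls (\<lambda>n. X' n * Y' n)) = cls (\<lambda>n. X n * Y n)"
    using mem_cls_self[OF X] mem_cls_self[OF Y] by blast
  then show ?thesis
    by (simp add: univ_cstar_def)
qed

lemma cls_zero: "\<zero>\<^bsub>A\<^esub> = cls (\<lambda>_. 0)"
  by (simp add: univ_cstar_def)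

lemma cls_one: "\<one>\<^bsub>A\<^esub> = cls (\<lambda>_. e)"
  by (simp add: univ_cstar_def)

text \<open>The sum in \<open>Lg\<close> and the difference in \<open>Lg_dense\<close> are the
  generic ones of abelian groups with carrier, and their rules rest on this structure.\<close>

lemma abelian_group_A: "abelian_group A"
proof (rule abelian_groupI)
  fix P Q S assume "P \<in> carrier A" "Q \<in> carrier A" "S \<in> carrier A"
  then show "P \<oplus>\<^bsub>A\<^esub> Q \<oplus>\<^bsub>A\<^esub> S = P \<oplus>\<^bsub>A\<^esub> (Q \<oplus>\<^bsub>A\<^esub> S)"
    by (auto elim!: carrierE simp: cls_add CS_add add.assoc)
next
  fix P Q assume "P \<in> carrier A" "Q \<in> carrier A"
  then show "P \<oplus>\<^bsub>A\<^esub> Q \<in> carrier A" "P \<oplus>\<^bsub>A\<^esub> Q = Q \<oplus>\<^bsub>A\<^esub> P"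
    by (auto elim!: carrierE simp: cls_add CS_add cls_closed add.commute)
next
  fix P assume "P \<in> carrier A"
  then show "\<zero>\<^bsub>A\<^esub> \<oplus>\<^bsub>A\<^esub> P = P"
    by (auto elim!: carrierE simp: cls_zero cls_add CS_const)
next
  fix P assume "P \<in> carrier A"
  then obtain X where X: "X \<in> CS" "P = cls X"
    by (rule carrierE)
  then have "cls (\<lambda>n. - X n) \<oplus>\<^bsub>A\<^esub> P = \<zero>\<^bsub>A\<^esub>"
    by (simp add: cls_zero cls_add CS_uminus)
  then show "\<exists>Q\<in>carrier A. Q \<oplus>\<^bsub>A\<^esub> P = \<zero>\<^bsub>A\<^esub>"
    using cls_closed[OF CS_uminus[OF X(1)]] by blast
qed (simp add: cls_zero cls_closed CS_const)

lemma cls_minus: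
  assumes X: "X \<in> CS" and Y: "Y \<in> CS"
  shows "cls X \<ominus>\<^bsub>A\<^esub> cls Y = cls (\<lambda>n. X n - Y n)"
proof -
  interpret abelian_group A
    by (rule abelian_group_A)
  have "cls (\<lambda>n. - Y n) \<oplus>\<^bsub>A\<^esub> cls Y = \<zero>\<^bsub>A\<^esub>"
    by (simp add: cls_zero cls_add CS_uminus Y)
  then have "\<ominus>\<^bsub>A\<^esub> cls Y = cls (\<lambda>n. - Y n)"
    by (rule minus_equality) (auto intro: cls_closed CS_uminus Y)
  then show ?thesis
    by (simp add: a_minus_def cls_add CS_uminus X Y)
qed

lemma cls_finsum:
  assumes "finite I" "\<And>i. i \<in> I \<Longrightarrow> X i \<in> CS"
  shows "(\<Oplus>\<^bsub>A\<^esub>i\<in>I. cls (X i)) = cls (\<lambda>n. \<Sum>i\<in>I. X i n)"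
proof -
  interpret abelian_group A
    by (rule abelian_group_A)
  show ?thesis
    using assms
  proof (induction I)
    case empty
    then show ?case
      by (simp add: cls_zero)
  next
    case (insert i I)
    then have "(\<Oplus>\<^bsub>A\<^esub>j\<in>insert i I. cls (X j)) = cls (X i) \<oplus>\<^bsub>A\<^esub> (\<Oplus>\<^bsub>A\<^esub>j\<in>I. cls (X j))"
      by (intro finsum_insert) (auto intro: cls_closed)
    with insert show ?case
      by (simp add: cls_add CS_sum)
  qed
qed

lemma rho_diff_abs:
  assumes "f \<in> free_star G" "g \<in> free_star G"
  shows "\<bar>\<rho> f - \<rho> g\<bar> \<le> \<rho> (f - g)"
  using rho_add[of "f - g" g] rho_add[of "g - f" f] rho_minus_commute[OF assms] assms
  by auto

text \<open>By the reverse triangle inequality the norms form a real Cauchy sequence, and equivalent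
  sequences share its limit; hence the definite description in \<open>nrm\<close> has a unique
  solution.\<close>

lemma nrm_cls:
  assumes "X \<in> CS"
  shows "(\<lambda>n. \<rho> (X n)) \<longlonglongrightarrow> nrm A (cls X)"
proof -
  have "Cauchy (\<lambda>n. \<rho> (X n))"
  proof (rule CauchyI)
    fix \<epsilon> :: real assume "0 < \<epsilon>"
    then obtain N where N: "\<forall>m\<ge>N. \<forall>n\<ge>N. \<rho> (X m - X n) < \<epsilon>"
      using CS_cauchy[OF assms] by blast
    have "norm (\<rho> (X m) - \<rho> (X n)) < \<epsilon>" if "m \<ge> N" "n \<ge> N" for m n
    proof -
      have "\<bar>\<rho> (X m) - \<rho> (X n)\<bar> \<le> \<rho> (X m - X n)"
        by (intro rho_diff_abs CS_free_star assms)
      also have "\<dots> < \<epsilon>"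
        using N that by blast
      finally show ?thesis
        by simp
    qed
    then show "\<exists>N. \<forall>m\<ge>N. \<forall>n\<ge>N. norm (\<rho> (X m) - \<rho> (X n)) < \<epsilon>"
      by blast
  qed
  then obtain r where r: "(\<lambda>n. \<rho> (X n)) \<longlonglongrightarrow> r"
    using Cauchy_convergent_iff convergent_def by blast
  have "(\<lambda>n. \<rho> (Y n)) \<longlonglongrightarrow> r" if "Y \<in> cls X" for Y
  proof -
    have Y: "Y \<in> CS" "(\<lambda>n. \<rho> (X n - Y n)) \<longlonglongrightarrow> 0"
      using that by (auto simp: mem_cls_iff)
    have "(\<lambda>n. \<rho> (X n) - \<rho> (Y n)) \<longlonglongrightarrow> 0"
      by (rule tendsto_zero_squeeze[OF Y(2)])
        (use rho_diff_abs CS_free_star[OF assms] CS_free_star[OF Y(1)] in auto)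
    from tendsto_diff[OF r this] show ?thesis
      by simp
  qed
  moreover have "r' = r" if "\<forall>Y\<in>cls X. (\<lambda>n. \<rho> (Y n)) \<longlonglongrightarrow> r'" for r'
    using that mem_cls_self[OF assms] r LIMSEQ_unique by blast
  ultimately have "(THE r. \<forall>Y\<in>cls X. (\<lambda>n. \<rho> (Y n)) \<longlonglongrightarrow> r) = r"
    by (intro the_equality) auto
  then show ?thesis
    using r by (simp add: univ_cstar_def)
qed

end

section \<open>Finite-dimensional algebras have stable rank one\<close>

text \<open>Gaussian elimination with unknowns \<open>K\<close> and equations \<open>B\<close>: an
  unknown \<open>l\<close> with non-zero coefficient in equation \<open>b\<close> is solved for and
  substituted, which removes one equation and one unknown.\<close>

lemma homogeneous_system_solvable:
  fixes c :: "'a \<Rightarrow> 'b \<Rightarrow> complex"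
  assumes "finite B" "finite K" "card B < card K"
  shows "\<exists>a. (\<exists>k\<in>K. a k \<noteq> 0) \<and> (\<forall>b\<in>B. (\<Sum>k\<in>K. a k * c k b) = 0)"
  using assms
proof (induction B arbitrary: K c)
  case empty
  then obtain k where "k \<in> K"
    by fastforce
  then show ?case
    by (intro exI[of _ "\<lambda>_. 1"]) auto
next
  case (insert b B)
  show ?case
  proof (cases "\<forall>k\<in>K. c k b = 0")
    case True
    obtain a where "\<exists>k\<in>K. a k \<noteq> 0" "\<forall>b\<in>B. (\<Sum>k\<in>K. a k * c k b) = 0"
      using insert.IH[of K c] insert.prems insert.hyps by auto
    with True show ?thesis
      by (intro exI[of _ a]) auto
  next
    case False
    then obtain l where l: "l \<in> K" "c l b \<noteq> 0"
      by blast
    define c' where "c' k b' = c k b' - c k b / c l b * c l b'" for k b'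
    have "card B < card (K - {l})"
      using insert l by simp
    then obtain a where a: "\<exists>k\<in>K - {l}. a k \<noteq> 0" "\<forall>b'\<in>B. (\<Sum>k\<in>K - {l}. a k * c' k b') = 0"
      using insert.IH[of "K - {l}" c'] insert.prems by auto
    define a' where "a' = a(l := - (\<Sum>k\<in>K - {l}. a k * (c k b / c l b)))"
    have "(\<Sum>k\<in>K. a' k * c k b') = (\<Sum>k\<in>K - {l}. a k * c' k b')" for b'
    proof -
      have "(\<Sum>k\<in>K. a' k * c k b') = a' l * c l b' + (\<Sum>k\<in>K - {l}. a' k * c k b')"
        using insert.prems l by (intro sum.remove) auto
      also have "(\<Sum>k\<in>K - {l}. a' k * c k b') = (\<Sum>k\<in>K - {l}. a k * c k b')"
        by (intro sum.cong) (auto simp: a'_def)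
      also have "a' l * c l b' = - (\<Sum>k\<in>K - {l}. a k * (c k b / c l b * c l b'))"
        by (simp add: a'_def sum_distrib_right mult.assoc)
      finally show ?thesis
        by (simp add: c'_def right_diff_distrib sum_subtractf)
    qed
    moreover have "(\<Sum>k\<in>K - {l}. a k * c' k b) = 0"
      using l by (simp add: c'_def)
    moreover have "\<exists>k\<in>K. a' k \<noteq> 0"
      using a(1) by (auto simp: a'_def)
    ultimately show ?thesis
      using a(2) by (intro exI[of _ a']) auto
  qed
qed

context cstar_semi
begin

definition spanned :: "'i set \<Rightarrow> ('i \<Rightarrow> 'l star_poly) \<Rightarrow> 'l star_poly \<Rightarrow> bool" where
  "spanned B U f \<longleftrightarrow> (\<exists>c. f \<approx> (\<Sum>b\<in>B. sp_scale (c b) (U b)))"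

lemma spannedI: "f \<approx> (\<Sum>b\<in>B. sp_scale (c b) (U b)) \<Longrightarrow> spanned B U f"
  unfolding spanned_def by (rule exI[of _ c])

lemma spanned_zero: "spanned B U 0"
  unfolding spanned_def by (intro exI[of _ "\<lambda>_. 0"]) auto

lemma spanned_eqv: "f \<approx> g \<Longrightarrow> spanned B U g \<Longrightarrow> spanned B U f"
  unfolding spanned_def using eqv_trans by blast

lemma spanned_add:
  assumes "spanned B U f" "spanned B U g"
  shows "spanned B U (f + g)"
proof -
  obtain c d where "f \<approx> (\<Sum>b\<in>B. sp_scale (c b) (U b))" "g \<approx> (\<Sum>b\<in>B. sp_scale (d b) (U b))"
    using assms by (auto simp: spanned_def)
  from eqv_add[OF this] have "f + g \<approx> (\<Sum>b\<in>B. sp_scale (c b + d b) (U b))"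
    by (simp add: sp_scale_add_left sum.distrib)
  then show ?thesis
    by (rule spannedI)
qed

lemma spanned_scale:
  assumes "spanned B U f"
  shows "spanned B U (sp_scale a f)"
proof -
  obtain c where "f \<approx> (\<Sum>b\<in>B. sp_scale (c b) (U b))"
    using assms by (auto simp: spanned_def)
  from eqv_scale[OF this, of a] have "sp_scale a f \<approx> (\<Sum>b\<in>B. sp_scale (a * c b) (U b))"
    by (simp add: sp_scale_sum)
  then show ?thesis
    by (rule spannedI)
qed

lemma spanned_sum: "(\<And>i. i \<in> I \<Longrightarrow> spanned B U (f i)) \<Longrightarrow> spanned B U (sum f I)"
  by (induction I rule: infinite_finite_induct) (auto intro: spanned_zero spanned_add)

lemma spanned_basis:
  assumes "finite B" "b \<in> B" "U b \<in> free_star G"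
  shows "spanned B U (U b)"
proof -
  have "(\<Sum>x\<in>B. sp_scale (if x = b then 1 else 0) (U x)) = (\<Sum>x\<in>B. if x = b then U x else 0)"
    by (intro sum.cong) auto
  also have "\<dots> = U b"
    using assms by simp
  finally show ?thesis
    unfolding spanned_def using assms by (intro exI[of _ "\<lambda>x. if x = b then 1 else 0"]) auto
qed

lemma spanned_mult:
  assumes "\<And>b b'. b \<in> B \<Longrightarrow> b' \<in> B \<Longrightarrow> spanned B U (U b * U b')"
    and "spanned B U f" "spanned B U g"
  shows "spanned B U (f * g)"
proof -
  obtain c d where "f \<approx> (\<Sum>b\<in>B. sp_scale (c b) (U b))" "g \<approx> (\<Sum>b\<in>B. sp_scale (d b) (U b))"
    using assms(2,3) by (auto simp: spanned_def)
  from eqv_mult[OF this]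
  have "f * g \<approx> (\<Sum>b\<in>B. \<Sum>b'\<in>B. sp_scale (c b * d b') (U b * U b'))"
    by (simp add: sum_product sp_scale_mult_left sp_scale_mult_right mult.commute)
  moreover have "spanned B U (\<Sum>b\<in>B. \<Sum>b'\<in>B. sp_scale (c b * d b') (U b * U b'))"
    using assms(1) by (intro spanned_sum spanned_scale)
  ultimately show ?thesis
    by (rule spanned_eqv)
qed

text \<open>The \<open>card B + 1\<close> powers of \<open>f\<close> have coordinate vectors of
  length \<open>card B\<close>, so they are dependent. The powers start at \<open>f\<close>, because
  \<open>f ^ 0 = 1\<close> lies outside \<open>free_star G\<close>.\<close>

lemma spanned_algebraic:
  assumes "finite B" "\<And>b. b \<in> B \<Longrightarrow> U b \<in> free_star G"
    and "\<And>b b'. b \<in> B \<Longrightarrow> b' \<in> B \<Longrightarrow> spanned B U (U b * U b')"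
    and f: "f \<in> free_star G" "spanned B U f"
  shows "\<exists>n a. (\<exists>k\<le>n. a k \<noteq> 0) \<and> (\<Sum>k\<le>n. sp_scale (a k) (f ^ Suc k)) \<approx> 0"
proof -
  have "spanned B U (f ^ Suc k)" for k
    by (induction k) (use f spanned_mult[OF assms(3)] in auto)
  then obtain c where c: "f ^ Suc k \<approx> (\<Sum>b\<in>B. sp_scale (c k b) (U b))" for k
    unfolding spanned_def by metis
  obtain a where a: "\<exists>k\<le>card B. a k \<noteq> 0" "\<forall>b\<in>B. (\<Sum>k\<le>card B. a k * c k b) = 0"
    using homogeneous_system_solvable[of B "{..card B}" c] assms(1) by auto
  have "(\<Sum>k\<le>card B. sp_scale (a k) (f ^ Suc k))
      \<approx> (\<Sum>k\<le>card B. sp_scale (a k) (\<Sum>b\<in>B. sp_scale (c k b) (U b)))"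
    by (intro eqv_sum eqv_scale c)
  also have "\<dots> = (\<Sum>b\<in>B. \<Sum>k\<le>card B. sp_scale (a k * c k b) (U b))"
    unfolding sp_scale_sum by (subst sum.swap) simp
  also have "\<dots> = (\<Sum>b\<in>B. sp_scale (\<Sum>k\<le>card B. a k * c k b) (U b))"
    by (intro sum.cong) (auto simp: sp_scale_sum_left)
  also have "\<dots> = 0"
    using a(2) by simp
  finally show ?thesis
    using a(1) by blast
qed

text \<open>For the annihilating polynomial \<open>p\<close>, the difference
  \<open>p(f) - p(z) e\<close> is a left multiple of \<open>f - z e\<close>. Since
  \<open>p(f)\<close> vanishes, dividing by \<open>- p(z)\<close> gives a left inverse, unless
  \<open>z\<close> is one of the finitely many roots.\<close>

lemma algebraic_almost_invertible:
  assumes e: "e \<in> free_star G" "\<And>g. g \<in> free_star G \<Longrightarrow> e * g \<approx> g" "\<And>g. g \<in> free_star G \<Longrightarrow> g * e \<approx> g"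
    and f: "f \<in> free_star G"
    and alg: "\<exists>k\<le>n. a k \<noteq> 0" "(\<Sum>k\<le>n. sp_scale (a k) (f ^ Suc k)) \<approx> 0"
    and "0 < \<epsilon>"
  shows "\<exists>z y. cmod z < \<epsilon> \<and> y \<in> free_star G \<and> y * (f - sp_scale z e) \<approx> e"
proof -
  let ?p = "\<lambda>z. \<Sum>k\<le>n. a k * z ^ Suc k"
  have "finite {z. (\<Sum>k\<le>n. a k * z ^ k) = 0}"
    using alg(1) polyfun_finite_roots[of a n] by simp
  \<comment> \<open>The exponents in \<open>?p\<close> start at \<open>1\<close>, so
    \<open>0\<close> is a further root to be avoided.\<close>
  then have fin: "finite (insert 0 {z. (\<Sum>k\<le>n. a k * z ^ k) = 0})"
    by simp
  have "infinite ((\<lambda>t. complex_of_real t) ` {0<..<\<epsilon>})"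
    using \<open>0 < \<epsilon>\<close> by (subst finite_image_iff) (auto simp: inj_on_def infinite_Ioo)
  then obtain t where t: "t \<in> {0<..<\<epsilon>}" "of_real t \<notin> insert 0 {z. (\<Sum>k\<le>n. a k * z ^ k) = 0}"
    using fin by (metis (no_types, lifting) finite_subset image_subset_iff subsetI)
  define z where "z = complex_of_real t"
  have z: "cmod z < \<epsilon>"
    using t by (simp add: z_def)
  have "?p z = z * (\<Sum>k\<le>n. a k * z ^ k)"
    by (simp add: sum_distrib_left algebra_simps)
  then have pz: "?p z \<noteq> 0"
    using t by (simp add: z_def)
  let ?g = "f - sp_scale z e"
  have g: "?g \<in> free_star G"
    using e f by simp
  have pow: "f ^ Suc k \<in> free_star G" for k
    by (induction k) (use f in auto)
  have comm: "?g * f \<approx> f * ?g"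
  proof -
    have "f * f - sp_scale z (e * f) \<approx> f * f - sp_scale z (f * e)"
      using f by (intro eqv_diff eqv_scale eqv_trans[OF e(2)[OF f] eqv_sym[OF e(3)[OF f]]]) auto
    then show ?thesis
      by (simp add: algebra_simps sp_scale_mult_left sp_scale_mult_right)
  qed
  \<comment> \<open>The induction step is
    \<open>f^(k+2) - z^(k+2) = z^(k+1) (f - z) + (f^(k+1) - z^(k+1)) f\<close>; \<open>comm\<close>
    then moves the last factor \<open>f\<close> to the left of \<open>?g\<close>.\<close>
  have "\<exists>Q\<in>free_star G. f ^ Suc k - sp_scale (z ^ Suc k) e \<approx> Q * ?g" for k
  proof (induction k)
    case 0
    show ?case
      using e(1) eqv_sym[OF e(2)[OF g]] by (intro bexI[of _ e]) simp_all
  next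
    case (Suc k)
    then obtain Q where Q: "Q \<in> free_star G" "f ^ Suc k - sp_scale (z ^ Suc k) e \<approx> Q * ?g"
      by blast
    have "f ^ Suc (Suc k) - sp_scale (z ^ Suc (Suc k)) e =
        sp_scale (z ^ Suc k) ?g + (f ^ Suc k * f - sp_scale (z ^ Suc k) f)"
      by (simp add: sp_scale_diff power_Suc2[of f "Suc k"] power_Suc2[of z "Suc k"] del: power_Suc)
    also have "\<dots> \<approx> sp_scale (z ^ Suc k) (e * ?g) + (f ^ Suc k * f - sp_scale (z ^ Suc k) (e * f))"
      using e f g pow by (intro eqv_add eqv_diff eqv_scale eqv_sym[OF e(2)] eqv_refl) auto
    also have "\<dots> = sp_scale (z ^ Suc k) e * ?g + (f ^ Suc k - sp_scale (z ^ Suc k) e) * f"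
      by (simp add: left_diff_distrib sp_scale_mult_left)
    also have "\<dots> \<approx> sp_scale (z ^ Suc k) e * ?g + (Q * ?g) * f"
      using e f g by (intro eqv_add eqv_mult_right Q(2) eqv_refl) auto
    also have "\<dots> = sp_scale (z ^ Suc k) e * ?g + Q * (?g * f)"
      by (simp add: mult.assoc)
    also have "\<dots> \<approx> sp_scale (z ^ Suc k) e * ?g + Q * (f * ?g)"
      using e g Q by (intro eqv_add eqv_mult_left comm eqv_refl) auto
    also have "\<dots> = (sp_scale (z ^ Suc k) e + Q * f) * ?g"
      by (simp add: distrib_right mult.assoc)
    finally show ?case
      using Q e f by (intro bexI[of _ "sp_scale (z ^ Suc k) e + Q * f"]) auto
  qed
  then obtain Q where Q: "Q k \<in> free_star G" "f ^ Suc k - sp_scale (z ^ Suc k) e \<approx> Q k * ?g" for k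
    by metis
  define y where "y = sp_scale (- 1 / ?p z) (\<Sum>k\<le>n. sp_scale (a k) (Q k))"
  have "y * ?g = sp_scale (- 1 / ?p z) (\<Sum>k\<le>n. sp_scale (a k) (Q k * ?g))"
    by (simp add: y_def sp_scale_mult_left sum_distrib_right)
  also have "\<dots> \<approx> sp_scale (- 1 / ?p z) (\<Sum>k\<le>n. sp_scale (a k) (f ^ Suc k - sp_scale (z ^ Suc k) e))"
    by (intro eqv_scale eqv_sum eqv_sym[OF Q(2)])
  also have "\<dots> = sp_scale (- 1 / ?p z) ((\<Sum>k\<le>n. sp_scale (a k) (f ^ Suc k)) - sp_scale (?p z) e)"
    by (simp add: sp_scale_diff sum_subtractf sp_scale_sum_left)
  also have "\<dots> \<approx> sp_scale (- 1 / ?p z) (0 - sp_scale (?p z) e)"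
    using e by (intro eqv_scale eqv_diff alg(2) eqv_refl) auto
  also have "\<dots> = e"
    using pz by simp
  finally show ?thesis
    using z Q by (intro exI[of _ z] exI[of _ y]) (auto simp: y_def)
qed

end

context completion
begin

notation eqv (infix \<open>\<approx>\<close> 50)

text \<open>The class is approximated by a polynomial, namely a late term of its Cauchy sequence,
  and the polynomial by a left-invertible one. A left inverse is exactly what membership in
  \<open>Lg A 1\<close> means.\<close>

lemma Lg_dense_one:
  assumes "\<And>f \<epsilon>. f \<in> free_star G \<Longrightarrow> 0 < \<epsilon> \<Longrightarrow>
    \<exists>z y. cmod z < \<epsilon> \<and> y \<in> free_star G \<and> y * (f - sp_scale z e) \<approx> e"
  shows "Lg_dense A 1"
  unfolding Lg_dense_def
proof (intro ballI allI impI)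
  fix x :: "nat \<Rightarrow> (nat \<Rightarrow> 'l star_poly) set" and \<epsilon> :: real
  assume x: "x \<in> {..<1} \<rightarrow>\<^sub>E carrier A" and \<epsilon>: "0 < \<epsilon>"
  then have "x 0 \<in> carrier A"
    by auto
  then obtain X where X: "X \<in> CS" "x 0 = cls X"
    by (rule carrierE)
  obtain N where N: "\<forall>m\<ge>N. \<forall>n\<ge>N. \<rho> (X m - X n) < \<epsilon> / 3"
    using CS_cauchy[OF X(1), of "\<epsilon> / 3"] \<epsilon> by auto
  have f: "X N \<in> free_star G"
    using X(1) by (rule CS_free_star)
  have re: "0 \<le> \<rho> e"
    using unit_closed by (rule rho_nonneg)
  \<comment> \<open>The bound on \<open>z\<close> keeps the perturbation \<open>z e\<close> within a
    third of \<open>\<epsilon>\<close>; the \<open>+ 1\<close> covers the case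
    \<open>\<rho> e = 0\<close>.\<close>
  then obtain z y where z: "cmod z < \<epsilon> / (3 * (\<rho> e + 1))" and y: "y \<in> free_star G"
    and inv: "y * (X N - sp_scale z e) \<approx> e"
    using assms[OF f, of "\<epsilon> / (3 * (\<rho> e + 1))"] \<epsilon> by auto
  define g where "g = X N - sp_scale z e"
  have g: "g \<in> free_star G"
    using f unit_closed by (simp add: g_def)
  have "(\<Oplus>\<^bsub>A\<^esub>i\<in>{..<1::nat}. cls (\<lambda>_. y) \<otimes>\<^bsub>A\<^esub> cls (\<lambda>_. g)) = (\<Oplus>\<^bsub>A\<^esub>i\<in>{..<1::nat}. cls (\<lambda>_. y * g))"
    using y g by (simp add: cls_mult CS_const)
  also have "\<dots> = cls (\<lambda>_. y * g)"
    using y g by (subst cls_finsum) (auto intro: CS_const)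
  also have "\<dots> = \<one>\<^bsub>A\<^esub>"
    unfolding cls_one using inv y g unit_closed
    by (subst cls_eq_iff) (auto intro: CS_const simp: eqv_def g_def)
  finally have one: "(\<Oplus>\<^bsub>A\<^esub>i\<in>{..<1::nat}. cls (\<lambda>_. y) \<otimes>\<^bsub>A\<^esub> cls (\<lambda>_. g)) = \<one>\<^bsub>A\<^esub>" .
  define z' where "z' = (\<lambda>i\<in>{..<1::nat}. cls (\<lambda>_. g))"
  define y' where "y' = (\<lambda>i\<in>{..<1::nat}. cls (\<lambda>_. y))"
  have mem: "z' \<in> {..<1} \<rightarrow>\<^sub>E carrier A" "y' \<in> {..<1} \<rightarrow>\<^sub>E carrier A"
    using y g by (auto simp: z'_def y'_def intro: cls_closed CS_const)
  interpret abelian_group A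
    by (rule abelian_group_A)
  have "(\<Oplus>\<^bsub>A\<^esub>i\<in>{..<1}. y' i \<otimes>\<^bsub>A\<^esub> z' i) = (\<Oplus>\<^bsub>A\<^esub>i\<in>{..<1::nat}. cls (\<lambda>_. y) \<otimes>\<^bsub>A\<^esub> cls (\<lambda>_. g))"
    using y g by (intro finsum_cong') (auto simp: z'_def y'_def cls_mult CS_const intro!: cls_closed CS_const)
  then have "z' \<in> Lg A 1"
    using mem one unfolding Lg_def by auto
  moreover have "nrm A (x 0 \<ominus>\<^bsub>A\<^esub> z' 0) < \<epsilon>"
  proof -
    have "x 0 \<ominus>\<^bsub>A\<^esub> z' 0 = cls (\<lambda>n. X n - g)"
      using X g by (simp add: z'_def cls_minus CS_const)
    moreover have mem: "(\<lambda>n. X n - g) \<in> CS"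
      using CS_add[OF X(1) CS_const[of "- g"]] g by simp
    moreover have "\<rho> (X n - g) \<le> \<epsilon> / 3 + \<epsilon> / 3" if "n \<ge> N" for n
    proof -
      have eq: "X n - g = (X n - X N) + sp_scale z e"
        by (simp add: g_def)
      have "\<rho> (X n - g) \<le> \<rho> (X n - X N) + \<rho> (sp_scale z e)"
        unfolding eq using rho_add[of "X n - X N" "sp_scale z e"] CS_free_star[OF X(1)] unit_closed by simp
      moreover have "\<rho> (X n - X N) < \<epsilon> / 3"
        using N that by blast
      moreover have "\<rho> (sp_scale z e) \<le> cmod z * (\<rho> e + 1)"
        using rho_scale[OF unit_closed] by (simp add: mult_left_mono)
      moreover have "cmod z * (\<rho> e + 1) \<le> \<epsilon> / 3"
        using z re by (simp add: field_simps)
      ultimately show ?thesis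
        by linarith
    qed
    ultimately have "nrm A (x 0 \<ominus>\<^bsub>A\<^esub> z' 0) \<le> \<epsilon> / 3 + \<epsilon> / 3"
      using LIMSEQ_le_const2[OF nrm_cls[OF mem], of "\<epsilon> / 3 + \<epsilon> / 3"] by auto
    with \<epsilon> show ?thesis
      by simp
  qed
  ultimately show "\<exists>z\<in>Lg A 1. \<forall>i<1. nrm A (x i \<ominus>\<^bsub>A\<^esub> z i) < \<epsilon>"
    by auto
qed


section \<open>Orthogonal isometries force infinite stable rank\<close>

text \<open>
  For \<open>x = (s\<^sub>0*, \<dots>, s\<^sub>n\<^sub>-\<^sub>1*)\<close> and a nearby \<open>z\<close>, the matrix \<open>z x*\<close> is close to the identity.  The
  elements \<open>t\<close> below are the partial sums of \<open>1 - x* (z x*)\<inverse> z\<close>: they are fixed by \<open>s\<^sub>n*\<close> on the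
  left, while \<open>z t\<close> tends to zero, so that \<open>z\<close> cannot be left invertible.
\<close>

lemma not_Lg_dense:
  assumes e: "\<And>f. f \<in> free_star G \<Longrightarrow> e * f \<approx> f" "\<And>f. f \<in> free_star G \<Longrightarrow> f * e \<approx> f"
      "sp_adj e \<approx> e" "\<rho> e \<noteq> 0"
    and s: "\<And>i. i \<le> n \<Longrightarrow> s i \<in> free_star G"
      "\<And>i j. i \<le> n \<Longrightarrow> j \<le> n \<Longrightarrow> sp_adj (s i) * s j \<approx> (if i = j then e else 0)"
    and n: "n \<ge> 1"
  shows "\<not> Lg_dense A n"
proof
  assume dense: "Lg_dense A n"
  have re: "\<rho> e = 1"
  proof -
    have "(\<rho> e)\<^sup>2 = \<rho> (sp_adj e * e)"
      by (rule rho_cstar[OF unit_closed, symmetric])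
    also have "\<dots> = \<rho> e"
      using eqv_rho[OF e(2)[of "sp_adj e"]] eqv_rho[OF e(3)] unit_closed by simp
    finally show ?thesis
      using e(4) by (simp add: power2_eq_square)
  qed
  have rs: "\<rho> (s i) = 1" "\<rho> (sp_adj (s i)) = 1" if "i \<le> n" for i
  proof -
    have "(\<rho> (s i))\<^sup>2 = 1"
      using rho_cstar[OF s(1)[OF that]] eqv_rho[OF s(2)[OF that that]] re by simp
    then show "\<rho> (s i) = 1" "\<rho> (sp_adj (s i)) = 1"
      using rho_nonneg[OF s(1)[OF that]] rho_adj[OF s(1)[OF that]] by (auto simp: power2_eq_1_iff)
  qed
  \<comment> \<open>In \<open>w_bound\<close> each of \<open>n\<close> summands contributes
    \<open>\<epsilon>\<close> times the previous bound, so \<open>n \<epsilon> = 1/2\<close> halves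
    the bound in every step.\<close>
  define \<epsilon> where "\<epsilon> = 1 / (2 * real n)"
  have \<epsilon>: "0 < \<epsilon>" "\<epsilon> \<le> 1"
    using n by (auto simp: \<epsilon>_def)
  define x where "x = (\<lambda>i\<in>{..<n}. cls (\<lambda>_. sp_adj (s i)))"
  have "x \<in> {..<n} \<rightarrow>\<^sub>E carrier A"
    using s by (auto simp: x_def intro!: cls_closed CS_const)
  then obtain z where z: "z \<in> Lg A n" "\<And>i. i < n \<Longrightarrow> nrm A (x i \<ominus>\<^bsub>A\<^esub> z i) < \<epsilon>"
    using dense \<epsilon>(1) unfolding Lg_dense_def by blast
  then obtain y where y: "y \<in> {..<n} \<rightarrow>\<^sub>E carrier A" and zc: "z \<in> {..<n} \<rightarrow>\<^sub>E carrier A"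
    and yz: "(\<Oplus>\<^bsub>A\<^esub>i\<in>{..<n}. y i \<otimes>\<^bsub>A\<^esub> z i) = \<one>\<^bsub>A\<^esub>"
    unfolding Lg_def by blast
  have "\<exists>X. X \<in> CS \<and> y i = cls X" "\<exists>X. X \<in> CS \<and> z i = cls X" if "i < n" for i
    using y zc that by (auto elim!: carrierE dest: PiE_mem)
  then obtain Y Z where Y: "\<And>i. i < n \<Longrightarrow> Y i \<in> CS" "\<And>i. i < n \<Longrightarrow> y i = cls (Y i)"
    and Z: "\<And>i. i < n \<Longrightarrow> Z i \<in> CS" "\<And>i. i < n \<Longrightarrow> z i = cls (Z i)"
    by metis
  have YZ: "(\<lambda>m. \<rho> ((\<Sum>i<n. Y i m * Z i m) - e)) \<longlonglongrightarrow> 0"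
  proof -
    interpret abelian_group A
      by (rule abelian_group_A)
    have "(\<Oplus>\<^bsub>A\<^esub>i\<in>{..<n}. y i \<otimes>\<^bsub>A\<^esub> z i) = (\<Oplus>\<^bsub>A\<^esub>i\<in>{..<n}. cls (\<lambda>m. Y i m * Z i m))"
      using Y Z by (intro finsum_cong') (auto simp: cls_mult intro!: cls_closed CS_mult)
    also have "\<dots> = cls (\<lambda>m. \<Sum>i<n. Y i m * Z i m)"
      using Y Z by (intro cls_finsum) (auto intro: CS_mult)
    finally have "cls (\<lambda>m. \<Sum>i<n. Y i m * Z i m) = cls (\<lambda>_. e)"
      using yz by (simp add: cls_one)
    moreover have "(\<lambda>m. \<Sum>i<n. Y i m * Z i m) \<in> CS"
      using Y Z by (intro CS_sum CS_mult) auto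
    ultimately show ?thesis
      using cls_eq_iff[OF _ CS_const[OF unit_closed]] by blast
  qed
  have "\<exists>C. 0 < C \<and> (\<forall>m. \<rho> (Y i m) \<le> C)" if "i < n" for i
    using CS_bounded[OF Y(1)[OF that]] by blast
  then obtain C where C: "\<And>i. i < n \<Longrightarrow> 0 < C i" "\<And>i m. i < n \<Longrightarrow> \<rho> (Y i m) \<le> C i"
    by metis
  \<comment> \<open>\<open>M\<close> will bound all \<open>t k\<close>: it is
    \<open>\<rho> e = 1\<close> plus the increments \<open>2 n / 2 ^ k\<close>, whose total is at
    most \<open>4 n\<close>. The tolerance \<open>1 / (2 * M)\<close> below then costs at most
    \<open>1/2\<close>.\<close>
  define M where "M = 1 + 4 * real n"
  have M: "0 < M"
    by (simp add: M_def)
  have "\<forall>\<^sub>F m in sequentially. \<rho> (sp_adj (s i) - Z i m) < \<epsilon>" if i: "i < n" for i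
  proof -
    have mem: "(\<lambda>m. sp_adj (s i) - Z i m) \<in> CS"
      using CS_add[OF CS_const CS_uminus[OF Z(1)[OF i]], of "sp_adj (s i)"] s i by simp
    have "nrm A (cls (\<lambda>m. sp_adj (s i) - Z i m)) < \<epsilon>"
      using z(2)[OF i] Z i s by (simp add: x_def cls_minus CS_const)
    with nrm_cls[OF mem] show ?thesis
      by (rule order_tendstoD)
  qed
  then have "\<forall>\<^sub>F m in sequentially. \<forall>i\<in>{..<n}. \<rho> (sp_adj (s i) - Z i m) < \<epsilon>"
    by (intro eventually_ball_finite) auto
  moreover have "\<forall>\<^sub>F m in sequentially. \<rho> ((\<Sum>i<n. Y i m * Z i m) - e) < 1 / (2 * M)"
    using YZ M by (intro order_tendstoD) auto
  ultimately have "\<forall>\<^sub>F m in sequentially. (\<forall>i\<in>{..<n}. \<rho> (sp_adj (s i) - Z i m) < \<epsilon>)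
      \<and> \<rho> ((\<Sum>i<n. Y i m * Z i m) - e) < 1 / (2 * M)"
    by (rule eventually_conj)
  then obtain m where m: "\<And>i. i < n \<Longrightarrow> \<rho> (sp_adj (s i) - Z i m) < \<epsilon>"
      "\<rho> ((\<Sum>i<n. Y i m * Z i m) - e) < 1 / (2 * M)"
    by (auto simp: eventually_sequentially)
  define p where "p i = Y i m" for i
  define q where "q i = Z i m" for i
  define D where "D i = sp_adj (s i) - q i" for i
  have fs: "p i \<in> free_star G" "q i \<in> free_star G" "D i \<in> free_star G" "s i \<in> free_star G" if "i < n" for i
    using that Y Z s CS_free_star by (auto simp: p_def q_def D_def)
  have rD: "\<rho> (D i) \<le> \<epsilon>" if "i < n" for i
    using m(1)[OF that] by (simp add: D_def q_def)
  \<comment> \<open>With \<open>x*\<close> the row of the \<open>s j\<close>, this is the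
    \<open>k\<close>-th power of \<open>1 - x* z\<close> applied to \<open>e\<close>; as an
    iteration it stays inside \<open>free_star G\<close>.\<close>
  define t where "t k = ((\<lambda>f. f - (\<Sum>j<n. s j * (q j * f))) ^^ k) e" for k
  have t0: "t 0 = e" and tS: "t (Suc k) = t k - (\<Sum>j<n. s j * (q j * t k))" for k
    by (simp_all add: t_def)
  have tf: "t k \<in> free_star G" for k
    by (induction k) (use unit_closed fs in \<open>auto simp: t0 tS intro!: free_star_diff free_star_sum free_star_mult\<close>)
  define w where "w k i = q i * t k" for k i
  have wf: "w k i \<in> free_star G" if "i < n" for k i
    using fs tf that by (simp add: w_def)
  have sf: "(\<Sum>j<n. s j * w k j) \<in> free_star G" for k
    using fs wf by (intro free_star_sum free_star_mult) auto
  \<comment> \<open>With \<open>q i = sp_adj (s i) - D i\<close>, orthogonality reproduces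
    \<open>w k i\<close> from the first part and cancels it, so that only the small
    \<open>D i\<close> is left.\<close>
  have w_step: "w (Suc k) i \<approx> D i * (\<Sum>j<n. s j * w k j)" if i: "i < n" for k i
  proof -
    have "w (Suc k) i = w k i - q i * (\<Sum>j<n. s j * w k j)"
      by (simp add: w_def tS algebra_simps)
    also have "\<dots> = w k i - (\<Sum>j<n. (sp_adj (s i) * s j) * w k j) + D i * (\<Sum>j<n. s j * w k j)"
      by (simp add: D_def left_diff_distrib sum_distrib_left mult.assoc sum_subtractf)
    also have "\<dots> \<approx> w k i - (\<Sum>j<n. (if i = j then e else 0) * w k j) + D i * (\<Sum>j<n. s j * w k j)"
      using i wf sf fs
      by (intro eqv_add eqv_diff eqv_sum eqv_mult_right s(2) eqv_refl) auto
    also have "(\<Sum>j<n. (if i = j then e else 0) * w k j) = (\<Sum>j<n. if j = i then e * w k j else 0)"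
      by (intro sum.cong) auto
    also have "\<dots> = e * w k i"
      using i by simp
    also have "w k i - e * w k i + D i * (\<Sum>j<n. s j * w k j) \<approx> w k i - w k i + D i * (\<Sum>j<n. s j * w k j)"
      using i wf sf fs by (intro eqv_add eqv_diff e(1) eqv_refl) auto
    finally show ?thesis
      by simp
  qed
  have w_bound: "\<forall>i<n. \<rho> (w k i) \<le> 2 / 2 ^ k" for k
  proof (induction k)
    case 0
    have "\<rho> (w 0 i) \<le> 2" if i: "i < n" for i
    proof -
      have "\<rho> (w 0 i) = \<rho> (q i)"
        using eqv_rho[OF e(2)[OF fs(2)[OF i]]] by (simp add: w_def t0)
      also have "q i = sp_adj (s i) - D i"
        by (simp add: D_def)
      also have "\<rho> \<dots> \<le> \<rho> (sp_adj (s i)) + \<rho> (D i)"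
        using fs i by (intro rho_diff) auto
      finally show ?thesis
        using rs(2)[of i] rD[OF i] \<epsilon> i by simp
    qed
    then show ?case
      by simp
  next
    case (Suc k)
    have "\<rho> (w (Suc k) i) \<le> 2 / 2 ^ Suc k" if i: "i < n" for i
    proof -
      have "\<rho> (\<Sum>j<n. s j * w k j) \<le> (\<Sum>j<n. \<rho> (s j * w k j))"
        using fs wf by (intro rho_sum) auto
      also have "\<dots> \<le> (\<Sum>j<n. 2 / 2 ^ k)"
      proof (rule sum_mono)
        fix j assume "j \<in> {..<n}"
        then show "\<rho> (s j * w k j) \<le> 2 / 2 ^ k"
          using rho_mult[OF fs(4) wf, of j j k] rs(1)[of j] Suc by fastforce
      qed
      finally have sb: "\<rho> (\<Sum>j<n. s j * w k j) \<le> real n * (2 / 2 ^ k)"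
        by simp
      have "\<rho> (w (Suc k) i) \<le> \<rho> (D i) * \<rho> (\<Sum>j<n. s j * w k j)"
        using eqv_rho[OF w_step[OF i]] rho_mult[OF fs(3)[OF i] sf] by simp
      also have "\<dots> \<le> \<epsilon> * (real n * (2 / 2 ^ k))"
        using rD[OF i] sb \<epsilon> rho_nonneg[OF sf] by (intro mult_mono) auto
      also have "\<dots> = 2 / 2 ^ Suc k"
        using n by (simp add: \<epsilon>_def)
      finally show ?thesis .
    qed
    then show ?case
      by blast
  qed
  have t_bound: "\<rho> (t k) \<le> 1 + 4 * real n * (1 - 1 / 2 ^ k)" for k
  proof (induction k)
    case 0
    then show ?case
      by (simp add: t0 re)
  next
    case (Suc k)
    have "\<rho> (t (Suc k)) \<le> \<rho> (t k) + \<rho> (\<Sum>j<n. s j * w k j)"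
      unfolding tS w_def[symmetric] using tf sf by (intro rho_diff)
    also have "\<rho> (\<Sum>j<n. s j * w k j) \<le> (\<Sum>j<n. \<rho> (s j * w k j))"
      using fs wf by (intro rho_sum) auto
    also have "\<dots> \<le> (\<Sum>j<n. 2 / 2 ^ k)"
    proof (rule sum_mono)
      fix j assume "j \<in> {..<n}"
      then show "\<rho> (s j * w k j) \<le> 2 / 2 ^ k"
        using rho_mult[OF fs(4) wf, of j j k] rs(1)[of j] w_bound[of k] by fastforce
    qed
    finally have "\<rho> (t (Suc k)) \<le> \<rho> (t k) + 2 * (real n / 2 ^ k)"
      by (simp add: mult.commute)
    moreover have "4 * real n * (1 - 1 / 2 ^ k) = 4 * real n - 4 * (real n / 2 ^ k)"
      "4 * real n * (1 - 1 / 2 ^ Suc k) = 4 * real n - 2 * (real n / 2 ^ k)"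
      by (simp_all add: right_diff_distrib)
    ultimately show ?case
      using Suc by linarith
  qed
  have "\<rho> (t k) \<le> M" for k
  proof -
    have "4 * real n * (1 - 1 / 2 ^ k) \<le> 4 * real n * 1"
      by (intro mult_left_mono) auto
    then show ?thesis
      using t_bound[of k] by (simp add: M_def)
  qed
  note tM = this
  \<comment> \<open>Everything subtracted in \<open>t\<close> starts with some \<open>s j\<close>,
    \<open>j < n\<close>, and these are killed by the adjoint of the extra isometry
    \<open>s n\<close>. So the norm of \<open>t k\<close> cannot drop below
    \<open>1\<close>.\<close>
  have st: "sp_adj (s n) * t k \<approx> sp_adj (s n)" for k
  proof (induction k)
    case 0
    show ?case
      using e(2)[of "sp_adj (s n)"] s(1)[of n] by (simp add: t0)
  next
    case (Suc k)
    have "sp_adj (s n) * t (Suc k) = sp_adj (s n) * t k - (\<Sum>j<n. (sp_adj (s n) * s j) * w k j)"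
      by (simp add: tS w_def algebra_simps sum_distrib_left)
    also have "\<dots> \<approx> sp_adj (s n) - (\<Sum>j<n. (if n = j then e else 0) * w k j)"
      using wf by (intro eqv_diff Suc eqv_sum eqv_mult_right s(2)) auto
    also have "(\<Sum>j<n. (if n = j then e else 0) * w k j) = 0"
      by (intro sum.neutral) auto
    finally show ?case
      by simp
  qed
  have lower: "1 \<le> \<rho> (t k)" for k
    using eqv_rho[OF st[of k]] rho_mult[of "sp_adj (s n)" "t k"] s(1)[of n] tf[of k] rs(2)[of n] by simp
  \<comment> \<open>Approximate left invertibility expresses \<open>t k\<close> by the
    \<open>w k i\<close>, which tend to zero, up to an error of at most \<open>1/2\<close>; for
    large \<open>k\<close> this contradicts \<open>lower\<close>.\<close>
  have upper: "\<rho> (t k) \<le> 1 / 2 + (\<Sum>i<n. C i) * (2 / 2 ^ k)" for k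
  proof -
    let ?d = "(\<Sum>i<n. p i * q i) - e"
    have d: "?d \<in> free_star G"
      using fs unit_closed by (intro free_star_diff free_star_sum free_star_mult) auto
    have "t k \<approx> e * t k"
      using eqv_sym[OF e(1)[OF tf]] .
    also have "e * t k = (\<Sum>i<n. p i * w k i) - ?d * t k"
      by (simp add: w_def left_diff_distrib sum_distrib_right mult.assoc)
    finally have "\<rho> (t k) = \<rho> ((\<Sum>i<n. p i * w k i) - ?d * t k)"
      by (rule eqv_rho)
    also have "\<dots> \<le> \<rho> (\<Sum>i<n. p i * w k i) + \<rho> (?d * t k)"
      using fs wf d tf by (intro rho_diff) auto
    also have "\<rho> (?d * t k) \<le> \<rho> ?d * \<rho> (t k)"
      using d tf by (rule rho_mult)
    also have "\<dots> \<le> 1 / (2 * M) * M"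
      using m(2) tM rho_nonneg[OF tf] M by (intro mult_mono) (auto simp: p_def q_def)
    also have "\<dots> = 1 / 2"
      using M by simp
    also have "\<rho> (\<Sum>i<n. p i * w k i) \<le> (\<Sum>i<n. \<rho> (p i * w k i))"
      using fs wf by (intro rho_sum) auto
    also have "\<dots> \<le> (\<Sum>i<n. C i * (2 / 2 ^ k))"
    proof (rule sum_mono)
      fix i assume "i \<in> {..<n}"
      then have i: "i < n"
        by simp
      have "\<rho> (p i * w k i) \<le> \<rho> (p i) * \<rho> (w k i)"
        using fs wf i by (intro rho_mult)
      also have "\<dots> \<le> C i * (2 / 2 ^ k)"
        using C[OF i] w_bound[of k] i rho_nonneg[OF wf[OF i]]
        by (intro mult_mono) (auto simp: p_def less_imp_le)
      finally show "\<rho> (p i * w k i) \<le> C i * (2 / 2 ^ k)" .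
    qed
    finally show ?thesis
      unfolding sum_distrib_right by linarith
  qed
  have "(\<lambda>k. 1 / 2 + (\<Sum>i<n. C i) * (2 * inverse 2 ^ k)) \<longlonglongrightarrow> 1 / 2 + (\<Sum>i<n. C i) * (2 * 0)"
    by (intro tendsto_intros LIMSEQ_power_zero) auto
  then have "1 \<le> 1 / 2 + (\<Sum>i<n. C i) * (2 * 0)"
  proof (rule LIMSEQ_le_const)
    show "\<exists>N. \<forall>k\<ge>N. 1 \<le> 1 / 2 + (\<Sum>i<n. C i) * (2 * inverse 2 ^ k)"
      using order_trans[OF lower upper] by (auto simp: field_simps)
  qed
  then show False
    by simp
qed

end

section \<open>Cuntz--Krieger families\<close>

text \<open>The seminorm is left arbitrary, so that the facts below apply to every member of the
  family whose supremum is the universal norm, and then to the supremum itself.\<close>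

locale ck_family = k_graph \<Lambda> + cstar_semi "mor \<Lambda>" \<rho>
  for \<Lambda> :: "('l, 'k::finite) kgraph" and \<rho> +
  assumes finite_graph: "finite_kgraph \<Lambda>"
    and rho_relation: "h \<in> ck_relations \<Lambda> \<Longrightarrow> \<rho> h = 0"
begin

notation eqv (infix \<open>\<approx>\<close> 50)

abbreviation S :: "'l \<Rightarrow> 'l star_poly" where "S \<equiv> gen"
abbreviation T :: "'l \<Rightarrow> 'l star_poly" where "T \<xi> \<equiv> sp_adj (gen \<xi>)"

lemma finite_vertices: "finite (vertices \<Lambda>)"
  using finite_graph by (simp add: finite_kgraph_def)

lemma relation_eqv:
  "a - b \<in> ck_relations \<Lambda> \<Longrightarrow> a \<in> free_star (mor \<Lambda>) \<Longrightarrow> b \<in> free_star (mor \<Lambda>) \<Longrightarrow> a \<approx> b"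
  by (simp add: eqv_def rho_relation)

lemma vertex_mor: "v \<in> vertices \<Lambda> \<Longrightarrow> v \<in> mor \<Lambda>"
  by (rule vertexD)

lemma finite_with_range_upto: "finite (with_range \<Lambda> v (upto_degree \<Lambda> n))"
  using finite_upto_degree[OF finite_graph] by (simp add: with_range_def)

lemma with_range_uptoD:
  assumes "\<xi> \<in> with_range \<Lambda> v (upto_degree \<Lambda> n)"
  shows "\<xi> \<in> mor \<Lambda>" "rg \<Lambda> \<xi> = v" "\<xi> \<in> upto_degree \<Lambda> n"
  using assms by (auto simp: with_range_def upto_degree_def)

lemma S_vertex_idem: "v \<in> vertices \<Lambda> \<Longrightarrow> S v * S v \<approx> S v"
  by (rule relation_eqv) (auto simp: ck_relations_def vertex_mor)

lemma T_vertex: "v \<in> vertices \<Lambda> \<Longrightarrow> T v \<approx> S v"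
  by (rule relation_eqv) (auto simp: ck_relations_def vertex_mor)

lemma S_vertices_orthogonal:
  assumes "v \<in> vertices \<Lambda>" "w \<in> vertices \<Lambda>" "v \<noteq> w"
  shows "S v * S w \<approx> 0"
proof -
  have "S v * S w \<in> ck_relations \<Lambda>"
    using assms unfolding ck_relations_def by blast
  then show ?thesis
    using assms by (simp add: eqv_zero_iff rho_relation vertex_mor)
qed

lemma S_cmp:
  assumes "\<mu> \<in> mor \<Lambda>" "\<nu> \<in> mor \<Lambda>" "sc \<Lambda> \<mu> = rg \<Lambda> \<nu>"
  shows "S \<mu> * S \<nu> \<approx> S (cmp \<Lambda> \<mu> \<nu>)"
proof (rule relation_eqv)
  show "S \<mu> * S \<nu> - S (cmp \<Lambda> \<mu> \<nu>) \<in> ck_relations \<Lambda>"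
    using assms unfolding ck_relations_def by blast
qed (use assms in \<open>auto simp: cmp_closed\<close>)

lemma T_S: "\<xi> \<in> mor \<Lambda> \<Longrightarrow> T \<xi> * S \<xi> \<approx> S (sc \<Lambda> \<xi>)"
proof (rule relation_eqv)
  assume "\<xi> \<in> mor \<Lambda>"
  then show "T \<xi> * S \<xi> - S (sc \<Lambda> \<xi>) \<in> ck_relations \<Lambda>"
    unfolding ck_relations_def by blast
qed (auto simp: sc_closed)

lemma S_vertex_sum:
  assumes "v \<in> vertices \<Lambda>"
  shows "S v \<approx> (\<Sum>\<xi>\<in>with_range \<Lambda> v (upto_degree \<Lambda> n). S \<xi> * T \<xi>)"
proof (rule relation_eqv)
  show "S v - (\<Sum>\<xi>\<in>with_range \<Lambda> v (upto_degree \<Lambda> n). S \<xi> * T \<xi>) \<in> ck_relations \<Lambda>"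
    using assms unfolding ck_relations_def by blast
  show "(\<Sum>\<xi>\<in>with_range \<Lambda> v (upto_degree \<Lambda> n). S \<xi> * T \<xi>) \<in> free_star (mor \<Lambda>)"
    using with_range_uptoD(1) by (intro free_star_sum free_star_mult free_star_adj free_star_gen)
qed (use assms in \<open>auto simp: vertex_mor\<close>)

lemma S_rg: "\<xi> \<in> mor \<Lambda> \<Longrightarrow> S (rg \<Lambda> \<xi>) * S \<xi> \<approx> S \<xi>"
  using S_cmp[of "rg \<Lambda> \<xi>" \<xi>] by (simp add: rg_closed sc_rg rg_cmp_id)

lemma S_sc: "\<xi> \<in> mor \<Lambda> \<Longrightarrow> S \<xi> * S (sc \<Lambda> \<xi>) \<approx> S \<xi>"
  using S_cmp[of \<xi> "sc \<Lambda> \<xi>"] by (simp add: sc_closed rg_sc cmp_sc_id)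

lemma T_rg:
  assumes "\<xi> \<in> mor \<Lambda>"
  shows "T \<xi> * S (rg \<Lambda> \<xi>) \<approx> T \<xi>"
proof -
  have "T \<xi> * S (rg \<Lambda> \<xi>) \<approx> T \<xi> * T (rg \<Lambda> \<xi>)"
    using assms by (intro eqv_mult_left eqv_sym[OF T_vertex] rg_vertex) auto
  also have "\<dots> = sp_adj (S (rg \<Lambda> \<xi>) * S \<xi>)"
    by (simp add: sp_adj_mult)
  also have "\<dots> \<approx> T \<xi>"
    using assms by (intro eqv_adj S_rg)
  finally show ?thesis .
qed

lemma T_sc:
  assumes "\<xi> \<in> mor \<Lambda>"
  shows "S (sc \<Lambda> \<xi>) * T \<xi> \<approx> T \<xi>"
proof -
  have "S (sc \<Lambda> \<xi>) * T \<xi> \<approx> T (sc \<Lambda> \<xi>) * T \<xi>"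
    using assms by (intro eqv_mult_right eqv_sym[OF T_vertex] sc_vertex) auto
  also have "\<dots> = sp_adj (S \<xi> * S (sc \<Lambda> \<xi>))"
    by (simp add: sp_adj_mult)
  also have "\<dots> \<approx> T \<xi>"
    using assms by (intro eqv_adj S_sc)
  finally show ?thesis .
qed

lemma S_T_S:
  assumes "\<xi> \<in> mor \<Lambda>"
  shows "S \<xi> * T \<xi> * S \<xi> \<approx> S \<xi>"
proof -
  have "S \<xi> * T \<xi> * S \<xi> \<approx> S \<xi> * S (sc \<Lambda> \<xi>)"
    unfolding mult.assoc using assms by (intro eqv_mult_left T_S) auto
  also have "\<dots> \<approx> S \<xi>"
    using assms by (rule S_sc)
  finally show ?thesis .
qed

text \<open>\<open>T \<xi> * S \<xi>\<close> is a vertex projection up to \<open>\<approx>\<close>.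
  The bound is the same for all seminorms that kill the relations, which is what makes the universal
  norm finite.\<close>

lemma rho_S_le_1:
  assumes "\<xi> \<in> mor \<Lambda>"
  shows "\<rho> (S \<xi>) \<le> 1" "\<rho> (T \<xi>) \<le> 1"
proof -
  have "(\<rho> (S \<xi>))\<^sup>2 = \<rho> (S (sc \<Lambda> \<xi>))"
    using rho_cstar[of "S \<xi>"] eqv_rho[OF T_S[OF assms]] assms by simp
  also have "\<dots> \<le> 1"
    using assms by (intro rho_projection_le_1 S_vertex_idem T_vertex sc_vertex)
  finally show "\<rho> (S \<xi>) \<le> 1"
    by (metis one_power2 power2_le_imp_le zero_le_one)
  then show "\<rho> (T \<xi>) \<le> 1"
    using rho_adj[of "S \<xi>"] assms by simp
qed

text \<open>For a common range \<open>v\<close> the elements \<open>S \<xi> * T \<xi>\<close> sum to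
  the projection \<open>S v\<close>, and \<open>partial_isometries_orthogonal\<close> applies; for
  different ranges the two vertex projections annihilate each other.\<close>

lemma T_S_orthogonal:
  assumes "\<xi> \<in> upto_degree \<Lambda> n" "\<zeta> \<in> upto_degree \<Lambda> n" "\<xi> \<noteq> \<zeta>"
  shows "T \<xi> * S \<zeta> \<approx> 0"
proof (cases "rg \<Lambda> \<xi> = rg \<Lambda> \<zeta>")
  case True
  have \<xi>: "\<xi> \<in> mor \<Lambda>"
    using assms by (simp add: upto_degree_def)
  let ?J = "with_range \<Lambda> (rg \<Lambda> \<xi>) (upto_degree \<Lambda> n)"
  have v: "rg \<Lambda> \<xi> \<in> vertices \<Lambda>"
    using \<xi> by (rule rg_vertex)
  show ?thesis
  proof (rule partial_isometries_orthogonal[OF finite_with_range_upto _ S_vertex_idem[OF v]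
        T_vertex[OF v] S_vertex_sum[OF v, of n]])
    fix j assume "j \<in> ?J"
    note j = with_range_uptoD[OF this]
    show "S j \<in> free_star (mor \<Lambda>)" "S (rg \<Lambda> \<xi>) * S j \<approx> S j" "S j * T j * S j \<approx> S j"
      using j S_rg[OF j(1)] S_T_S[OF j(1)] by auto
  qed (use assms True in \<open>auto simp: with_range_def\<close>)
next
  case False
  have m: "\<xi> \<in> mor \<Lambda>" "\<zeta> \<in> mor \<Lambda>"
    using assms by (auto simp: upto_degree_def)
  have "T \<xi> * S \<zeta> \<approx> (T \<xi> * S (rg \<Lambda> \<xi>)) * (S (rg \<Lambda> \<zeta>) * S \<zeta>)"
    using m by (intro eqv_mult eqv_sym[OF T_rg] eqv_sym[OF S_rg])
  also have "\<dots> = T \<xi> * ((S (rg \<Lambda> \<xi>) * S (rg \<Lambda> \<zeta>)) * S \<zeta>)"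
    by (simp add: mult.assoc)
  also have "\<dots> \<approx> 0"
    using m False
    by (intro eqv_mult_zero eqv_zero_mult S_vertices_orthogonal rg_vertex) auto
  finally show ?thesis .
qed

lemma S_S_disjoint:
  assumes "\<xi> \<in> mor \<Lambda>" "\<zeta> \<in> mor \<Lambda>" "sc \<Lambda> \<xi> \<noteq> rg \<Lambda> \<zeta>"
  shows "S \<xi> * S \<zeta> \<approx> 0"
proof -
  have "S \<xi> * S \<zeta> \<approx> (S \<xi> * S (sc \<Lambda> \<xi>)) * (S (rg \<Lambda> \<zeta>) * S \<zeta>)"
    using assms by (intro eqv_mult eqv_sym[OF S_sc] eqv_sym[OF S_rg])
  also have "\<dots> = S \<xi> * ((S (sc \<Lambda> \<xi>) * S (rg \<Lambda> \<zeta>)) * S \<zeta>)"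
    by (simp add: mult.assoc)
  also have "\<dots> \<approx> 0"
    using assms
    by (intro eqv_mult_zero eqv_zero_mult S_vertices_orthogonal rg_vertex sc_vertex) auto
  finally show ?thesis .
qed

definition unit :: "'l star_poly" where
  "unit = (\<Sum>v\<in>vertices \<Lambda>. S v)"

lemma unit_free_star: "unit \<in> free_star (mor \<Lambda>)"
  unfolding unit_def by (intro free_star_sum free_star_gen vertex_mor)

lemma unit_adj: "sp_adj unit \<approx> unit"
  unfolding unit_def sp_adj_sum by (intro eqv_sum T_vertex)

lemma unit_mult_S:
  assumes "\<xi> \<in> mor \<Lambda>"
  shows "unit * S \<xi> \<approx> S \<xi>"
proof -
  have "unit * S \<xi> = (\<Sum>v\<in>vertices \<Lambda>. S v * S \<xi>)"
    by (simp add: unit_def sum_distrib_right)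
  also have "\<dots> \<approx> (\<Sum>v\<in>vertices \<Lambda>. if v = rg \<Lambda> \<xi> then S \<xi> else 0)"
    using assms by (intro eqv_sum) (auto simp: vertexD intro: S_rg S_S_disjoint)
  also have "\<dots> = S \<xi>"
    using assms finite_vertices by (simp add: rg_vertex)
  finally show ?thesis .
qed

lemma unit_mult_T:
  assumes "\<xi> \<in> mor \<Lambda>"
  shows "unit * T \<xi> \<approx> T \<xi>"
proof -
  have "unit * T \<xi> \<approx> unit * (S (sc \<Lambda> \<xi>) * T \<xi>)"
    using assms by (intro eqv_mult_left eqv_sym[OF T_sc] unit_free_star)
  also have "\<dots> = (unit * S (sc \<Lambda> \<xi>)) * T \<xi>"
    by (simp add: mult.assoc)
  also have "\<dots> \<approx> S (sc \<Lambda> \<xi>) * T \<xi>"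
    using assms by (intro eqv_mult_right unit_mult_S sc_closed) auto
  also have "\<dots> \<approx> T \<xi>"
    using assms by (rule T_sc)
  finally show ?thesis .
qed

lemma unit_mult: "f \<in> free_star (mor \<Lambda>) \<Longrightarrow> unit * f \<approx> f"
proof (induction f rule: free_star_induct)
  case (mult f g)
  then show ?case
    using eqv_mult_right[of "unit * f" f g] by (simp add: mult.assoc)
qed (auto simp: distrib_left sp_scale_mult_right intro: eqv_add eqv_scale unit_mult_S unit_mult_T)

lemma mult_unit:
  assumes "f \<in> free_star (mor \<Lambda>)"
  shows "f * unit \<approx> f"
proof -
  have "f * unit \<approx> f * sp_adj unit"
    using assms by (intro eqv_mult_left eqv_sym[OF unit_adj])
  also have "\<dots> = sp_adj (unit * sp_adj f)"
    by (simp add: sp_adj_mult)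
  also have "\<dots> \<approx> sp_adj (sp_adj f)"
    using assms by (intro eqv_adj unit_mult) auto
  finally show ?thesis
    by simp
qed

section \<open>Graphs without cycles\<close>

lemma acyclic_almost_invertible:
  assumes acyclic: "\<not> (\<exists>\<xi>. is_cycle \<Lambda> \<xi>)" and f: "f \<in> free_star (mor \<Lambda>)" and "0 < \<epsilon>"
  shows "\<exists>z y. cmod z < \<epsilon> \<and> y \<in> free_star (mor \<Lambda>) \<and> y * (f - sp_scale z unit) \<approx> unit"
proof -
  \<comment> \<open>\<open>N\<close> strictly exceeds every degree in every colour, so
    \<open>upto_degree \<Lambda> N\<close> consists of all paths that end at a vertex without edges.
    A path reaching \<open>N\<close> in some colour would escape the condition for that
    colour.\<close>
  define N :: "'k \<Rightarrow> nat" where "N = (\<lambda>_. Suc (card (vertices \<Lambda>)))"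
  define M where "M = upto_degree \<Lambda> N"
  have lt: "dg \<Lambda> \<xi> i < N i" if "\<xi> \<in> mor \<Lambda>" for \<xi> i
    using acyclic_total_le[OF finite_vertices acyclic that] le_total[of "dg \<Lambda> \<xi>" i] by (simp add: N_def)
  have M_iff: "\<xi> \<in> M \<longleftrightarrow> \<xi> \<in> mor \<Lambda> \<and> (\<forall>i. \<not> has_edge \<Lambda> i (sc \<Lambda> \<xi>))" for \<xi>
    using lt[of \<xi>] by (auto simp: M_def upto_degree_iff le_fun_def less_imp_le)
  have Mm: "\<xi> \<in> mor \<Lambda>" if "\<xi> \<in> M" for \<xi>
    using that M_iff by blast
  have fin: "finite (M \<times> M)"
    using finite_upto_degree[OF finite_graph] by (simp add: M_def)
  define U where "U = (\<lambda>(\<beta>, \<gamma>). S \<beta> * T \<gamma>)"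
  have Uf: "U b \<in> free_star (mor \<Lambda>)" if "b \<in> M \<times> M" for b
    using that Mm by (auto simp: U_def)
  have basis: "spanned (M \<times> M) U (S \<beta> * T \<gamma>)" if "\<beta> \<in> M" "\<gamma> \<in> M" for \<beta> \<gamma>
    using spanned_basis[OF fin, of "(\<beta>, \<gamma>)" U] Uf[of "(\<beta>, \<gamma>)"] that by (simp add: U_def)
  \<comment> \<open>The spanning elements multiply like matrix units: the middle factor
    \<open>T \<gamma> * S \<mu>\<close> is zero unless \<open>\<gamma> = \<mu>\<close>, and then it
    is a vertex projection, absorbed by \<open>S \<beta>\<close> or annihilating it.\<close>
  have mult_basis: "spanned (M \<times> M) U (U b * U b')" if bb: "b \<in> M \<times> M" "b' \<in> M \<times> M" for b b'
  proof -
    obtain \<beta> \<gamma> \<mu> \<nu> where b: "b = (\<beta>, \<gamma>)" "b' = (\<mu>, \<nu>)" "\<beta> \<in> M" "\<gamma> \<in> M" "\<mu> \<in> M" "\<nu> \<in> M"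
      using bb by auto
    have eq: "U b * U b' = S \<beta> * ((T \<gamma> * S \<mu>) * T \<nu>)"
      by (simp add: b U_def mult.assoc)
    show ?thesis
    proof (cases "\<gamma> = \<mu>")
      case False
      then have "U b * U b' \<approx> 0"
        unfolding eq using b Mm
        by (intro eqv_mult_zero eqv_zero_mult T_S_orthogonal[of _ N]) (auto simp: M_def)
      then show ?thesis
        using spanned_eqv spanned_zero by blast
    next
      case True
      have "U b * U b' \<approx> S \<beta> * (S (sc \<Lambda> \<gamma>) * T \<nu>)"
        unfolding eq using b Mm True T_S[OF Mm[OF b(4)]] by (intro eqv_mult_left eqv_mult_right) auto
      moreover have "spanned (M \<times> M) U (S \<beta> * (S (sc \<Lambda> \<gamma>) * T \<nu>))"
      proof (cases "sc \<Lambda> \<beta> = sc \<Lambda> \<gamma>")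
        case True
        then have "(S \<beta> * S (sc \<Lambda> \<gamma>)) * T \<nu> \<approx> S \<beta> * T \<nu>"
          using S_sc[OF Mm[OF b(3)]] Mm[OF b(6)] by (intro eqv_mult_right) auto
        then show ?thesis
          unfolding mult.assoc using basis b spanned_eqv by blast
      next
        case False
        then have "(S \<beta> * S (sc \<Lambda> \<gamma>)) * T \<nu> \<approx> 0"
          using b Mm by (intro eqv_zero_mult S_S_disjoint) (auto simp: sc_closed rg_sc)
        then show ?thesis
          unfolding mult.assoc using spanned_eqv spanned_zero by blast
      qed
      ultimately show ?thesis
        by (rule spanned_eqv)
    qed
  qed
  have ext: "cmp \<Lambda> \<alpha> \<gamma> \<in> M" if "\<alpha> \<in> mor \<Lambda>" "\<gamma> \<in> M" "sc \<Lambda> \<alpha> = rg \<Lambda> \<gamma>" for \<alpha> \<gamma>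
    using that by (simp add: M_iff cmp_closed sc_cmp)
  \<comment> \<open>The relation at the source of \<open>\<alpha>\<close> is multiplied by
    \<open>S \<alpha>\<close>. Each composite of \<open>\<alpha>\<close> with
    \<open>\<gamma>\<close> ends where \<open>\<gamma>\<close> does, hence lies in \<open>M\<close>
    again.\<close>
  have S_expand: "S \<alpha> \<approx> (\<Sum>\<gamma>\<in>with_range \<Lambda> (sc \<Lambda> \<alpha>) M. S (cmp \<Lambda> \<alpha> \<gamma>) * T \<gamma>)" if \<alpha>: "\<alpha> \<in> mor \<Lambda>" for \<alpha>
  proof -
    have "S \<alpha> \<approx> S \<alpha> * S (sc \<Lambda> \<alpha>)"
      using \<alpha> by (intro eqv_sym[OF S_sc])
    also have "\<dots> \<approx> S \<alpha> * (\<Sum>\<gamma>\<in>with_range \<Lambda> (sc \<Lambda> \<alpha>) M. S \<gamma> * T \<gamma>)"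
      unfolding M_def using \<alpha> by (intro eqv_mult_left S_vertex_sum sc_vertex) auto
    also have "\<dots> = (\<Sum>\<gamma>\<in>with_range \<Lambda> (sc \<Lambda> \<alpha>) M. (S \<alpha> * S \<gamma>) * T \<gamma>)"
      by (simp add: sum_distrib_left mult.assoc)
    also have "\<dots> \<approx> (\<Sum>\<gamma>\<in>with_range \<Lambda> (sc \<Lambda> \<alpha>) M. S (cmp \<Lambda> \<alpha> \<gamma>) * T \<gamma>)"
      using \<alpha> Mm by (intro eqv_sum eqv_mult_right S_cmp) (auto simp: with_range_def)
    finally show ?thesis .
  qed
  have S_span: "spanned (M \<times> M) U (S \<alpha>)" and T_span: "spanned (M \<times> M) U (T \<alpha>)" if \<alpha>: "\<alpha> \<in> mor \<Lambda>" for \<alpha>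
  proof -
    show "spanned (M \<times> M) U (S \<alpha>)"
      using \<alpha> ext by (intro spanned_eqv[OF S_expand] spanned_sum basis) (auto simp: with_range_def)
    have "T \<alpha> \<approx> (\<Sum>\<gamma>\<in>with_range \<Lambda> (sc \<Lambda> \<alpha>) M. S \<gamma> * T (cmp \<Lambda> \<alpha> \<gamma>))"
      using eqv_adj[OF S_expand[OF \<alpha>]] by (simp add: sp_adj_sum sp_adj_mult)
    then show "spanned (M \<times> M) U (T \<alpha>)"
      by (rule spanned_eqv) (use \<alpha> ext in \<open>auto simp: with_range_def intro!: spanned_sum basis\<close>)
  qed
  have "spanned (M \<times> M) U f"
    using f
  proof (induction f rule: free_star_induct)
    case (mult f g)
    then show ?case
      using spanned_mult[OF mult_basis] by blast
  qed (auto intro: spanned_zero spanned_add spanned_scale S_span T_span)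
  then obtain n a where na: "\<exists>k\<le>n. a k \<noteq> 0" "(\<Sum>k\<le>n. sp_scale (a k) (f ^ Suc k)) \<approx> 0"
    using spanned_algebraic[OF fin Uf mult_basis f] by blast
  show ?thesis
    by (rule algebraic_almost_invertible[OF unit_free_star unit_mult mult_unit f na \<open>0 < \<epsilon>\<close>])
qed

section \<open>Graphs with a cycle\<close>

text \<open>As in the Cuntz algebras, \<open>h k = g'^k g\<close> have the common initial projection
  \<open>S u\<close> and orthogonal ranges below \<open>S u\<close>. A finite set \<open>M\<close>
  of paths splits the unit into the projections \<open>S \<mu> * T \<mu>\<close>, and cofinality
  supplies paths \<open>b \<mu>\<close> with range \<open>u\<close> and the source of
  \<open>\<mu>\<close>. Then \<open>s i\<close> moves each piece below \<open>S u\<close> by means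
  of \<open>b \<mu>\<close> and on into a range of \<open>h\<close> reserved for it.\<close>

lemma cycle_orthogonal_isometries:
  assumes lc: "locally_convex \<Lambda>" and cof: "cofinal_kgraph \<Lambda>" and ap: "no_local_periodicity \<Lambda>"
    and cyc: "is_cycle \<Lambda> \<xi>"
  shows "\<exists>s :: nat \<Rightarrow> 'l star_poly. (\<forall>i. s i \<in> free_star (mor \<Lambda>)) \<and>
    (\<forall>i j. sp_adj (s i) * s j \<approx> (if i = j then unit else 0))"
proof -
  obtain u \<alpha> \<beta> \<alpha>' \<beta>' where u: "u \<in> vertices \<Lambda>"
    and p: "\<alpha> \<in> mor \<Lambda>" "\<beta> \<in> mor \<Lambda>" "rg \<Lambda> \<alpha> = u" "rg \<Lambda> \<beta> = u" "dg \<Lambda> \<alpha> = dg \<Lambda> \<beta>" "\<alpha> \<noteq> \<beta>"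
    and p': "\<alpha>' \<in> mor \<Lambda>" "\<beta>' \<in> mor \<Lambda>" "rg \<Lambda> \<alpha>' = sc \<Lambda> \<alpha>" "rg \<Lambda> \<beta>' = sc \<Lambda> \<beta>" "sc \<Lambda> \<alpha>' = u" "sc \<Lambda> \<beta>' = u"
    using distinct_return_paths[OF finite_vertices lc cof ap cyc] by metis
  define g where "g = S (cmp \<Lambda> \<alpha> \<alpha>')"
  define g' where "g' = S (cmp \<Lambda> \<beta> \<beta>')"
  have loop: "cmp \<Lambda> \<alpha> \<alpha>' \<in> mor \<Lambda>" "rg \<Lambda> (cmp \<Lambda> \<alpha> \<alpha>') = u" "sc \<Lambda> (cmp \<Lambda> \<alpha> \<alpha>') = u"
    and loop': "cmp \<Lambda> \<beta> \<beta>' \<in> mor \<Lambda>" "rg \<Lambda> (cmp \<Lambda> \<beta> \<beta>') = u" "sc \<Lambda> (cmp \<Lambda> \<beta> \<beta>') = u"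
    using p p' by (simp_all add: cmp_closed rg_cmp sc_cmp)
  have gf: "g \<in> free_star (mor \<Lambda>)" "g' \<in> free_star (mor \<Lambda>)" "S u \<in> free_star (mor \<Lambda>)"
    using loop loop' vertex_mor[OF u] by (auto simp: g_def g'_def)
  have gg: "sp_adj g * g \<approx> S u" "sp_adj g' * g' \<approx> S u"
    using T_S[OF loop(1)] T_S[OF loop'(1)] loop loop' by (simp_all add: g_def g'_def)
  have ug: "S u * g \<approx> g" "S u * g' \<approx> g'"
    using S_rg[OF loop(1)] S_rg[OF loop'(1)] loop loop' by (simp_all add: g_def g'_def)
  have orth: "sp_adj g * g' \<approx> 0"
  proof -
    have "sp_adj g * g' \<approx> sp_adj (S \<alpha> * S \<alpha>') * (S \<beta> * S \<beta>')"
      unfolding g_def g'_def using p p' by (intro eqv_mult eqv_adj eqv_sym[OF S_cmp]) auto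
    also have "\<dots> = T \<alpha>' * ((T \<alpha> * S \<beta>) * S \<beta>')"
      by (simp add: sp_adj_mult mult.assoc)
    \<comment> \<open>Both paths have exactly the degree \<open>dg \<Lambda> \<beta>\<close>, so
      they belong to one \<open>upto_degree\<close> set.\<close>
    also have "\<dots> \<approx> 0"
      using p p' of_degree_upto_degree[of "dg \<Lambda> \<beta>"]
      by (intro eqv_mult_zero eqv_zero_mult T_S_orthogonal[of _ "dg \<Lambda> \<beta>"]) (auto simp: of_degree_def)
    finally show ?thesis .
  qed
  define h where "h k = ((\<lambda>f. g' * f) ^^ k) g" for k :: nat
  have h0: "h 0 = g" and hS: "h (Suc k) = g' * h k" for k
    by (simp_all add: h_def)
  have hf: "h k \<in> free_star (mor \<Lambda>)" for k
    by (induction k) (use gf in \<open>auto simp: h0 hS\<close>)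
  have uh: "S u * h k \<approx> h k" for k
  proof (cases k)
    case (Suc l)
    then show ?thesis
      using eqv_mult_right[OF ug(2) hf[of l]] by (simp add: hS mult.assoc)
  qed (use ug h0 in simp)
  have hh: "sp_adj (h i) * h j \<approx> (if i = j then S u else 0)" for i j
  proof (induction i arbitrary: j)
    case 0
    show ?case
    proof (cases j)
      case (Suc l)
      then show ?thesis
        using eqv_zero_mult[OF orth hf[of l]] by (simp add: h0 hS mult.assoc)
    qed (use gg h0 in simp)
  next
    case (Suc i)
    note IH = Suc.IH
    show ?case
    proof (cases j)
      case 0
      have "sp_adj (sp_adj (h 0) * h (Suc i)) \<approx> sp_adj 0"
        using eqv_zero_mult[OF orth hf[of i]] by (intro eqv_adj) (simp add: h0 hS mult.assoc)
      then show ?thesis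
        using 0 by (simp add: sp_adj_mult)
    next
      case (Suc l)
      have "sp_adj (h (Suc i)) * h j = sp_adj (h i) * ((sp_adj g' * g') * h l)"
        by (simp add: Suc hS sp_adj_mult mult.assoc)
      also have "\<dots> \<approx> sp_adj (h i) * (S u * h l)"
        using hf by (intro eqv_mult_left eqv_mult_right gg) auto
      also have "\<dots> \<approx> sp_adj (h i) * h l"
        using hf by (intro eqv_mult_left uh) auto
      also have "\<dots> \<approx> (if i = l then S u else 0)"
        by (rule IH)
      finally show ?thesis
        by (simp add: Suc)
    qed
  qed
  have "\<forall>v\<in>vertices \<Lambda>. \<exists>n. sc \<Lambda> ` with_range \<Lambda> v (upto_degree \<Lambda> n) \<subseteq> sc \<Lambda> ` with_range \<Lambda> u (mor \<Lambda>)"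
    using cof u by (simp add: cofinal_kgraph_def)
  then obtain n where n: "\<And>v. v \<in> vertices \<Lambda> \<Longrightarrow>
      sc \<Lambda> ` with_range \<Lambda> v (upto_degree \<Lambda> (n v)) \<subseteq> sc \<Lambda> ` with_range \<Lambda> u (mor \<Lambda>)"
    by metis
  define P where "P v = with_range \<Lambda> v (upto_degree \<Lambda> (n v))" for v
  define M where "M = (\<Union>v\<in>vertices \<Lambda>. P v)"
  have Pfin: "finite (P v)" for v
    by (simp add: P_def finite_with_range_upto)
  have finM: "finite M"
    using Pfin finite_vertices by (simp add: M_def)
  have Mm: "\<mu> \<in> mor \<Lambda>" if "\<mu> \<in> M" for \<mu>
    using that with_range_uptoD(1) by (auto simp: M_def P_def)
  have "\<exists>\<beta>. \<beta> \<in> mor \<Lambda> \<and> rg \<Lambda> \<beta> = u \<and> sc \<Lambda> \<beta> = sc \<Lambda> \<mu>" if "\<mu> \<in> M" for \<mu>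
  proof -
    have "sc \<Lambda> \<mu> \<in> sc \<Lambda> ` with_range \<Lambda> u (mor \<Lambda>)"
      using that n by (fastforce simp: M_def P_def)
    then show ?thesis
      by (auto simp: with_range_def)
  qed
  then obtain b where b: "\<And>\<mu>. \<mu> \<in> M \<Longrightarrow> b \<mu> \<in> mor \<Lambda>" "\<And>\<mu>. \<mu> \<in> M \<Longrightarrow> rg \<Lambda> (b \<mu>) = u"
      "\<And>\<mu>. \<mu> \<in> M \<Longrightarrow> sc \<Lambda> (b \<mu>) = sc \<Lambda> \<mu>"
    by metis
  have sum_unit: "(\<Sum>\<mu>\<in>M. S \<mu> * T \<mu>) \<approx> unit"
  proof -
    have "(\<Sum>\<mu>\<in>M. S \<mu> * T \<mu>) = (\<Sum>v\<in>vertices \<Lambda>. \<Sum>\<mu>\<in>P v. S \<mu> * T \<mu>)"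
      unfolding M_def using finite_vertices Pfin
      by (intro sum.UNION_disjoint) (auto simp: P_def with_range_def)
    also have "\<dots> \<approx> unit"
      unfolding unit_def P_def by (intro eqv_sum eqv_sym[OF S_vertex_sum])
    finally show ?thesis .
  qed
  obtain idx :: "'l \<Rightarrow> nat" where idx: "inj_on idx M"
    using finite_imp_inj_to_nat_seg[OF finM] by blast
  \<comment> \<open>Pairs of an index \<open>i\<close> and a path in \<open>M\<close> receive
    distinct numbers, so the single sequence \<open>h\<close> serves all pieces of all
    \<open>s i\<close>.\<close>
  define \<kappa> where "\<kappa> i \<mu> = prod_encode (i, idx \<mu>)" for i \<mu>
  have \<kappa>: "\<kappa> i \<mu> = \<kappa> j \<nu> \<longleftrightarrow> i = j \<and> \<mu> = \<nu>" if "\<mu> \<in> M" "\<nu> \<in> M" for i j \<mu> \<nu>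
    using that idx by (auto simp: \<kappa>_def inj_on_def)
  define s where "s i = (\<Sum>\<mu>\<in>M. h (\<kappa> i \<mu>) * (S (b \<mu>) * T \<mu>))" for i
  have cross: "sp_adj (h (\<kappa> i \<mu>) * (S (b \<mu>) * T \<mu>)) * (h (\<kappa> j \<nu>) * (S (b \<nu>) * T \<nu>))
      \<approx> (if i = j \<and> \<mu> = \<nu> then S \<mu> * T \<mu> else 0)" if mn: "\<mu> \<in> M" "\<nu> \<in> M" for i j \<mu> \<nu>
  proof -
    have fs: "S \<mu> \<in> free_star (mor \<Lambda>)" "T \<mu> \<in> free_star (mor \<Lambda>)" "T (b \<mu>) \<in> free_star (mor \<Lambda>)"
        "S (b \<nu>) \<in> free_star (mor \<Lambda>)" "T \<nu> \<in> free_star (mor \<Lambda>)"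
      using mn Mm b by auto
    have eq: "sp_adj (h (\<kappa> i \<mu>) * (S (b \<mu>) * T \<mu>)) * (h (\<kappa> j \<nu>) * (S (b \<nu>) * T \<nu>)) =
        S \<mu> * (T (b \<mu>) * ((sp_adj (h (\<kappa> i \<mu>)) * h (\<kappa> j \<nu>)) * (S (b \<nu>) * T \<nu>)))"
      by (simp add: sp_adj_mult mult.assoc)
    show ?thesis
    proof (cases "i = j \<and> \<mu> = \<nu>")
      case False
      then have "sp_adj (h (\<kappa> i \<mu>)) * h (\<kappa> j \<nu>) \<approx> 0"
        using hh[of "\<kappa> i \<mu>" "\<kappa> j \<nu>"] \<kappa>[OF mn] by (simp split: if_splits)
      then have "S \<mu> * (T (b \<mu>) * ((sp_adj (h (\<kappa> i \<mu>)) * h (\<kappa> j \<nu>)) * (S (b \<nu>) * T \<nu>))) \<approx> 0"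
        using fs
        by (intro eqv_mult_zero[OF eqv_mult_zero[OF eqv_zero_mult]] free_star_mult) auto
      then show ?thesis
        unfolding eq if_not_P[OF False] .
    next
      case True
      then have "S \<mu> * (T (b \<mu>) * ((sp_adj (h (\<kappa> i \<mu>)) * h (\<kappa> j \<nu>)) * (S (b \<nu>) * T \<nu>)))
          \<approx> S \<mu> * (T (b \<mu>) * (S u * (S (b \<nu>) * T \<nu>)))"
        using fs hh[of "\<kappa> i \<mu>" "\<kappa> j \<nu>"] by (intro eqv_mult_left eqv_mult_right) auto
      also have "\<dots> = S \<mu> * (T (b \<mu>) * ((S u * S (b \<mu>)) * T \<mu>))"
        using True by (simp add: mult.assoc)
      also have "\<dots> \<approx> S \<mu> * (T (b \<mu>) * (S (b \<mu>) * T \<mu>))"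
        using fs S_rg[OF b(1)] b(2) mn by (intro eqv_mult_left eqv_mult_right) auto
      also have "\<dots> = S \<mu> * ((T (b \<mu>) * S (b \<mu>)) * T \<mu>)"
        by (simp add: mult.assoc)
      also have "\<dots> \<approx> S \<mu> * (S (sc \<Lambda> \<mu>) * T \<mu>)"
        using fs T_S[OF b(1)] b(3) mn by (intro eqv_mult_left eqv_mult_right) auto
      also have "\<dots> \<approx> S \<mu> * T \<mu>"
        using fs mn Mm by (intro eqv_mult_left T_sc)
      finally show ?thesis
        unfolding eq if_P[OF True] .
    qed
  qed
  show ?thesis
  proof (intro exI[of _ s] conjI allI)
    show "s i \<in> free_star (mor \<Lambda>)" for i
      unfolding s_def using hf Mm b by (intro free_star_sum free_star_mult free_star_gen free_star_adj)
    show "sp_adj (s i) * s j \<approx> (if i = j then unit else 0)" for i j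
    proof -
      have "sp_adj (s i) * s j = (\<Sum>\<mu>\<in>M. \<Sum>\<nu>\<in>M.
          sp_adj (h (\<kappa> i \<mu>) * (S (b \<mu>) * T \<mu>)) * (h (\<kappa> j \<nu>) * (S (b \<nu>) * T \<nu>)))"
        by (simp add: s_def sp_adj_sum sum_product)
      also have "\<dots> \<approx> (\<Sum>\<mu>\<in>M. \<Sum>\<nu>\<in>M. if i = j \<and> \<mu> = \<nu> then S \<mu> * T \<mu> else 0)"
        by (intro eqv_sum cross)
      also have "\<dots> = (if i = j then (\<Sum>\<mu>\<in>M. S \<mu> * T \<mu>) else 0)"
        using finM by simp
      finally show ?thesis
        using eqv_trans[OF _ sum_unit] by (cases "i = j") simp_all
    qed
  qed
qed

end

section \<open>Boundary paths as filters of finite paths\<close>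

context k_graph
begin

definition pre :: "'l \<Rightarrow> 'l \<Rightarrow> bool" where
  "pre \<mu> \<kappa> \<longleftrightarrow> \<mu> \<in> mor \<Lambda> \<and> (\<exists>\<tau>\<in>mor \<Lambda>. sc \<Lambda> \<mu> = rg \<Lambda> \<tau> \<and> \<kappa> = cmp \<Lambda> \<mu> \<tau>)"

text \<open>
  A boundary path is represented by the set of its finite initial segments; this makes
  concatenation with a finite path easy to describe.
\<close>

definition bfilter :: "'l \<Rightarrow> 'l set \<Rightarrow> bool" where
  "bfilter v F \<longleftrightarrow> F \<subseteq> mor \<Lambda> \<and> (\<forall>\<xi>\<in>F. rg \<Lambda> \<xi> = v) \<and> (\<forall>\<kappa>\<in>F. \<forall>\<mu>. pre \<mu> \<kappa> \<longrightarrow> \<mu> \<in> F) \<and>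
     (\<forall>\<xi>\<in>F. \<forall>\<zeta>\<in>F. \<exists>\<kappa>\<in>F. pre \<xi> \<kappa> \<and> pre \<zeta> \<kappa>) \<and> (\<forall>n. F \<inter> upto_degree \<Lambda> n \<noteq> {})"

text \<open>Concatenation of \<open>\<xi>\<close> with the boundary path \<open>F\<close>. The
  closure under \<open>pre\<close> adds the initial segments that do not contain
  \<open>\<xi>\<close>.\<close>

definition ext :: "'l \<Rightarrow> 'l set \<Rightarrow> 'l set" where
  "ext \<xi> F = {\<mu>. \<exists>\<eta>\<in>F. pre \<mu> (cmp \<Lambda> \<xi> \<eta>)}"

definition quot :: "'l \<Rightarrow> 'l set \<Rightarrow> 'l set" where
  "quot \<xi> F = {\<eta> \<in> mor \<Lambda>. sc \<Lambda> \<xi> = rg \<Lambda> \<eta> \<and> cmp \<Lambda> \<xi> \<eta> \<in> F}"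

lemma pre_mor: "pre \<mu> \<kappa> \<Longrightarrow> \<mu> \<in> mor \<Lambda>" "pre \<mu> \<kappa> \<Longrightarrow> \<kappa> \<in> mor \<Lambda>" "pre \<mu> \<kappa> \<Longrightarrow> rg \<Lambda> \<mu> = rg \<Lambda> \<kappa>"
  by (auto simp: pre_def cmp_closed rg_cmp)

lemma pre_cmp: "\<mu> \<in> mor \<Lambda> \<Longrightarrow> \<tau> \<in> mor \<Lambda> \<Longrightarrow> sc \<Lambda> \<mu> = rg \<Lambda> \<tau> \<Longrightarrow> pre \<mu> (cmp \<Lambda> \<mu> \<tau>)"
  by (auto simp: pre_def)

lemma pre_refl: "\<mu> \<in> mor \<Lambda> \<Longrightarrow> pre \<mu> \<mu>"
  unfolding pre_def by (metis cmp_sc_id rg_sc sc_closed)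

lemma pre_rg: "\<mu> \<in> mor \<Lambda> \<Longrightarrow> pre (rg \<Lambda> \<mu>) \<mu>"
  unfolding pre_def by (metis rg_closed rg_cmp_id sc_rg)

lemma pre_trans:
  assumes "pre \<mu> \<kappa>" "pre \<kappa> \<xi>"
  shows "pre \<mu> \<xi>"
proof -
  obtain \<tau> where \<tau>: "\<mu> \<in> mor \<Lambda>" "\<tau> \<in> mor \<Lambda>" "sc \<Lambda> \<mu> = rg \<Lambda> \<tau>" "\<kappa> = cmp \<Lambda> \<mu> \<tau>"
    using assms(1) by (auto simp: pre_def)
  obtain \<sigma> where \<sigma>: "\<sigma> \<in> mor \<Lambda>" "sc \<Lambda> \<kappa> = rg \<Lambda> \<sigma>" "\<xi> = cmp \<Lambda> \<kappa> \<sigma>"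
    using assms(2) by (auto simp: pre_def)
  show ?thesis
    using \<tau> \<sigma> pre_cmp[of \<mu> "cmp \<Lambda> \<tau> \<sigma>"] by (simp add: cmp_assoc sc_cmp cmp_closed rg_cmp)
qed

lemma pre_cmp_left:
  assumes "\<xi> \<in> mor \<Lambda>" "sc \<Lambda> \<xi> = rg \<Lambda> \<mu>" "pre \<mu> \<kappa>"
  shows "pre (cmp \<Lambda> \<xi> \<mu>) (cmp \<Lambda> \<xi> \<kappa>)"
proof -
  obtain \<tau> where \<tau>: "\<mu> \<in> mor \<Lambda>" "\<tau> \<in> mor \<Lambda>" "sc \<Lambda> \<mu> = rg \<Lambda> \<tau>" "\<kappa> = cmp \<Lambda> \<mu> \<tau>"
    using assms(3) by (auto simp: pre_def)
  then show ?thesis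
    using assms pre_cmp[of "cmp \<Lambda> \<xi> \<mu>" \<tau>] by (simp add: cmp_assoc sc_cmp cmp_closed)
qed

lemma pre_cmp_cancel:
  assumes "pre (cmp \<Lambda> \<xi> \<mu>) (cmp \<Lambda> \<xi> \<kappa>)" "\<xi> \<in> mor \<Lambda>" "\<mu> \<in> mor \<Lambda>" "\<kappa> \<in> mor \<Lambda>"
    "sc \<Lambda> \<xi> = rg \<Lambda> \<mu>" "sc \<Lambda> \<xi> = rg \<Lambda> \<kappa>"
  shows "pre \<mu> \<kappa>"
proof -
  obtain \<tau> where \<tau>: "\<tau> \<in> mor \<Lambda>" "sc \<Lambda> \<mu> = rg \<Lambda> \<tau>" "cmp \<Lambda> \<xi> \<kappa> = cmp \<Lambda> \<xi> (cmp \<Lambda> \<mu> \<tau>)"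
    using assms by (auto simp: pre_def cmp_assoc sc_cmp)
  then have "\<kappa> = cmp \<Lambda> \<mu> \<tau>"
    using cmp_cancel(2)[of \<xi> \<kappa> \<xi> "cmp \<Lambda> \<mu> \<tau>"] assms by (simp add: cmp_closed rg_cmp)
  then show ?thesis
    using \<tau> assms pre_cmp by simp
qed

lemma
  assumes "bfilter v F"
  shows bfilter_mor: "\<xi> \<in> F \<Longrightarrow> \<xi> \<in> mor \<Lambda>"
    and bfilter_rg: "\<xi> \<in> F \<Longrightarrow> rg \<Lambda> \<xi> = v"
    and bfilter_pre: "\<kappa> \<in> F \<Longrightarrow> pre \<mu> \<kappa> \<Longrightarrow> \<mu> \<in> F"
    and bfilter_directed: "\<xi> \<in> F \<Longrightarrow> \<zeta> \<in> F \<Longrightarrow> \<exists>\<kappa>\<in>F. pre \<xi> \<kappa> \<and> pre \<zeta> \<kappa>"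
    and bfilter_upto: "\<exists>\<xi>\<in>F. \<xi> \<in> upto_degree \<Lambda> n"
  using assms unfolding bfilter_def by blast+

lemma bfilter_vertex:
  assumes "bfilter v F"
  shows "v \<in> F" "v \<in> vertices \<Lambda>"
proof -
  obtain \<xi> where \<xi>: "\<xi> \<in> F"
    using bfilter_upto[OF assms] by blast
  then show "v \<in> F" "v \<in> vertices \<Lambda>"
    using bfilter_pre[OF assms \<xi> pre_rg] bfilter_mor[OF assms \<xi>] bfilter_rg[OF assms \<xi>]
      rg_vertex[of \<xi>] by auto
qed

lemma bfilter_range_unique: "bfilter v F \<Longrightarrow> bfilter w F \<Longrightarrow> v = w"
  using bfilter_vertex(1) bfilter_rg by metis

text \<open>Any two candidates are prefixes of a common path, where
  \<open>upto_degree_unique\<close> applies. At a given boundary path this leaves exactly one term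
  of the sum in the last Cuntz-Krieger relation.\<close>

lemma bfilter_upto_unique:
  assumes F: "bfilter v F"
  obtains \<xi> where "with_range \<Lambda> v (upto_degree \<Lambda> n) \<inter> F = {\<xi>}"
proof -
  obtain \<xi> where \<xi>: "\<xi> \<in> F" "\<xi> \<in> upto_degree \<Lambda> n"
    using bfilter_upto[OF F] by blast
  have "\<zeta> = \<xi>" if \<zeta>: "\<zeta> \<in> F" "\<zeta> \<in> upto_degree \<Lambda> n" for \<zeta>
  proof -
    obtain \<kappa> where "pre \<xi> \<kappa>" "pre \<zeta> \<kappa>"
      using bfilter_directed[OF F \<xi>(1) \<zeta>(1)] by blast
    then show ?thesis
      unfolding pre_def using upto_degree_unique[OF \<zeta>(2) \<xi>(2)] by metis
  qed
  then have "with_range \<Lambda> v (upto_degree \<Lambda> n) \<inter> F = {\<xi>}"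
    unfolding with_range_def using \<xi> bfilter_rg[OF F] by blast
  then show thesis
    by (rule that)
qed

text \<open>Stage \<open>N\<close> appends a member of \<open>upto_degree\<close> for the constant
  degree \<open>N\<close>; afterwards each colour has degree at least \<open>N\<close> or no further
  edge. Cutting such a path by \<open>upto_degree_prefix\<close> reaches every
  \<open>n\<close>.\<close>

lemma bfilter_exists:
  assumes lc: "locally_convex \<Lambda>" and v: "v \<in> vertices \<Lambda>"
  obtains F where "bfilter v F"
proof -
  have "\<exists>\<eta>. \<eta> \<in> upto_degree \<Lambda> (\<lambda>_. N) \<and> rg \<Lambda> \<eta> = sc \<Lambda> \<xi>" if "\<xi> \<in> mor \<Lambda>" for \<xi> N
    using upto_degree_nonempty[OF sc_vertex[OF that]] by metis
  then obtain \<eta> where \<eta>: "\<And>\<xi> N. \<xi> \<in> mor \<Lambda> \<Longrightarrow> \<eta> \<xi> N \<in> upto_degree \<Lambda> (\<lambda>_. N)"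
      "\<And>\<xi> N. \<xi> \<in> mor \<Lambda> \<Longrightarrow> rg \<Lambda> (\<eta> \<xi> N) = sc \<Lambda> \<xi>"
    by metis
  have \<eta>m: "\<eta> \<xi> N \<in> mor \<Lambda>" if "\<xi> \<in> mor \<Lambda>" for \<xi> N
    using \<eta>(1)[OF that, of N] by (simp add: upto_degree_iff)
  define x where "x = rec_nat v (\<lambda>N \<xi>. cmp \<Lambda> \<xi> (\<eta> \<xi> N))"
  have x0: "x 0 = v" and xS: "x (Suc N) = cmp \<Lambda> (x N) (\<eta> (x N) N)" for N
    by (simp_all add: x_def)
  have xm: "x N \<in> mor \<Lambda>" "rg \<Lambda> (x N) = v" for N
  proof (induction N)
    case (Suc N)
    case 1
    show ?case
      using Suc \<eta> \<eta>m by (simp add: xS cmp_closed)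
    case 2
    show ?case
      using Suc \<eta> \<eta>m by (simp add: xS rg_cmp)
  qed (use vertexD[OF v] in \<open>simp_all add: x0\<close>)
  have step: "pre (x N) (x (Suc N))" for N
    unfolding xS using xm \<eta> \<eta>m by (intro pre_cmp) auto
  have mono: "pre (x M) (x N)" if "M \<le> N" for M N
    using that
  proof (induction N rule: dec_induct)
    case (step N)
    then show ?case
      using pre_trans \<open>\<And>N. pre (x N) (x (Suc N))\<close> by blast
  qed (simp add: pre_refl xm)
  have "bfilter v {\<mu>. \<exists>N. pre \<mu> (x N)}"
    unfolding bfilter_def
  proof (intro conjI ballI allI impI)
    show "{\<mu>. \<exists>N. pre \<mu> (x N)} \<subseteq> mor \<Lambda>"
      by (auto dest: pre_mor)
    show "rg \<Lambda> \<xi> = v" if "\<xi> \<in> {\<mu>. \<exists>N. pre \<mu> (x N)}" for \<xi>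
      using that xm pre_mor(3) by force
    show "\<mu> \<in> {\<mu>. \<exists>N. pre \<mu> (x N)}" if "\<kappa> \<in> {\<mu>. \<exists>N. pre \<mu> (x N)}" "pre \<mu> \<kappa>" for \<mu> \<kappa>
      using that pre_trans by blast
    show "\<exists>\<kappa>\<in>{\<mu>. \<exists>N. pre \<mu> (x N)}. pre \<xi> \<kappa> \<and> pre \<zeta> \<kappa>"
      if mem: "\<xi> \<in> {\<mu>. \<exists>N. pre \<mu> (x N)}" "\<zeta> \<in> {\<mu>. \<exists>N. pre \<mu> (x N)}" for \<xi> \<zeta>
    proof -
      obtain M N where "pre \<xi> (x M)" "pre \<zeta> (x N)"
        using mem by blast
      then have "pre \<xi> (x (max M N))" "pre \<zeta> (x (max M N))"
        using pre_trans mono by (meson max.cobounded1 max.cobounded2)+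
      then show ?thesis
        using pre_refl xm(1) by blast
    qed
    fix n :: "'k \<Rightarrow> nat"
    define N where "N = total n"
    have n: "n i \<le> N" for i
      by (simp add: N_def le_total)
    have "\<not> has_edge \<Lambda> i (sc \<Lambda> (x (Suc N)))" if "dg \<Lambda> (x (Suc N)) i < n i" for i
    proof -
      have "dg \<Lambda> (\<eta> (x N) N) i < N"
        using that n[of i] xm(1)[of N] \<eta>(2)[OF xm(1)[of N]] \<eta>m[OF xm(1)[of N]]
        by (simp add: xS dg_cmp)
      then show ?thesis
        using \<eta>(1)[OF xm(1)[of N], of N] \<eta>(2)[OF xm(1)[of N]] \<eta>m[OF xm(1)[of N]] xm(1)[of N]
        by (simp add: xS sc_cmp upto_degree_iff)
    qed
    then obtain \<mu> \<tau> where "\<mu> \<in> upto_degree \<Lambda> n" "\<tau> \<in> mor \<Lambda>" "sc \<Lambda> \<mu> = rg \<Lambda> \<tau>" "x (Suc N) = cmp \<Lambda> \<mu> \<tau>"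
      using upto_degree_prefix[OF lc xm(1)] by metis
    moreover from this have "pre \<mu> (x (Suc N))"
      using pre_cmp by (simp add: upto_degree_iff)
    ultimately show "{\<mu>. \<exists>N. pre \<mu> (x N)} \<inter> upto_degree \<Lambda> n \<noteq> {}"
      by blast
  qed
  then show thesis
    by (rule that)
qed

lemma mem_ext: "\<xi> \<in> mor \<Lambda> \<Longrightarrow> bfilter (sc \<Lambda> \<xi>) F \<Longrightarrow> \<xi> \<in> ext \<xi> F"
  unfolding ext_def mem_Collect_eq
  by (rule bexI[of _ "sc \<Lambda> \<xi>"]) (simp_all add: cmp_sc_id pre_refl bfilter_vertex)

lemma bfilter_ext:
  assumes lc: "locally_convex \<Lambda>" and \<xi>: "\<xi> \<in> mor \<Lambda>" and F: "bfilter (sc \<Lambda> \<xi>) F"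
  shows "bfilter (rg \<Lambda> \<xi>) (ext \<xi> F)"
  unfolding bfilter_def
proof (intro conjI ballI allI impI)
  note Fm = bfilter_mor[OF F] bfilter_rg[OF F]
  show "ext \<xi> F \<subseteq> mor \<Lambda>"
    by (auto simp: ext_def dest: pre_mor)
  show "rg \<Lambda> \<mu> = rg \<Lambda> \<xi>" if "\<mu> \<in> ext \<xi> F" for \<mu>
    using that \<xi> Fm pre_mor(3) by (force simp: ext_def rg_cmp)
  show "\<mu> \<in> ext \<xi> F" if "\<kappa> \<in> ext \<xi> F" "pre \<mu> \<kappa>" for \<mu> \<kappa>
    using that pre_trans unfolding ext_def by blast
  show "\<exists>\<kappa>\<in>ext \<xi> F. pre \<mu> \<kappa> \<and> pre \<nu> \<kappa>" if mem: "\<mu> \<in> ext \<xi> F" "\<nu> \<in> ext \<xi> F" for \<mu> \<nu>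
  proof -
    obtain a b where ab: "a \<in> F" "pre \<mu> (cmp \<Lambda> \<xi> a)" "b \<in> F" "pre \<nu> (cmp \<Lambda> \<xi> b)"
      using mem by (auto simp: ext_def)
    obtain c where c: "c \<in> F" "pre a c" "pre b c"
      using bfilter_directed[OF F ab(1,3)] by blast
    have "pre \<mu> (cmp \<Lambda> \<xi> c)" "pre \<nu> (cmp \<Lambda> \<xi> c)"
      using pre_trans[OF ab(2) pre_cmp_left] pre_trans[OF ab(4) pre_cmp_left] ab c Fm \<xi> by auto
    moreover have "cmp \<Lambda> \<xi> c \<in> ext \<xi> F"
      using c \<xi> Fm pre_refl[of "cmp \<Lambda> \<xi> c"] by (auto simp: ext_def cmp_closed)
    ultimately show ?thesis
      by blast
  qed
  fix n :: "'k \<Rightarrow> nat"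
  obtain \<eta> where \<eta>: "\<eta> \<in> F" "\<eta> \<in> upto_degree \<Lambda> n"
    using bfilter_upto[OF F] by blast
  have "\<not> has_edge \<Lambda> i (sc \<Lambda> (cmp \<Lambda> \<xi> \<eta>))" if "dg \<Lambda> (cmp \<Lambda> \<xi> \<eta>) i < n i" for i
    using that \<eta> \<xi> Fm[OF \<eta>(1)] by (simp add: upto_degree_iff dg_cmp sc_cmp)
  then obtain \<mu> \<tau> where \<mu>: "\<mu> \<in> upto_degree \<Lambda> n" "\<tau> \<in> mor \<Lambda>" "sc \<Lambda> \<mu> = rg \<Lambda> \<tau>" "cmp \<Lambda> \<xi> \<eta> = cmp \<Lambda> \<mu> \<tau>"
    using upto_degree_prefix[OF lc, of "cmp \<Lambda> \<xi> \<eta>" n] \<xi> Fm[OF \<eta>(1)] by (metis cmp_closed)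
  then have "pre \<mu> (cmp \<Lambda> \<xi> \<eta>)"
    using pre_cmp[of \<mu> \<tau>] by (simp add: upto_degree_iff)
  with \<eta> have "\<mu> \<in> ext \<xi> F"
    by (auto simp: ext_def)
  with \<mu> show "ext \<xi> F \<inter> upto_degree \<Lambda> n \<noteq> {}"
    by blast
qed

lemma bfilter_quot:
  assumes lc: "locally_convex \<Lambda>" and F: "bfilter v F" and \<xi>: "\<xi> \<in> F"
  shows "bfilter (sc \<Lambda> \<xi>) (quot \<xi> F)"
  unfolding bfilter_def
proof (intro conjI ballI allI impI)
  have \<xi>m: "\<xi> \<in> mor \<Lambda>"
    using bfilter_mor[OF F \<xi>] .
  show "quot \<xi> F \<subseteq> mor \<Lambda>"
    by (auto simp: quot_def)
  show "rg \<Lambda> \<mu> = sc \<Lambda> \<xi>" if "\<mu> \<in> quot \<xi> F" for \<mu>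
    using that by (simp add: quot_def)
  show "\<mu> \<in> quot \<xi> F" if "\<kappa> \<in> quot \<xi> F" "pre \<mu> \<kappa>" for \<mu> \<kappa>
    using that \<xi>m pre_mor[OF that(2)] bfilter_pre[OF F _ pre_cmp_left[OF \<xi>m _ that(2)]]
    by (auto simp: quot_def)
  have upper: "\<exists>\<eta>\<in>quot \<xi> F. pre \<zeta> (cmp \<Lambda> \<xi> \<eta>)" if \<zeta>: "\<zeta> \<in> F" for \<zeta>
  proof -
    obtain \<kappa> where \<kappa>: "\<kappa> \<in> F" "pre \<xi> \<kappa>" "pre \<zeta> \<kappa>"
      using bfilter_directed[OF F \<xi> \<zeta>] by blast
    then show ?thesis
      by (auto simp: quot_def pre_def[of \<xi>])
  qed
  show "\<exists>\<kappa>\<in>quot \<xi> F. pre \<mu> \<kappa> \<and> pre \<nu> \<kappa>" if "\<mu> \<in> quot \<xi> F" "\<nu> \<in> quot \<xi> F" for \<mu> \<nu>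
  proof -
    have m: "\<mu> \<in> mor \<Lambda>" "sc \<Lambda> \<xi> = rg \<Lambda> \<mu>" "cmp \<Lambda> \<xi> \<mu> \<in> F" "\<nu> \<in> mor \<Lambda>" "sc \<Lambda> \<xi> = rg \<Lambda> \<nu>" "cmp \<Lambda> \<xi> \<nu> \<in> F"
      using that by (auto simp: quot_def)
    obtain \<kappa> where \<kappa>: "\<kappa> \<in> F" "pre (cmp \<Lambda> \<xi> \<mu>) \<kappa>" "pre (cmp \<Lambda> \<xi> \<nu>) \<kappa>"
      using bfilter_directed[OF F m(3,6)] by blast
    obtain \<eta> where \<eta>: "\<eta> \<in> quot \<xi> F" "pre \<kappa> (cmp \<Lambda> \<xi> \<eta>)"
      using upper[OF \<kappa>(1)] by blast
    have "pre \<mu> \<eta>" "pre \<nu> \<eta>"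
      using pre_cmp_cancel[OF pre_trans[OF \<kappa>(2) \<eta>(2)] \<xi>m m(1) _ m(2)]
        pre_cmp_cancel[OF pre_trans[OF \<kappa>(3) \<eta>(2)] \<xi>m m(4) _ m(5)] \<eta>(1)
      by (auto simp: quot_def)
    with \<eta>(1) show ?thesis
      by blast
  qed
  fix n :: "'k \<Rightarrow> nat"
  \<comment> \<open>The level is raised by \<open>dg \<Lambda> \<xi>\<close>, so that level
    \<open>n\<close> is left when \<open>\<xi>\<close> is removed.\<close>
  obtain \<zeta> where \<zeta>: "\<zeta> \<in> F" "\<zeta> \<in> upto_degree \<Lambda> (n + dg \<Lambda> \<xi>)"
    using bfilter_upto[OF F] by blast
  obtain \<eta> where \<eta>: "\<eta> \<in> quot \<xi> F" "pre \<zeta> (cmp \<Lambda> \<xi> \<eta>)"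
    using upper[OF \<zeta>(1)] by blast
  then have \<eta>m: "\<eta> \<in> mor \<Lambda>" "sc \<Lambda> \<xi> = rg \<Lambda> \<eta>" "cmp \<Lambda> \<xi> \<eta> \<in> F"
    by (auto simp: quot_def)
  obtain \<sigma> where \<sigma>: "\<zeta> \<in> mor \<Lambda>" "\<sigma> \<in> mor \<Lambda>" "sc \<Lambda> \<zeta> = rg \<Lambda> \<sigma>" "cmp \<Lambda> \<xi> \<eta> = cmp \<Lambda> \<zeta> \<sigma>"
    using \<eta>(2) by (auto simp: pre_def)
  have deg: "dg \<Lambda> \<xi> i + dg \<Lambda> \<eta> i = dg \<Lambda> \<zeta> i + dg \<Lambda> \<sigma> i" for i
    using \<sigma> \<eta>m \<xi>m dg_cmp by (metis plus_fun_apply)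
  have "\<not> has_edge \<Lambda> i (sc \<Lambda> \<eta>)" if "dg \<Lambda> \<eta> i < n i" for i
  proof
    assume "has_edge \<Lambda> i (sc \<Lambda> \<eta>)"
    moreover have "sc \<Lambda> \<eta> = sc \<Lambda> \<sigma>"
      using \<sigma> \<eta>m \<xi>m by (metis sc_cmp)
    ultimately have "has_edge \<Lambda> i (sc \<Lambda> \<zeta>)"
      using has_edge_hereditary[OF \<sigma>(2)] \<sigma>(3) by simp
    moreover have "dg \<Lambda> \<zeta> i < (n + dg \<Lambda> \<xi>) i"
      using deg[of i] that by simp
    ultimately show False
      using \<zeta>(2) by (simp add: upto_degree_iff)
  qed
  then obtain \<mu> \<tau> where \<mu>: "\<mu> \<in> upto_degree \<Lambda> n" "\<tau> \<in> mor \<Lambda>" "sc \<Lambda> \<mu> = rg \<Lambda> \<tau>" "\<eta> = cmp \<Lambda> \<mu> \<tau>"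
    using upto_degree_prefix[OF lc \<eta>m(1)] by metis
  then have "pre \<mu> \<eta>"
    using pre_cmp by (simp add: upto_degree_iff)
  then have "\<mu> \<in> quot \<xi> F"
    using \<eta>m \<xi>m pre_mor[OF \<open>pre \<mu> \<eta>\<close>] bfilter_pre[OF F \<eta>m(3) pre_cmp_left[OF \<xi>m _ \<open>pre \<mu> \<eta>\<close>]]
    by (auto simp: quot_def)
  with \<mu> show "quot \<xi> F \<inter> upto_degree \<Lambda> n \<noteq> {}"
    by blast
qed

text \<open>Together with \<open>quot_ext\<close>: concatenation with \<open>\<xi>\<close> is a
  bijection from the boundary paths at \<open>sc \<Lambda> \<xi>\<close> onto those that pass
  through \<open>\<xi>\<close>.\<close>

lemma ext_quot:
  assumes F: "bfilter v F" and \<xi>: "\<xi> \<in> F"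
  shows "ext \<xi> (quot \<xi> F) = F"
proof
  show "ext \<xi> (quot \<xi> F) \<subseteq> F"
    using bfilter_pre[OF F] by (auto simp: ext_def quot_def)
  show "F \<subseteq> ext \<xi> (quot \<xi> F)"
  proof
    fix \<zeta> assume "\<zeta> \<in> F"
    then obtain \<kappa> where "\<kappa> \<in> F" "pre \<xi> \<kappa>" "pre \<zeta> \<kappa>"
      using bfilter_directed[OF F \<xi>] by blast
    then show "\<zeta> \<in> ext \<xi> (quot \<xi> F)"
      by (auto simp: ext_def quot_def pre_def[of \<xi>])
  qed
qed

lemma quot_ext:
  assumes \<xi>: "\<xi> \<in> mor \<Lambda>" and F: "bfilter (sc \<Lambda> \<xi>) F"
  shows "quot \<xi> (ext \<xi> F) = F"
proof
  note Fm = bfilter_mor[OF F] bfilter_rg[OF F]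
  show "quot \<xi> (ext \<xi> F) \<subseteq> F"
  proof
    fix \<mu> assume "\<mu> \<in> quot \<xi> (ext \<xi> F)"
    then obtain \<eta> where \<mu>: "\<mu> \<in> mor \<Lambda>" "sc \<Lambda> \<xi> = rg \<Lambda> \<mu>"
      and \<eta>: "\<eta> \<in> F" "pre (cmp \<Lambda> \<xi> \<mu>) (cmp \<Lambda> \<xi> \<eta>)"
      by (auto simp: ext_def quot_def)
    have "pre \<mu> \<eta>"
      using pre_cmp_cancel[OF \<eta>(2) \<xi> \<mu>(1) Fm(1)[OF \<eta>(1)] \<mu>(2)] Fm(2)[OF \<eta>(1)] by simp
    then show "\<mu> \<in> F"
      using bfilter_pre[OF F \<eta>(1)] by blast
  qed
  show "F \<subseteq> quot \<xi> (ext \<xi> F)"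
  proof
    fix \<eta> assume "\<eta> \<in> F"
    with Fm \<xi> show "\<eta> \<in> quot \<xi> (ext \<xi> F)"
      using pre_refl[of "cmp \<Lambda> \<xi> \<eta>"] by (auto simp: ext_def quot_def cmp_closed)
  qed
qed

lemma quot_vertex:
  assumes F: "bfilter v F"
  shows "quot v F = F"
proof -
  have "cmp \<Lambda> v \<eta> = \<eta>" if "\<eta> \<in> mor \<Lambda>" "rg \<Lambda> \<eta> = v" for \<eta>
    using that rg_cmp_id by blast
  moreover have "sc \<Lambda> v = v"
    using vertexD(4)[OF bfilter_vertex(2)[OF F]] .
  ultimately have "\<eta> \<in> quot v F \<longleftrightarrow> \<eta> \<in> F" for \<eta>
    unfolding quot_def mem_Collect_eq using bfilter_mor[OF F, of \<eta>] bfilter_rg[OF F, of \<eta>]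
    by metis
  then show ?thesis
    by blast
qed

lemma ext_vertex: "bfilter v F \<Longrightarrow> ext v F = F"
  using ext_quot[of v F v] quot_vertex bfilter_vertex by simp

lemma cmp_mem_bfilter_iff:
  assumes "bfilter v F" "\<mu> \<in> mor \<Lambda>" "\<nu> \<in> mor \<Lambda>" "sc \<Lambda> \<mu> = rg \<Lambda> \<nu>"
  shows "cmp \<Lambda> \<mu> \<nu> \<in> F \<longleftrightarrow> \<mu> \<in> F \<and> \<nu> \<in> quot \<mu> F"
  using assms bfilter_pre[OF assms(1) _ pre_cmp[OF assms(2-4)]] by (auto simp: quot_def)

lemma quot_quot:
  assumes "\<mu> \<in> mor \<Lambda>" "\<nu> \<in> mor \<Lambda>" "sc \<Lambda> \<mu> = rg \<Lambda> \<nu>"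
  shows "quot \<nu> (quot \<mu> F) = quot (cmp \<Lambda> \<mu> \<nu>) F"
proof (rule Set.set_eqI)
  fix \<eta>
  show "\<eta> \<in> quot \<nu> (quot \<mu> F) \<longleftrightarrow> \<eta> \<in> quot (cmp \<Lambda> \<mu> \<nu>) F"
    unfolding quot_def mem_Collect_eq
    using assms cmp_assoc[of \<mu> \<nu> \<eta>] cmp_closed[of \<nu> \<eta>] rg_cmp[of \<nu> \<eta>] sc_cmp[of \<mu> \<nu>] by metis
qed

end

section \<open>Finitely supported vectors\<close>

text \<open>An inner product space with finite sums only; the operator norm over it already
  satisfies the C*-identity.\<close>

definition fsupp :: "('x \<Rightarrow> complex) set" where
  "fsupp = {f. finite {x. f x \<noteq> 0}}"

definition vnorm :: "('x \<Rightarrow> complex) \<Rightarrow> real" where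
  "vnorm f = L2_set (\<lambda>x. cmod (f x)) {x. f x \<noteq> 0}"

definition ip :: "('x \<Rightarrow> complex) \<Rightarrow> ('x \<Rightarrow> complex) \<Rightarrow> complex" where
  "ip f g = (\<Sum>x | f x \<noteq> 0. f x * cnj (g x))"

lemma vnorm_eq:
  assumes "finite A" "{x. f x \<noteq> 0} \<subseteq> A"
  shows "vnorm f = L2_set (\<lambda>x. cmod (f x)) A"
  unfolding vnorm_def L2_set_def
  by (intro arg_cong[where f = sqrt] sum.mono_neutral_left assms) auto

lemma ip_eq:
  assumes "finite A" "{x. f x \<noteq> 0} \<subseteq> A"
  shows "ip f g = (\<Sum>x\<in>A. f x * cnj (g x))"
  unfolding ip_def by (intro sum.mono_neutral_left assms) auto

lemma fsuppD: "f \<in> fsupp \<Longrightarrow> finite {x. f x \<noteq> 0}"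
  by (simp add: fsupp_def)

lemma fsupp_subset: "f \<in> fsupp \<Longrightarrow> {x. g x \<noteq> 0} \<subseteq> {x. f x \<noteq> 0} \<Longrightarrow> g \<in> fsupp"
  by (auto simp: fsupp_def intro: finite_subset)

lemma fsupp_zero: "(\<lambda>_. 0) \<in> fsupp"
  by (simp add: fsupp_def)

lemma fsupp_add: "f \<in> fsupp \<Longrightarrow> g \<in> fsupp \<Longrightarrow> (\<lambda>x. f x + g x) \<in> fsupp"
  unfolding fsupp_def mem_Collect_eq
  by (rule finite_subset[of _ "{x. f x \<noteq> 0} \<union> {x. g x \<noteq> 0}"]) auto

lemma fsupp_scale: "f \<in> fsupp \<Longrightarrow> (\<lambda>x. c * f x) \<in> fsupp"
  by (rule fsupp_subset) auto

lemma vnorm_nonneg: "0 \<le> vnorm f"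
  by (simp add: vnorm_def)

lemma vnorm_zero [simp]: "vnorm (\<lambda>_. 0) = 0"
  by (simp add: vnorm_def)

lemma vnorm_add:
  assumes "f \<in> fsupp" "g \<in> fsupp"
  shows "vnorm (\<lambda>x. f x + g x) \<le> vnorm f + vnorm g"
proof -
  let ?A = "{x. f x \<noteq> 0} \<union> {x. g x \<noteq> 0}"
  have A: "finite ?A"
    using assms by (simp add: fsupp_def)
  have "vnorm (\<lambda>x. f x + g x) = L2_set (\<lambda>x. cmod (f x + g x)) ?A"
    by (rule vnorm_eq[OF A]) auto
  also have "\<dots> \<le> L2_set (\<lambda>x. cmod (f x) + cmod (g x)) ?A"
    by (rule L2_set_mono) (auto intro: norm_triangle_ineq)
  also have "\<dots> \<le> L2_set (\<lambda>x. cmod (f x)) ?A + L2_set (\<lambda>x. cmod (g x)) ?A"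
    by (rule L2_set_triangle_ineq)
  also have "\<dots> = vnorm f + vnorm g"
    using vnorm_eq[OF A, of f] vnorm_eq[OF A, of g] by simp
  finally show ?thesis .
qed

lemma vnorm_scale:
  assumes "f \<in> fsupp"
  shows "vnorm (\<lambda>x. c * f x) = cmod c * vnorm f"
proof -
  have "vnorm (\<lambda>x. c * f x) = L2_set (\<lambda>x. cmod (c * f x)) {x. f x \<noteq> 0}"
    using fsuppD[OF assms] by (rule vnorm_eq) auto
  then show ?thesis
    by (simp add: vnorm_def norm_mult L2_set_right_distrib)
qed

lemma ip_self: "ip f f = of_real ((vnorm f)\<^sup>2)"
  by (simp add: ip_def vnorm_def L2_set_def sum_nonneg flip: complex_norm_square)

lemma ip_cnj:
  assumes "f \<in> fsupp" "g \<in> fsupp"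
  shows "ip f g = cnj (ip g f)"
proof -
  let ?A = "{x. f x \<noteq> 0} \<union> {x. g x \<noteq> 0}"
  have A: "finite ?A"
    using assms by (simp add: fsupp_def)
  show ?thesis
    using ip_eq[OF A, of f g] ip_eq[OF A, of g f] by (simp add: mult.commute)
qed

lemma cmod_ip_le:
  assumes "f \<in> fsupp" "g \<in> fsupp"
  shows "cmod (ip f g) \<le> vnorm f * vnorm g"
proof -
  let ?A = "{x. f x \<noteq> 0} \<union> {x. g x \<noteq> 0}"
  have A: "finite ?A"
    using assms by (simp add: fsupp_def)
  have "cmod (ip f g) \<le> (\<Sum>x\<in>?A. \<bar>cmod (f x)\<bar> * \<bar>cmod (g x)\<bar>)"
    unfolding ip_eq[OF A, of f g, simplified] by (rule order_trans[OF norm_sum]) (simp add: norm_mult)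
  also have "\<dots> \<le> L2_set (\<lambda>x. cmod (f x)) ?A * L2_set (\<lambda>x. cmod (g x)) ?A"
    by (rule L2_set_mult_ineq)
  also have "\<dots> = vnorm f * vnorm g"
    using vnorm_eq[OF A, of f] vnorm_eq[OF A, of g] by simp
  finally show ?thesis .
qed

lemma ip_add_left:
  assumes "f \<in> fsupp" "g \<in> fsupp"
  shows "ip (\<lambda>x. f x + g x) h = ip f h + ip g h"
proof -
  let ?A = "{x. f x \<noteq> 0} \<union> {x. g x \<noteq> 0}"
  have A: "finite ?A"
    using assms by (simp add: fsupp_def)
  have "ip (\<lambda>x. f x + g x) h = (\<Sum>x\<in>?A. (f x + g x) * cnj (h x))"
    by (rule ip_eq[OF A]) auto
  then show ?thesis
    using ip_eq[OF A, of f h] ip_eq[OF A, of g h] by (simp add: distrib_right sum.distrib)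
qed

lemma ip_add_right: "ip h (\<lambda>x. f x + g x) = ip h f + ip h g"
  by (simp add: ip_def distrib_left sum.distrib)

lemma ip_scale_left:
  assumes "f \<in> fsupp"
  shows "ip (\<lambda>x. c * f x) h = c * ip f h"
proof -
  have "ip (\<lambda>x. c * f x) h = (\<Sum>x | f x \<noteq> 0. c * f x * cnj (h x))"
    using fsuppD[OF assms] by (rule ip_eq) auto
  then show ?thesis
    by (simp add: ip_def sum_distrib_left mult.assoc)
qed

lemma ip_scale_right: "ip h (\<lambda>x. c * f x) = cnj c * ip h f"
  by (simp add: ip_def sum_distrib_left mult.left_commute mult.assoc)

section \<open>The boundary path representation\<close>

context k_graph
begin

text \<open>For a boundary path \<open>G\<close> at \<open>sc \<Lambda> \<xi>\<close>, the point
  mass at \<open>G\<close> goes to the point mass at \<open>ext \<xi> G\<close>. Vectors are indexed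
  by arbitrary sets of paths, and the filter condition discards all but boundary paths with the
  right range.\<close>

definition S_op :: "'l \<Rightarrow> ('l set \<Rightarrow> complex) \<Rightarrow> 'l set \<Rightarrow> complex" where
  "S_op \<xi> f = (\<lambda>F. if bfilter (rg \<Lambda> \<xi>) F \<and> \<xi> \<in> F then f (quot \<xi> F) else 0)"

definition T_op :: "'l \<Rightarrow> ('l set \<Rightarrow> complex) \<Rightarrow> 'l set \<Rightarrow> complex" where
  "T_op \<xi> f = (\<lambda>F. if bfilter (sc \<Lambda> \<xi>) F then f (ext \<xi> F) else 0)"

fun word_op :: "('l \<times> bool) list \<Rightarrow> ('l set \<Rightarrow> complex) \<Rightarrow> 'l set \<Rightarrow> complex" where
  "word_op [] f = f"
| "word_op ((\<xi>, b) # w) f = (if b then T_op \<xi> (word_op w f) else S_op \<xi> (word_op w f))"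

definition rep :: "'l star_poly \<Rightarrow> ('l set \<Rightarrow> complex) \<Rightarrow> 'l set \<Rightarrow> complex" where
  "rep p f = (\<lambda>F. \<Sum>w\<in>Poly_Mapping.keys p. Poly_Mapping.lookup p w * word_op w f F)"

lemma word_op_append: "word_op (u @ w) f = word_op u (word_op w f)"
  by (induction u f rule: word_op.induct) auto

lemma word_op_add: "word_op w (\<lambda>F. f F + g F) = (\<lambda>F. word_op w f F + word_op w g F)"
  by (induction w f rule: word_op.induct) (auto simp: S_op_def T_op_def)

lemma word_op_scale: "word_op w (\<lambda>F. c * f F) = (\<lambda>F. c * word_op w f F)"
  by (induction w f rule: word_op.induct) (auto simp: S_op_def T_op_def)

lemma rep_eq:
  assumes "finite A" "Poly_Mapping.keys p \<subseteq> A"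
  shows "rep p f F = (\<Sum>w\<in>A. Poly_Mapping.lookup p w * word_op w f F)"
  unfolding rep_def by (intro sum.mono_neutral_left assms) (auto simp: in_keys_iff)

lemma rep_zero: "rep 0 f = (\<lambda>_. 0)"
  by (simp add: rep_def)

lemma rep_add: "rep (p + q) f = (\<lambda>F. rep p f F + rep q f F)"
proof
  fix F
  let ?A = "Poly_Mapping.keys p \<union> Poly_Mapping.keys q"
  have "Poly_Mapping.keys (p + q) \<subseteq> ?A"
    by (auto simp: in_keys_iff lookup_add)
  then show "rep (p + q) f F = rep p f F + rep q f F"
    using rep_eq[of ?A "p + q" f F] rep_eq[of ?A p f F] rep_eq[of ?A q f F]
    by (simp add: lookup_add distrib_right sum.distrib)
qed

lemma rep_single: "rep (Poly_Mapping.single w c) f = (\<lambda>F. c * word_op w f F)"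
  using rep_eq[of "{w}" "Poly_Mapping.single w c" f] by (auto simp: fun_eq_iff in_keys_iff lookup_single when_def split: if_splits)

lemma rep_vec_add: "rep p (\<lambda>F. f F + g F) = (\<lambda>F. rep p f F + rep p g F)"
  by (simp add: rep_def word_op_add distrib_left sum.distrib)

lemma rep_mult: "rep (p * q) f = rep p (rep q f)"
proof (induction p rule: star_poly_induct)
  case (single u a)
  show ?case
  proof (induction q rule: star_poly_induct)
    case (single w b)
    show ?case
      by (simp add: mult_single rep_single plus_list_def word_op_append word_op_scale mult.assoc)
  next
    case zero
    show ?case
      using word_op_scale[of u 0 f] by (simp add: rep_zero rep_single)
  qed (simp add: distrib_left rep_add rep_vec_add)
qed (simp_all add: rep_zero distrib_right rep_add)

lemma rep_scale: "rep (sp_scale c p) f = (\<lambda>F. c * rep p f F)"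
  by (simp add: sp_scale_eq_mult rep_mult rep_single zero_list_def)

lemma rep_diff: "rep (p - q) f = (\<lambda>F. rep p f F - rep q f F)"
  using rep_add[of p "sp_scale (- 1) q" f] rep_scale[of "- 1" q f] by simp

lemma rep_sum: "rep (sum p A) f = (\<lambda>F. \<Sum>i\<in>A. rep (p i) f F)"
  by (induction A rule: infinite_finite_induct) (auto simp: rep_zero rep_add)

lemma rep_gen: "rep (gen \<xi>) f = S_op \<xi> f"
  by (simp add: gen_def rep_single)

lemma rep_adj_gen: "rep (sp_adj (gen \<xi>)) f = T_op \<xi> f"
  by (simp add: gen_def sp_adj_single star_word_def rep_single)

context
  assumes lc: "locally_convex \<Lambda>"
begin

lemma S_op_fsupp:
  assumes "\<xi> \<in> mor \<Lambda>" "f \<in> fsupp"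
  shows "S_op \<xi> f \<in> fsupp"
proof -
  have "{F. S_op \<xi> f F \<noteq> 0} \<subseteq> ext \<xi> ` {F. f F \<noteq> 0}"
  proof
    fix F assume "F \<in> {F. S_op \<xi> f F \<noteq> 0}"
    then have F: "bfilter (rg \<Lambda> \<xi>) F" "\<xi> \<in> F" "f (quot \<xi> F) \<noteq> 0"
      by (auto simp: S_op_def split: if_splits)
    then show "F \<in> ext \<xi> ` {F. f F \<noteq> 0}"
      by (intro image_eqI[of _ _ "quot \<xi> F"]) (auto simp: ext_quot)
  qed
  then show ?thesis
    using fsuppD[OF assms(2)] unfolding fsupp_def by (auto intro: finite_subset)
qed

lemma T_op_fsupp:
  assumes "\<xi> \<in> mor \<Lambda>" "f \<in> fsupp"
  shows "T_op \<xi> f \<in> fsupp"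
proof -
  have "{F. T_op \<xi> f F \<noteq> 0} \<subseteq> quot \<xi> ` {F. f F \<noteq> 0}"
  proof
    fix F assume "F \<in> {F. T_op \<xi> f F \<noteq> 0}"
    then have F: "bfilter (sc \<Lambda> \<xi>) F" "f (ext \<xi> F) \<noteq> 0"
      by (auto simp: T_op_def split: if_splits)
    then show "F \<in> quot \<xi> ` {F. f F \<noteq> 0}"
      using assms by (intro image_eqI[of _ _ "ext \<xi> F"]) (auto simp: quot_ext)
  qed
  then show ?thesis
    using fsuppD[OF assms(2)] unfolding fsupp_def by (auto intro: finite_subset)
qed

text \<open>Change of variables along the bijection \<open>ext \<xi>\<close> with inverse
  \<open>quot \<xi>\<close>.\<close>

lemma ip_S_op:
  assumes \<xi>: "\<xi> \<in> mor \<Lambda>" and f: "f \<in> fsupp"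
  shows "ip (S_op \<xi> f) g = ip f (T_op \<xi> g)"
proof -
  have "ip (S_op \<xi> f) g = (\<Sum>F\<in>{F. bfilter (rg \<Lambda> \<xi>) F \<and> \<xi> \<in> F \<and> f (quot \<xi> F) \<noteq> 0}. f (quot \<xi> F) * cnj (g F))"
    unfolding ip_def by (rule sum.cong) (auto simp: S_op_def)
  also have "\<dots> = (\<Sum>F\<in>{F. bfilter (sc \<Lambda> \<xi>) F \<and> f F \<noteq> 0}. f F * cnj (g (ext \<xi> F)))"
    by (rule sum.reindex_bij_witness[of _ "ext \<xi>" "quot \<xi>"])
      (auto simp: ext_quot quot_ext \<xi> bfilter_ext[OF lc] bfilter_quot[OF lc] mem_ext)
  also have "\<dots> = ip f (T_op \<xi> g)"
    unfolding ip_def by (rule sum.mono_neutral_cong_left) (auto simp: T_op_def fsuppD[OF f])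
  finally show ?thesis .
qed

lemma ip_T_op:
  assumes "\<xi> \<in> mor \<Lambda>" "f \<in> fsupp" "g \<in> fsupp"
  shows "ip (T_op \<xi> f) g = ip f (S_op \<xi> g)"
  using assms ip_S_op[of \<xi> g f] ip_cnj[of "T_op \<xi> f" g] ip_cnj[of f "S_op \<xi> g"]
  by (simp add: T_op_fsupp S_op_fsupp)

lemma T_op_S_op:
  assumes "\<xi> \<in> mor \<Lambda>"
  shows "T_op \<xi> (S_op \<xi> f) = S_op (sc \<Lambda> \<xi>) f"
proof
  fix F
  show "T_op \<xi> (S_op \<xi> f) F = S_op (sc \<Lambda> \<xi>) f F"
    using assms bfilter_ext[OF lc assms] mem_ext[OF assms] quot_ext[OF assms]
      bfilter_vertex(1)[of "sc \<Lambda> \<xi>" F] quot_vertex[of "sc \<Lambda> \<xi>" F]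
    by (auto simp: T_op_def S_op_def rg_sc)
qed

text \<open>By adjointness the squared norm is the inner product of \<open>f\<close> with
  \<open>T_op \<xi> (S_op \<xi> f)\<close>, which is merely the restriction of \<open>f\<close> to
  the boundary paths at \<open>sc \<Lambda> \<xi>\<close>.\<close>

lemma vnorm_S_op:
  assumes \<xi>: "\<xi> \<in> mor \<Lambda>" and f: "f \<in> fsupp"
  shows "vnorm (S_op \<xi> f) \<le> vnorm f"
proof -
  have Sf: "S_op \<xi> f \<in> fsupp"
    using assms by (rule S_op_fsupp)
  have eq: "S_op (sc \<Lambda> \<xi>) f = (\<lambda>F. if bfilter (sc \<Lambda> \<xi>) F then f F else 0)"
    using \<xi> bfilter_vertex(1)[of "sc \<Lambda> \<xi>"] quot_vertex[of "sc \<Lambda> \<xi>"]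
    by (auto simp: S_op_def rg_sc fun_eq_iff)
  have "vnorm (S_op (sc \<Lambda> \<xi>) f) = L2_set (\<lambda>F. cmod (S_op (sc \<Lambda> \<xi>) f F)) {F. f F \<noteq> 0}"
    using fsuppD[OF f] by (rule vnorm_eq) (auto simp: eq)
  also have "\<dots> \<le> vnorm f"
    unfolding vnorm_def by (rule L2_set_mono) (auto simp: eq)
  finally have le: "vnorm (S_op (sc \<Lambda> \<xi>) f) \<le> vnorm f" .
  have "(vnorm (S_op \<xi> f))\<^sup>2 = cmod (ip (S_op \<xi> f) (S_op \<xi> f))"
    by (simp add: ip_self norm_power)
  also have "\<dots> = cmod (ip f (S_op (sc \<Lambda> \<xi>) f))"
    using ip_S_op[OF \<xi> f, of "S_op \<xi> f"] T_op_S_op[OF \<xi>] by simp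
  also have "\<dots> \<le> vnorm f * vnorm (S_op (sc \<Lambda> \<xi>) f)"
    using f \<xi> by (intro cmod_ip_le S_op_fsupp sc_closed)
  also have "\<dots> \<le> (vnorm f)\<^sup>2"
    using le vnorm_nonneg[of f] by (simp add: power2_eq_square mult_left_mono)
  finally show ?thesis
    using vnorm_nonneg by (rule power2_le_imp_le)
qed

text \<open>Adjointness and the bound for \<open>S_op\<close> bound the squared norm by
  \<open>vnorm f\<close> times the norm itself, and one factor cancels.\<close>

lemma vnorm_T_op:
  assumes \<xi>: "\<xi> \<in> mor \<Lambda>" and f: "f \<in> fsupp"
  shows "vnorm (T_op \<xi> f) \<le> vnorm f"
proof -
  have Tf: "T_op \<xi> f \<in> fsupp"
    using assms by (rule T_op_fsupp)
  have "(vnorm (T_op \<xi> f))\<^sup>2 = cmod (ip (T_op \<xi> f) (T_op \<xi> f))"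
    by (simp add: ip_self norm_power)
  also have "\<dots> = cmod (ip f (S_op \<xi> (T_op \<xi> f)))"
    using ip_T_op[OF \<xi> f Tf] by simp
  also have "\<dots> \<le> vnorm f * vnorm (S_op \<xi> (T_op \<xi> f))"
    using f \<xi> Tf by (intro cmod_ip_le S_op_fsupp)
  also have "\<dots> \<le> vnorm f * vnorm (T_op \<xi> f)"
    using vnorm_S_op[OF \<xi> Tf] vnorm_nonneg by (rule mult_left_mono)
  finally have "vnorm (T_op \<xi> f) * vnorm (T_op \<xi> f) \<le> vnorm f * vnorm (T_op \<xi> f)"
    by (simp add: power2_eq_square)
  then show ?thesis
    using vnorm_nonneg[of "T_op \<xi> f"] vnorm_nonneg[of f]
    by (cases "vnorm (T_op \<xi> f) = 0") auto
qed

lemma rep_fsupp: "p \<in> free_star (mor \<Lambda>) \<Longrightarrow> f \<in> fsupp \<Longrightarrow> rep p f \<in> fsupp"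
proof (induction p arbitrary: f rule: free_star_induct)
  case (mult p q)
  then show ?case
    by (simp add: rep_mult)
qed (simp_all add: rep_zero fsupp_zero rep_add fsupp_add rep_scale fsupp_scale rep_gen S_op_fsupp
    rep_adj_gen T_op_fsupp)

lemma ip_rep: "p \<in> free_star (mor \<Lambda>) \<Longrightarrow> f \<in> fsupp \<Longrightarrow> g \<in> fsupp \<Longrightarrow>
  ip (rep p f) g = ip f (rep (sp_adj p) g)"
proof (induction p arbitrary: f g rule: free_star_induct)
  case zero
  then show ?case
    by (simp add: rep_zero ip_def)
next
  case (add p q)
  then show ?case
    by (simp add: rep_add sp_adj_add ip_add_left ip_add_right rep_fsupp)
next
  case (scale c p)
  then show ?case
    by (simp add: rep_scale sp_adj_scale ip_scale_left ip_scale_right rep_fsupp)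
next
  case (gen \<xi>)
  then show ?case
    by (simp add: rep_gen rep_adj_gen ip_S_op)
next
  case (adj_gen \<xi>)
  then show ?case
    by (simp add: rep_gen rep_adj_gen ip_T_op)
next
  case (mult p q)
  then show ?case
    by (simp add: rep_mult sp_adj_mult rep_fsupp)
qed

text \<open>Ensures that the infimum in \<open>op_norm\<close> is taken over a non-empty
  set.\<close>

lemma rep_bounded: "p \<in> free_star (mor \<Lambda>) \<Longrightarrow> \<exists>B\<ge>0. \<forall>f\<in>fsupp. vnorm (rep p f) \<le> B * vnorm f"
proof (induction p rule: free_star_induct)
  case zero
  then show ?case
    by (intro exI[of _ 0]) (auto simp: rep_zero)
next
  case (add p q)
  then obtain B C where BC: "0 \<le> B" "\<And>f. f \<in> fsupp \<Longrightarrow> vnorm (rep p f) \<le> B * vnorm f"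
      "0 \<le> C" "\<And>f. f \<in> fsupp \<Longrightarrow> vnorm (rep q f) \<le> C * vnorm f"
    by blast
  have "vnorm (rep (p + q) f) \<le> (B + C) * vnorm f" if "f \<in> fsupp" for f
    using vnorm_add[OF rep_fsupp[OF add.hyps(1) that] rep_fsupp[OF add.hyps(2) that]]
      BC(2)[OF that] BC(4)[OF that] by (simp add: rep_add distrib_right)
  then show ?case
    using BC by (intro exI[of _ "B + C"]) auto
next
  case (scale c p)
  then obtain B where B: "0 \<le> B" "\<And>f. f \<in> fsupp \<Longrightarrow> vnorm (rep p f) \<le> B * vnorm f"
    by blast
  have "vnorm (rep (sp_scale c p) f) \<le> (cmod c * B) * vnorm f" if "f \<in> fsupp" for f
    using mult_left_mono[OF B(2)[OF that], of "cmod c"]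
    by (simp add: rep_scale vnorm_scale rep_fsupp scale.hyps that mult.assoc)
  then show ?case
    using B by (intro exI[of _ "cmod c * B"]) auto
next
  case (gen \<xi>)
  then show ?case
    using vnorm_S_op by (intro exI[of _ 1]) (auto simp: rep_gen)
next
  case (adj_gen \<xi>)
  then show ?case
    using vnorm_T_op by (intro exI[of _ 1]) (auto simp: rep_adj_gen)
next
  case (mult p q)
  then obtain B C where BC: "0 \<le> B" "\<And>f. f \<in> fsupp \<Longrightarrow> vnorm (rep p f) \<le> B * vnorm f"
      "0 \<le> C" "\<And>f. f \<in> fsupp \<Longrightarrow> vnorm (rep q f) \<le> C * vnorm f"
    by blast
  have "vnorm (rep (p * q) f) \<le> (B * C) * vnorm f" if "f \<in> fsupp" for f
    using BC(2)[OF rep_fsupp[OF mult.hyps(2) that]] mult_left_mono[OF BC(4)[OF that] BC(1)]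
    by (simp add: rep_mult mult.assoc)
  then show ?case
    using BC by (intro exI[of _ "B * C"]) auto
qed

section \<open>The operator norm of the representation as a C*-seminorm\<close>

definition op_norm :: "'l star_poly \<Rightarrow> real" where
  "op_norm p = Inf {B. 0 \<le> B \<and> (\<forall>f\<in>fsupp. vnorm (rep p f) \<le> B * vnorm f)}"

lemma op_norm_least:
  assumes "0 \<le> B" "\<And>f. f \<in> fsupp \<Longrightarrow> vnorm (rep p f) \<le> B * vnorm f"
  shows "op_norm p \<le> B"
  unfolding op_norm_def by (rule cInf_lower) (use assms in \<open>auto intro: bdd_belowI[of _ 0]\<close>)

lemma
  assumes p: "p \<in> free_star (mor \<Lambda>)"
  shows op_norm_nonneg: "0 \<le> op_norm p"
    and vnorm_rep_le: "f \<in> fsupp \<Longrightarrow> vnorm (rep p f) \<le> op_norm p * vnorm f"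
proof -
  let ?D = "{B. 0 \<le> B \<and> (\<forall>f\<in>fsupp. vnorm (rep p f) \<le> B * vnorm f)}"
  have ne: "?D \<noteq> {}"
    using rep_bounded[OF p] by blast
  show "0 \<le> op_norm p"
    unfolding op_norm_def by (rule cInf_greatest[OF ne]) auto
  assume f: "f \<in> fsupp"
  show "vnorm (rep p f) \<le> op_norm p * vnorm f"
  proof (cases "vnorm f = 0")
    case True
    obtain B where "\<forall>f\<in>fsupp. vnorm (rep p f) \<le> B * vnorm f"
      using rep_bounded[OF p] by blast
    with True f show ?thesis
      by force
  next
    case False
    then have pos: "0 < vnorm f"
      using vnorm_nonneg[of f] by simp
    have "vnorm (rep p f) / vnorm f \<le> op_norm p"
      unfolding op_norm_def by (rule cInf_greatest[OF ne]) (use f pos in \<open>auto simp: field_simps\<close>)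
    with pos show ?thesis
      by (simp add: field_simps)
  qed
qed

lemma cstar_seminorm_op_norm: "cstar_seminorm (mor \<Lambda>) op_norm"
proof (rule cstar_seminormI)
  show "0 \<le> op_norm p" if "p \<in> free_star (mor \<Lambda>)" for p
    using that by (rule op_norm_nonneg)
  show "op_norm (sp_scale c p) \<le> cmod c * op_norm p" if p: "p \<in> free_star (mor \<Lambda>)" for c p
  proof (rule op_norm_least)
    show "0 \<le> cmod c * op_norm p"
      using op_norm_nonneg[OF p] by simp
    show "vnorm (rep (sp_scale c p) f) \<le> cmod c * op_norm p * vnorm f" if f: "f \<in> fsupp" for f
      using mult_left_mono[OF vnorm_rep_le[OF p f], of "cmod c"]
      by (simp add: rep_scale vnorm_scale rep_fsupp p f mult.assoc)
  qed
  show "op_norm (p + q) \<le> op_norm p + op_norm q"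
    if p: "p \<in> free_star (mor \<Lambda>)" and q: "q \<in> free_star (mor \<Lambda>)" for p q
  proof (rule op_norm_least)
    show "0 \<le> op_norm p + op_norm q"
      using op_norm_nonneg[OF p] op_norm_nonneg[OF q] by simp
    show "vnorm (rep (p + q) f) \<le> (op_norm p + op_norm q) * vnorm f" if f: "f \<in> fsupp" for f
      using vnorm_add[OF rep_fsupp[OF p f] rep_fsupp[OF q f]] vnorm_rep_le[OF p f] vnorm_rep_le[OF q f]
      by (simp add: rep_add distrib_right)
  qed
  show "op_norm (p * q) \<le> op_norm p * op_norm q"
    if p: "p \<in> free_star (mor \<Lambda>)" and q: "q \<in> free_star (mor \<Lambda>)" for p q
  proof (rule op_norm_least)
    show "0 \<le> op_norm p * op_norm q"
      using op_norm_nonneg[OF p] op_norm_nonneg[OF q] by simp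
    show "vnorm (rep (p * q) f) \<le> op_norm p * op_norm q * vnorm f" if f: "f \<in> fsupp" for f
      using vnorm_rep_le[OF p rep_fsupp[OF q f]] mult_left_mono[OF vnorm_rep_le[OF q f] op_norm_nonneg[OF p]]
      by (simp add: rep_mult mult.assoc)
  qed
  show "(op_norm p)\<^sup>2 \<le> op_norm (sp_adj p * p)" if p: "p \<in> free_star (mor \<Lambda>)" for p
  proof -
    have pp: "sp_adj p * p \<in> free_star (mor \<Lambda>)"
      using p by auto
    have "op_norm p \<le> sqrt (op_norm (sp_adj p * p))"
    proof (rule op_norm_least)
      show "0 \<le> sqrt (op_norm (sp_adj p * p))"
        using op_norm_nonneg[OF pp] by simp
      show "vnorm (rep p f) \<le> sqrt (op_norm (sp_adj p * p)) * vnorm f" if f: "f \<in> fsupp" for f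
      proof -
        have "(vnorm (rep p f))\<^sup>2 = cmod (ip (rep p f) (rep p f))"
          by (simp add: ip_self norm_power)
        also have "\<dots> = cmod (ip f (rep (sp_adj p * p) f))"
          using ip_rep[OF p f rep_fsupp[OF p f]] by (simp add: rep_mult)
        also have "\<dots> \<le> vnorm f * vnorm (rep (sp_adj p * p) f)"
          using f rep_fsupp[OF pp f] by (rule cmod_ip_le)
        also have "\<dots> \<le> vnorm f * (op_norm (sp_adj p * p) * vnorm f)"
          using vnorm_rep_le[OF pp f] vnorm_nonneg by (rule mult_left_mono)
        also have "\<dots> = (sqrt (op_norm (sp_adj p * p)) * vnorm f)\<^sup>2"
          using op_norm_nonneg[OF pp] by (simp add: power_mult_distrib power2_eq_square)
        finally show ?thesis
          by (rule power2_le_imp_le) (simp add: vnorm_nonneg op_norm_nonneg[OF pp])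
      qed
    qed
    then have "(op_norm p)\<^sup>2 \<le> (sqrt (op_norm (sp_adj p * p)))\<^sup>2"
      using op_norm_nonneg[OF p] by (rule power_mono)
    then show ?thesis
      using op_norm_nonneg[OF pp] by simp
  qed
qed

lemma rep_relation:
  assumes fin: "finite_kgraph \<Lambda>" and h: "h \<in> ck_relations \<Lambda>"
  shows "rep h f = (\<lambda>_. 0)"
proof -
  have v: "S_op v f = (\<lambda>F. if bfilter v F then f F else 0)" "T_op v f = (\<lambda>F. if bfilter v F then f F else 0)"
    if "v \<in> vertices \<Lambda>" for v f
  proof -
    have "S_op v f F = (if bfilter v F then f F else 0) \<and> T_op v f F = (if bfilter v F then f F else 0)" for F
    proof (cases "bfilter v F")
      case True
      then show ?thesis
        using vertexD(3,4)[OF that]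
        by (simp add: S_op_def T_op_def bfilter_vertex(1)[OF True] quot_vertex[OF True] ext_vertex[OF True])
    qed (use vertexD(3,4)[OF that] in \<open>simp add: S_op_def T_op_def\<close>)
    then show "S_op v f = (\<lambda>F. if bfilter v F then f F else 0)" "T_op v f = (\<lambda>F. if bfilter v F then f F else 0)"
      by (simp_all add: fun_eq_iff)
  qed
  consider (idem) v where "h = gen v * gen v - gen v" "v \<in> vertices \<Lambda>"
    | (adj) v where "h = sp_adj (gen v) - gen v" "v \<in> vertices \<Lambda>"
    | (orth) v w where "h = gen v * gen w" "v \<in> vertices \<Lambda>" "w \<in> vertices \<Lambda>" "v \<noteq> w"
    | (cmp) \<mu> \<nu> where "h = gen \<mu> * gen \<nu> - gen (cmp \<Lambda> \<mu> \<nu>)" "\<mu> \<in> mor \<Lambda>" "\<nu> \<in> mor \<Lambda>" "sc \<Lambda> \<mu> = rg \<Lambda> \<nu>"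
    | (iso) \<xi> where "h = sp_adj (gen \<xi>) * gen \<xi> - gen (sc \<Lambda> \<xi>)" "\<xi> \<in> mor \<Lambda>"
    | (sum) v n where "h = gen v - (\<Sum>\<xi>\<in>with_range \<Lambda> v (upto_degree \<Lambda> n). gen \<xi> * sp_adj (gen \<xi>))"
        "v \<in> vertices \<Lambda>"
    using h unfolding ck_relations_def by (elim UnE CollectE exE conjE) (assumption | rule that)+
  then show ?thesis
  proof cases
    case idem
    then show ?thesis
      by (auto simp: rep_diff rep_mult rep_gen v)
  next
    case adj
    then show ?thesis
      by (auto simp: rep_diff rep_gen rep_adj_gen v)
  next
    case orth
    then show ?thesis
      using bfilter_range_unique[of v _ w] by (auto simp: fun_eq_iff rep_mult rep_gen v)
  next
    case cmp
    have "S_op \<mu> (S_op \<nu> f) F = S_op (cmp \<Lambda> \<mu> \<nu>) f F" for F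
    proof (cases "bfilter (rg \<Lambda> \<mu>) F")
      case True
      have "bfilter (rg \<Lambda> \<nu>) (quot \<mu> F)" if "\<mu> \<in> F"
        using bfilter_quot[OF lc True that] cmp(4) by simp
      then show ?thesis
        using True cmp_mem_bfilter_iff[OF True cmp(2-4)] quot_quot[OF cmp(2-4), of F] rg_cmp[OF cmp(2-4)]
        by (simp add: S_op_def)
    next
      case False
      then show ?thesis
        using rg_cmp[OF cmp(2-4)] by (simp add: S_op_def)
    qed
    then show ?thesis
      by (simp add: cmp(1) rep_diff rep_mult rep_gen)
  next
    case iso
    then show ?thesis
      by (simp add: rep_diff rep_mult rep_gen rep_adj_gen T_op_S_op)
  next
    case sum
    \<comment> \<open>At a boundary path \<open>F\<close> with range \<open>v\<close>, the term of
      \<open>\<xi>\<close> returns \<open>f F\<close> if \<open>\<xi>\<close> is an initial segment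
      of \<open>F\<close> and zero otherwise; exactly one member of \<open>?J\<close> is such a
      segment.\<close>
    let ?J = "with_range \<Lambda> v (upto_degree \<Lambda> n)"
    have finJ: "finite ?J"
      using finite_upto_degree[OF fin] by (simp add: with_range_def)
    have ST: "S_op \<xi> (T_op \<xi> f) F = (if bfilter v F \<and> \<xi> \<in> F then f F else 0)" if \<xi>: "\<xi> \<in> ?J" for \<xi> F
    proof -
      have r: "rg \<Lambda> \<xi> = v"
        using \<xi> by (simp add: with_range_def)
      show ?thesis
        using bfilter_quot[OF lc, of v F \<xi>] ext_quot[of v F \<xi>] by (auto simp: S_op_def T_op_def r)
    qed
    have "(\<Sum>\<xi>\<in>?J. S_op \<xi> (T_op \<xi> f) F) = S_op v f F" for F
    proof (cases "bfilter v F")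
      case True
      obtain \<zeta> where \<zeta>: "?J \<inter> F = {\<zeta>}"
        using bfilter_upto_unique[OF True] by blast
      have "(\<Sum>\<xi>\<in>?J. S_op \<xi> (T_op \<xi> f) F) = (\<Sum>\<xi>\<in>?J. if \<xi> \<in> F then f F else 0)"
        using True by (intro sum.cong) (auto simp: ST)
      also have "\<dots> = (\<Sum>\<xi>\<in>?J \<inter> F. f F)"
        using finJ by (rule sum.inter_restrict[symmetric])
      finally show ?thesis
        using True \<zeta> sum(2) by (simp add: v)
    next
      case False
      then show ?thesis
        using sum(2) by (simp add: ST v)
    qed
    then show ?thesis
      by (simp add: sum(1) rep_diff rep_sum rep_mult rep_gen rep_adj_gen)
  qed
qed

lemma op_norm_relation:
  assumes "finite_kgraph \<Lambda>" "h \<in> ck_relations \<Lambda>" 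
  shows "op_norm h = 0"
proof (rule antisym)
  show "op_norm h \<le> 0"
    by (rule op_norm_least) (auto simp: rep_relation[OF assms])
  show "0 \<le> op_norm h"
    unfolding op_norm_def
    by (rule cInf_greatest) (auto simp: rep_relation[OF assms] intro: exI[of _ 0])
qed

text \<open>The sum of the vertex projections fixes the point mass at a boundary path, and
  \<open>bfilter_exists\<close> provides one.\<close>

lemma op_norm_unit:
  assumes "finite_kgraph \<Lambda>"
  shows "op_norm (\<Sum>v\<in>vertices \<Lambda>. gen v) \<noteq> 0"
proof
  assume zero: "op_norm (\<Sum>v\<in>vertices \<Lambda>. gen v) = 0"
  have fin: "finite (vertices \<Lambda>)"
    using assms by (simp add: finite_kgraph_def)
  have mem: "(\<Sum>v\<in>vertices \<Lambda>. gen v) \<in> free_star (mor \<Lambda>)"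
    using vertexD(1) by (intro free_star_sum free_star_gen)
  obtain v where v: "v \<in> vertices \<Lambda>"
    using nonempty rg_vertex by blast
  obtain F where F: "bfilter v F"
    using bfilter_exists[OF lc v] .
  define f :: "'l set \<Rightarrow> complex" where "f = (\<lambda>x. if x = F then 1 else 0)"
  have f: "f \<in> fsupp"
    by (simp add: fsupp_def f_def)
  have "rep (\<Sum>v\<in>vertices \<Lambda>. gen v) f x = f x" for x
  proof -
    have "S_op w f x = (if w = v then f x else 0)" if w: "w \<in> vertices \<Lambda>" for w
    proof (cases "bfilter w x")
      case True
      then have "S_op w f x = f x"
        using vertexD[OF w] bfilter_vertex(1)[OF True] quot_vertex[OF True] by (simp add: S_op_def)
      moreover have "f x = 0" if "w \<noteq> v"
        using that True F bfilter_range_unique by (auto simp: f_def)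
      ultimately show ?thesis
        by auto
    next
      case False
      then have "S_op w f x = 0"
        using vertexD[OF w] by (simp add: S_op_def)
      with False F show ?thesis
        by (auto simp: f_def)
    qed
    then have "(\<Sum>w\<in>vertices \<Lambda>. S_op w f x) = (\<Sum>w\<in>vertices \<Lambda>. if w = v then f x else 0)"
      by (intro sum.cong) auto
    then show ?thesis
      using fin v by (simp add: rep_sum rep_gen)
  qed
  then have "rep (\<Sum>v\<in>vertices \<Lambda>. gen v) f = f"
    by blast
  then have "vnorm f \<le> 0"
    using vnorm_rep_le[OF mem f] zero by simp
  moreover have "vnorm f = 1"
    by (simp add: vnorm_def f_def L2_set_def)
  ultimately show False
    by simp
qed

end

end

text \<open>The bound is built by induction over the polynomial from the bound \<open>1\<close> on
  generators and their adjoints. Neither the base nor the steps depend on the seminorm, so it holds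
  for all of them at once.\<close>

lemma cstar_seminorm_univ_norm_graph:
  assumes "k_graph \<Lambda>" "finite_kgraph \<Lambda>"
  shows "cstar_seminorm (mor \<Lambda>) (univ_norm (mor \<Lambda>) (ck_relations \<Lambda>))"
    and "f \<in> free_star (mor \<Lambda>) \<Longrightarrow> cstar_seminorm (mor \<Lambda>) \<rho> \<Longrightarrow> \<forall>h\<in>ck_relations \<Lambda>. \<rho> h = 0 \<Longrightarrow>
      \<rho> f \<le> univ_norm (mor \<Lambda>) (ck_relations \<Lambda>) f"
proof -
  let ?SN = "\<lambda>\<rho>. cstar_seminorm (mor \<Lambda>) \<rho> \<and> (\<forall>h\<in>ck_relations \<Lambda>. \<rho> h = 0)"
  have fam: "ck_family \<Lambda> \<rho>" if "?SN \<rho>" for \<rho>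
    using that assms by (simp add: ck_family_def ck_family_axioms_def cstar_semi_def)
  have semi: "cstar_semi (mor \<Lambda>) \<rho>" if "?SN \<rho>" for \<rho>
    using that by (simp add: cstar_semi_def)
  have bd': "\<exists>B. \<forall>\<rho>. ?SN \<rho> \<longrightarrow> \<rho> f \<le> B" if "f \<in> free_star (mor \<Lambda>)" for f
    using that
  proof (induction f rule: free_star_induct)
    case zero
    show ?case
      using cstar_semi.rho_zero[OF semi] by (intro exI[of _ 0]) force
  next
    case (add f g)
    then obtain B C where BC: "\<And>\<rho>. ?SN \<rho> \<Longrightarrow> \<rho> f \<le> B" "\<And>\<rho>. ?SN \<rho> \<Longrightarrow> \<rho> g \<le> C"
      by metis
    have "\<rho> (f + g) \<le> B + C" if "?SN \<rho>" for \<rho>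
      using cstar_semi.rho_add[OF semi[OF that] add.hyps] BC[OF that] by linarith
    then show ?case
      by blast
  next
    case (scale c f)
    then obtain B where B: "\<And>\<rho>. ?SN \<rho> \<Longrightarrow> \<rho> f \<le> B"
      by metis
    have "\<rho> (sp_scale c f) \<le> cmod c * B" if "?SN \<rho>" for \<rho>
      using cstar_semi.rho_scale[OF semi[OF that] scale.hyps, of c] mult_left_mono[OF B[OF that], of "cmod c"]
      by simp
    then show ?case
      by blast
  next
    case (gen \<xi>)
    then show ?case
      using ck_family.rho_S_le_1(1)[OF fam] by blast
  next
    case (adj_gen \<xi>)
    then show ?case
      using ck_family.rho_S_le_1(2)[OF fam] by blast
  next
    case (mult f g)
    then obtain B C where BC: "\<And>\<rho>. ?SN \<rho> \<Longrightarrow> \<rho> f \<le> B" "\<And>\<rho>. ?SN \<rho> \<Longrightarrow> \<rho> g \<le> C"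
      by metis
    have "\<rho> (f * g) \<le> B * C" if \<rho>: "?SN \<rho>" for \<rho>
    proof -
      have nn: "0 \<le> \<rho> f" "0 \<le> \<rho> g"
        using cstar_semi.rho_nonneg[OF semi[OF \<rho>]] mult.hyps by auto
      have "\<rho> (f * g) \<le> \<rho> f * \<rho> g"
        using cstar_semi.rho_mult[OF semi[OF \<rho>] mult.hyps] .
      also have "\<dots> \<le> B * C"
        using BC[OF \<rho>] nn by (intro mult_mono) auto
      finally show ?thesis .
    qed
    then show ?case
      by blast
  qed
  have bd: "\<exists>B. \<forall>\<rho>. cstar_seminorm (mor \<Lambda>) \<rho> \<longrightarrow> (\<forall>h\<in>ck_relations \<Lambda>. \<rho> h = 0) \<longrightarrow> \<rho> f \<le> B"
    if "f \<in> free_star (mor \<Lambda>)" for f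
    using bd'[OF that] by blast
  show "cstar_seminorm (mor \<Lambda>) (univ_norm (mor \<Lambda>) (ck_relations \<Lambda>))"
    using bd by (rule cstar_seminorm_univ_norm)
  show "\<rho> f \<le> univ_norm (mor \<Lambda>) (ck_relations \<Lambda>) f"
    if "f \<in> free_star (mor \<Lambda>)" "cstar_seminorm (mor \<Lambda>) \<rho>" "\<forall>h\<in>ck_relations \<Lambda>. \<rho> h = 0"
    using bd[OF that(1)] univ_norm_upper[OF _ that(2,3)] by blast
qed

theorem proposition4p1:
  fixes \<Lambda> :: "('l, 'k::finite) kgraph"
  assumes "k_graph \<Lambda>"
    and "finite_kgraph \<Lambda>"
    and "locally_convex \<Lambda>"
    and "cofinal_kgraph \<Lambda>"
    and "no_local_periodicity \<Lambda>"
  shows "(\<not> (\<exists>\<xi>. is_cycle \<Lambda> \<xi>) \<longrightarrow> stable_rank (graph_cstar \<Lambda>) = 1) \<and>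
         ((\<exists>\<xi>. is_cycle \<Lambda> \<xi>) \<longrightarrow> stable_rank (graph_cstar \<Lambda>) = \<infinity>)"
proof -
  interpret k_graph \<Lambda>
    by fact
  let ?N = "univ_norm (mor \<Lambda>) (ck_relations \<Lambda>)"
  interpret ck_family \<Lambda> ?N
    by unfold_locales
      (use assms cstar_seminorm_univ_norm_graph(1) in \<open>auto simp: univ_norm_relation\<close>)
  interpret completion "mor \<Lambda>" "ck_relations \<Lambda>" unit
    by unfold_locales (rule unit_free_star)
  have A: "graph_cstar \<Lambda> = univ_cstar (mor \<Lambda>) (ck_relations \<Lambda>) unit"
    by (simp add: graph_cstar_def unit_def)
  have "stable_rank (graph_cstar \<Lambda>) = 1" if "\<not> (\<exists>\<xi>. is_cycle \<Lambda> \<xi>)"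
  proof -
    have "Lg_dense (graph_cstar \<Lambda>) 1"
      unfolding A using that by (intro Lg_dense_one acyclic_almost_invertible)
    then have "stable_rank (graph_cstar \<Lambda>) \<le> enat 1"
      unfolding stable_rank_def by (intro Inf_lower) auto
    moreover have "enat 1 \<le> stable_rank (graph_cstar \<Lambda>)"
      unfolding stable_rank_def by (intro Inf_greatest) auto
    ultimately show ?thesis
      by (simp add: one_enat_def)
  qed
  moreover have "stable_rank (graph_cstar \<Lambda>) = \<infinity>" if cycle: "is_cycle \<Lambda> \<xi>" for \<xi>
  proof -
    obtain s :: "nat \<Rightarrow> 'l star_poly" where s: "\<And>i. s i \<in> free_star (mor \<Lambda>)"
        "\<And>i j. eqv (sp_adj (s i) * s j) (if i = j then unit else 0)"
      using cycle_orthogonal_isometries[OF assms(3-5) cycle] by metis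
    \<comment> \<open>\<open>op_norm\<close> is one of the seminorms in the supremum, so the
      universal norm dominates it and the unit is not zero.\<close>
    have "op_norm unit \<le> ?N unit" "op_norm unit \<noteq> 0" "0 \<le> op_norm unit"
      using cstar_seminorm_univ_norm_graph(2)[OF assms(1,2) unit_free_star]
        cstar_seminorm_op_norm[OF assms(3)] op_norm_relation[OF assms(3,2)] op_norm_unit[OF assms(3,2)]
        op_norm_nonneg[OF assms(3) unit_free_star]
      by (auto simp: unit_def)
    then have "?N unit \<noteq> 0"
      by simp
    then have "\<not> Lg_dense (graph_cstar \<Lambda>) n" if "n \<ge> 1" for n
      unfolding A using that s
      by (intro not_Lg_dense[where s = s]) (auto intro: unit_mult mult_unit unit_adj)
    then have "{enat n |n. n \<ge> 1 \<and> Lg_dense (graph_cstar \<Lambda>) n} = {}"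
      by blast
    then show ?thesis
      unfolding stable_rank_def by (simp only: Inf_empty top_enat_def)
  qed
  ultimately show ?thesis
    by blast
qed

end
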